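(* Let $\Lambda$ be a rank-$r$ graph and let $\mathcal{V}=\{V_\lambda:\lambda\in\Lambda\}$ be a $\Lambda$-contraction on a Hilbert space $\mathsf{H}$. Suppose that $$\sum_{u\subset v}(-1)^{|u|}P_{u,v}\ge0\qquad\text{for every }v\subset\{1,\ldots,r\},$$ where the operators $P_{u,v}$ are those defined in the context. Then there exist a Hilbert space $\mathsf{K}\supset\mathsf{H}$ and a $\Lambda$-contraction $\mathcal{W}=\{W_\lambda:\lambda\in\Lambda\}$ on $\mathsf{K}$ consisting of partial isometries forming a Toeplitz $\Lambda$-family such that each $W_\lambda^*$ leaves $\mathsf{H}$ invariant and, for all $\lambda,\mu\in\Lambda$ such that for each $j\in\{1,\ldots,r\}$, $d(\lambda)_j\ne0$ implies $d(\mu)_j=0$, $$P_{\mathsf{H}}W_\lambda^*W_\mu|_{\mathsf{H}}=V_\lambda^*V_\mu.$$ One may assume that $\mathsf{K}=\overline{\mathrm{Lin}}\{W_\lambda\mathsf{H}:\lambda\in\Lambda\}$; under this assumption the family $\mathcal{W}$ is unique up to unitary equivalence.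
   Context: A rank-$r$ graph $\Lambda$ ($r\in\mathbb{N}$) is a small category with object set $\Lambda^0$ (objects are identified with their identity morphisms), range and source maps $r,s:\Lambda\to\Lambda^0$, and a shape functor $d:\Lambda\to\mathbb{N}_0^r$ with the factorisation property: for $m,n\in\mathbb{N}_0^r$ every $\lambda\in\Lambda$ with $d(\lambda)=m+n$ is a unique product $\lambda=\mu\nu$ with $d(\mu)=m$, $d(\nu)=n$, $s(\mu)=r(\nu)$. Write $\Lambda^n=\{\lambda:d(\lambda)=n\}$ and $\Lambda^n_a=\{\lambda\in\Lambda^n:s(\lambda)=a\}$. A $\Lambda$-contraction on a Hilbert space $\mathsf{H}$ is a family $\{V_\lambda:\lambda\in\Lambda\}\subset B(\mathsf{H})$ such that: (i) $V_\lambda V_\mu=0$ if $s(\lambda)\ne r(\mu)$; (ii) $V_\lambda V_\mu=V_{\lambda\mu}$ if $s(\lambda)=r(\mu)$; (iii) $\sum_{\lambda\in\Lambda^n}V_\lambda V_\lambda^*\le I$ for all $n\in\mathbb{N}_0^r$; (iv) each $V_a$ ($a\in\Lambda^0$) is an orthogonal projection. Infinite sums are understood in the strong operator topology. A Toeplitz $\Lambda$-family in $B(\mathsf{K})$ is a family of partial isometries $\{x_\lambda:\lambda\in\Lambda\}$ such that: (i) $\{x_a:a\in\Lambda^0\}$ are mutually orthogonal projections; (ii) $x_\lambda x_\mu=x_{\lambda\mu}$ if $s(\lambda)=r(\mu)$; (iii) $x_\lambda^*x_\lambda=x_{s(\lambda)}$ for $\lambda\in\Lambda$; (iv) if $n\in\mathbb{N}_0^r\setminus\{0\}$,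 $a\in\Lambda^0$ and $F\subset\{\lambda\in\Lambda^n:r(\lambda)=a\}$ is finite, then $x_a\ge\sum_{\lambda\in F}x_\lambda x_\lambda^*$. For $u\subset\{1,\ldots,r\}$ let $|u|$ be its cardinality and $e(u)=\sum_{i\in u}e_i\in\mathbb{N}_0^r$, where $e_1,\ldots,e_r$ is the canonical basis. For $u\subset v\subset\{1,\ldots,r\}$, $P_{u,v}$ is the operator on the Hilbert space $\bigoplus_{a\in\Lambda^0}\ell^2(\Lambda^{e(v)}_a;V_a\mathsf{H})$ given by the continuous linear extension of $$P_{u,v}(\delta_{\mu\nu}\otimes\xi)=\bigoplus_{a\in\Lambda^0}\ \sum_{\lambda\in\Lambda^{e(u)}_a,\ r(\lambda)=s(\mu)}\delta_{\mu\lambda}\otimes V_\lambda^*V_\nu\xi,$$ for $\mu\in\Lambda^{e(v)-e(u)}$, $\nu\in\Lambda^{e(u)}$, $r(\nu)=s(\mu)$, $\xi\in V_{s(\nu)}\mathsf{H}$. $P_{\mathsf{H}}$ is the orthogonal projection of $\mathsf{K}$ onto $\mathsf{H}$. Uniqueness up to unitary equivalence means that two families $\mathcal{W}$ on $\mathsf{K}$ and $\mathcal{W}'$ on $\mathsf{K}'$ with all the stated properties (including $\mathsf{K}=\overline{\mathrm{Lin}}\{W_\lambda\mathsf{H}:\lambda\in\Lambda\}$ and likewise for $\mathsf{K}'$) are intertwined by a unitary $U:\mathsf{K}\to\mathsf{K}'$, i.e. $UW_\lambda=W'_\lambda U$ for all $\lambda$.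
   Formalization: That one may assume K is the closed linear span of the W_λ H is proved only when the projections V_a, a∈Λ^0, sum strongly to the identity of H; this is necessary, since e.g. for V=0 on nonzero H the claim fails. Dilation existence and uniqueness are unrestricted. *)

theory Defs
  imports "HOL-Analysis.Analysis"
begin

section \<open>Complex Hilbert spaces\<close>

text \<open>
  The inner product is linear in the first argument; its real part is the real inner product of
  the class \<open>real_inner\<close>, so norm, metric and topology are those of the library.
\<close>

class complex_inner = real_inner +
  fixes scaleC :: "complex \<Rightarrow> 'a \<Rightarrow> 'a"  (infixr \<open>*\<^sub>C\<close> 75)
    and cinner :: "'a \<Rightarrow> 'a \<Rightarrow> complex"
  assumes scaleC_add_right: "c *\<^sub>C (x + y) = c *\<^sub>C x + c *\<^sub>C y"
    and scaleC_add_left: "(b + c) *\<^sub>C x = b *\<^sub>C x + c *\<^sub>C x"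
    and scaleC_scaleC: "b *\<^sub>C (c *\<^sub>C x) = (b * c) *\<^sub>C x"
    and scaleC_of_real: "complex_of_real t *\<^sub>C x = t *\<^sub>R x"
    and cinner_commute: "cinner x y = cnj (cinner y x)"
    and cinner_add_left: "cinner (x + y) z = cinner x z + cinner y z"
    and cinner_scaleC_left: "cinner (c *\<^sub>C x) y = c * cinner x y"
    and Re_cinner: "Re (cinner x y) = inner x y"

class chilbert_space = complex_inner + complete_space

instantiation complex :: chilbert_space
begin
definition scaleC_complex :: "complex \<Rightarrow> complex \<Rightarrow> complex" where
  "scaleC_complex c x = c * x"
definition cinner_complex :: "complex \<Rightarrow> complex \<Rightarrow> complex" where
  "cinner_complex x y = x * cnj y"
instance
  by standard (auto simp: scaleC_complex_def cinner_complex_def algebra_simps scaleR_conv_of_real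
      inner_complex_def)
end

lemma scaleC_imaginary_unit: "c *\<^sub>C x = Re c *\<^sub>R x + Im c *\<^sub>R (\<i> *\<^sub>C x)"
  for x :: "'a::complex_inner"
proof -
  have "c = of_real (Re c) + of_real (Im c) * \<i>"
    by (simp add: complex_eq mult.commute)
  then have "c *\<^sub>C x = (of_real (Re c) + of_real (Im c) * \<i>) *\<^sub>C x"
    by simp
  then show ?thesis
    by (simp only: scaleC_add_left scaleC_scaleC[symmetric] scaleC_of_real)
qed

lemma cinner_eq_inner: "cinner x y = Complex (inner x y) (- inner (\<i> *\<^sub>C x) y)"
proof -
  have "Re (cinner (\<i> *\<^sub>C x) y) = - Im (cinner x y)"
    by (simp add: cinner_scaleC_left)
  then show ?thesis
    by (simp add: complex_eq_iff Re_cinner)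
qed

lemma norm_scaleC: "norm (c *\<^sub>C x) = cmod c * norm x"
proof -
  have real: "Im (cinner x x) = 0"
    using arg_cong[OF cinner_commute[of x x], of Im] by simp
  have "cinner (c *\<^sub>C x) (c *\<^sub>C x) = c * cnj (cinner (c *\<^sub>C x) x)"
    by (subst cinner_scaleC_left, subst cinner_commute) (rule refl)
  also have "\<dots> = c * cnj c * cinner x x"
    by (simp add: cinner_scaleC_left mult.assoc flip: cinner_commute)
  finally have "cinner (c *\<^sub>C x) (c *\<^sub>C x) = c * cnj c * cinner x x" .
  then have "inner (c *\<^sub>C x) (c *\<^sub>C x) = (cmod c)\<^sup>2 * inner x x"
    using real by (simp add: Re_cinner[symmetric] cmod_power2) (simp add: power2_eq_square)
  then show ?thesis
    by (simp add: norm_eq_sqrt_inner real_sqrt_mult)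
qed

lemma inner_scaleC: "inner (c *\<^sub>C x) y = Re c * inner x y + Im c * inner (\<i> *\<^sub>C x) y"
  for x y :: "'a::complex_inner"
  by (subst scaleC_imaginary_unit) (simp add: inner_add_left)


section \<open>Square-summable families\<close>

text \<open>\<open>('i, 'h) ell2\<close> is the Hilbert space of square-summable families indexed by \<open>'i\<close>
  with values in \<open>'h\<close>.\<close>

typedef (overloaded) ('i, 'h::chilbert_space) ell2 =
  "{f :: 'i \<Rightarrow> 'h. (\<lambda>i. (norm (f i))\<^sup>2) summable_on UNIV}"
  morphisms coord Abs_ell2
  by (rule exI[of _ "\<lambda>_. 0"]) simp

setup_lifting type_definition_ell2

lemma norm_add_sq_le: "(norm (x + y))\<^sup>2 \<le> 2 * (norm x)\<^sup>2 + 2 * (norm y)\<^sup>2"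
  for x y :: "'a::real_normed_vector"
proof -
  have "(norm (x + y))\<^sup>2 \<le> (norm x + norm y)\<^sup>2"
    by (simp add: norm_triangle_ineq power_mono)
  also have "\<dots> \<le> 2 * (norm x)\<^sup>2 + 2 * (norm y)\<^sup>2"
    using sum_squares_bound[of "norm x" "norm y"] by (simp add: power2_sum)
  finally show ?thesis .
qed

lemma square_summable_add:
  fixes f g :: "'i \<Rightarrow> 'h::real_normed_vector"
  assumes "(\<lambda>i. (norm (f i))\<^sup>2) summable_on A" "(\<lambda>i. (norm (g i))\<^sup>2) summable_on A"
  shows "(\<lambda>i. (norm (f i + g i))\<^sup>2) summable_on A"
proof (rule summable_on_comparison_test)
  show "(\<lambda>i. 2 * (norm (f i))\<^sup>2 + 2 * (norm (g i))\<^sup>2) summable_on A"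
    by (intro summable_on_add summable_on_cmult_right assms)
qed (auto simp: norm_add_sq_le)

lemma inner_summable:
  fixes f g :: "'i \<Rightarrow> 'h::real_inner"
  assumes "(\<lambda>i. (norm (f i))\<^sup>2) summable_on A" "(\<lambda>i. (norm (g i))\<^sup>2) summable_on A"
  shows "(\<lambda>i. inner (f i) (g i)) summable_on A"
proof (rule abs_summable_summable, rule summable_on_comparison_test)
  show "(\<lambda>i. (norm (f i))\<^sup>2 + (norm (g i))\<^sup>2) summable_on A"
    by (intro summable_on_add assms)
  fix i
  have "norm (inner (f i) (g i)) \<le> norm (f i) * norm (g i)"
    by (simp add: Cauchy_Schwarz_ineq2)
  moreover have "2 * (norm (f i) * norm (g i)) \<le> (norm (f i))\<^sup>2 + (norm (g i))\<^sup>2"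
    using sum_squares_bound[of "norm (f i)" "norm (g i)"] by simp
  moreover have "0 \<le> norm (f i) * norm (g i)" by simp
  ultimately show "norm (inner (f i) (g i)) \<le> (norm (f i))\<^sup>2 + (norm (g i))\<^sup>2"
    by linarith
qed auto

lemma coord_summable: "(\<lambda>i. (norm (coord f i))\<^sup>2) summable_on UNIV"
  using coord[of f] by simp

instantiation ell2 :: (type, chilbert_space) real_inner
begin

lift_definition zero_ell2 :: "('a, 'b) ell2" is "\<lambda>_. 0" by simp

lift_definition plus_ell2 :: "('a, 'b) ell2 \<Rightarrow> ('a, 'b) ell2 \<Rightarrow> ('a, 'b) ell2"
  is "\<lambda>f g i. f i + g i" by (rule square_summable_add)

lift_definition uminus_ell2 :: "('a, 'b) ell2 \<Rightarrow> ('a, 'b) ell2" is "\<lambda>f i. - f i" by simp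

lift_definition minus_ell2 :: "('a, 'b) ell2 \<Rightarrow> ('a, 'b) ell2 \<Rightarrow> ('a, 'b) ell2"
  is "\<lambda>f g i. f i - g i"
  using square_summable_add[where g = "\<lambda>i. - _ i"] by simp

lift_definition scaleR_ell2 :: "real \<Rightarrow> ('a, 'b) ell2 \<Rightarrow> ('a, 'b) ell2"
  is "\<lambda>c f i. c *\<^sub>R f i"
  by (simp add: power_mult_distrib summable_on_cmult_right)

definition inner_ell2 :: "('a, 'b) ell2 \<Rightarrow> ('a, 'b) ell2 \<Rightarrow> real" where
  "inner_ell2 f g = (\<Sum>\<^sub>\<infinity>i. inner (coord f i) (coord g i))"

definition norm_ell2 :: "('a, 'b) ell2 \<Rightarrow> real" where
  "norm_ell2 f = sqrt (inner f f)"

definition sgn_ell2 :: "('a, 'b) ell2 \<Rightarrow> ('a, 'b) ell2" where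
  "sgn_ell2 f = inverse (norm f) *\<^sub>R f"

definition dist_ell2 :: "('a, 'b) ell2 \<Rightarrow> ('a, 'b) ell2 \<Rightarrow> real" where
  "dist_ell2 f g = norm (f - g)"

definition uniformity_ell2 :: "(('a, 'b) ell2 \<times> ('a, 'b) ell2) filter" where
  "uniformity_ell2 = (INF e\<in>{0 <..}. principal {(f, g). dist f g < e})"

definition open_ell2 :: "('a, 'b) ell2 set \<Rightarrow> bool" where
  "open_ell2 S \<longleftrightarrow> (\<forall>f\<in>S. \<forall>\<^sub>F (f', g) in uniformity. f' = f \<longrightarrow> g \<in> S)"

instance
proof
  fix f g h :: "('a, 'b) ell2" and a b :: real
  note summ = inner_summable[OF coord_summable coord_summable]
  show "f + g + h = f + (g + h)" by transfer (simp add: add.assoc)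
  show "f + g = g + f" by transfer (simp add: add.commute)
  show "0 + f = f" by transfer simp
  show "- f + f = 0" by transfer simp
  show "f - g = f + - g" by transfer simp
  show "a *\<^sub>R (f + g) = a *\<^sub>R f + a *\<^sub>R g" by transfer (simp add: scaleR_add_right)
  show "(a + b) *\<^sub>R f = a *\<^sub>R f + b *\<^sub>R f" by transfer (simp add: scaleR_add_left)
  show "a *\<^sub>R b *\<^sub>R f = (a * b) *\<^sub>R f" by transfer simp
  show "1 *\<^sub>R f = f" by transfer simp
  show "sgn f = inverse (norm f) *\<^sub>R f" by (rule sgn_ell2_def)
  show "dist f g = norm (f - g)" by (rule dist_ell2_def)
  show "uniformity = (INF e\<in>{0<..}. principal {(f::('a, 'b) ell2, g). dist f g < e})"
    by (rule uniformity_ell2_def)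
  show "open S \<longleftrightarrow> (\<forall>f\<in>S. \<forall>\<^sub>F (f', g) in uniformity. f' = f \<longrightarrow> g \<in> S)"
    for S :: "('a, 'b) ell2 set"
    by (rule open_ell2_def)
  show "inner f g = inner g f"
    unfolding inner_ell2_def by (rule infsum_cong, rule inner_commute)
  show "inner (f + g) h = inner f h + inner g h"
    by (simp add: inner_ell2_def plus_ell2.rep_eq inner_add_left infsum_add summ)
  show "inner (a *\<^sub>R f) g = a * inner f g"
    by (simp add: inner_ell2_def scaleR_ell2.rep_eq infsum_cmult_right')
  show "0 \<le> inner f f"
    unfolding inner_ell2_def by (rule infsum_nonneg) (rule inner_ge_zero)
  show "inner f f = 0 \<longleftrightarrow> f = 0"
  proof
    assume "inner f f = 0"
    then have le: "(\<Sum>\<^sub>\<infinity>i. inner (coord f i) (coord f i)) \<le> 0"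
      unfolding inner_ell2_def by (rule eq_refl)
    have "inner (coord f i) (coord f i) = 0" for i
      by (rule nonneg_infsum_le_0D[OF le summ inner_ge_zero UNIV_I])
    then have "coord f i = 0" for i by simp
    then show "f = 0" by transfer auto
  qed (simp add: inner_ell2_def zero_ell2.rep_eq)
  show "norm f = sqrt (inner f f)" by (rule norm_ell2_def)
qed

end

lemma norm_ell2_sq: "(norm f)\<^sup>2 = (\<Sum>\<^sub>\<infinity>i. (norm (coord f i))\<^sup>2)"
  unfolding power2_norm_eq_inner inner_ell2_def ..

lemma norm_coord_le: "norm (coord f i) \<le> norm f"
proof -
  have "sum (\<lambda>i. (norm (coord f i))\<^sup>2) {i} \<le> (norm f)\<^sup>2"
    unfolding norm_ell2_sq by (rule finite_sum_le_infsum[OF coord_summable]) auto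
  then have "(norm (coord f i))\<^sup>2 \<le> (norm f)\<^sup>2"
    by simp
  then show ?thesis
    by (rule power2_le_imp_le) simp
qed

instance ell2 :: (type, chilbert_space) complete_space
proof
  fix X :: "nat \<Rightarrow> ('a, 'b) ell2"
  assume X: "Cauchy X"
  have "Cauchy (\<lambda>n. coord (X n) i)" for i
  proof (rule metric_CauchyI)
    fix e :: real assume "e > 0"
    then obtain N where N: "\<And>m n. m \<ge> N \<Longrightarrow> n \<ge> N \<Longrightarrow> dist (X m) (X n) < e"
      using metric_CauchyD[OF X] by metis
    have "dist (coord (X m) i) (coord (X n) i) \<le> dist (X m) (X n)" for m n
      using norm_coord_le[of "X m - X n" i] by (simp add: dist_norm minus_ell2.rep_eq)
    then show "\<exists>N. \<forall>m\<ge>N. \<forall>n\<ge>N. dist (coord (X m) i) (coord (X n) i) < e"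
      using N by (meson le_less_trans)
  qed
  then have "\<exists>l. (\<lambda>n. coord (X n) i) \<longlonglongrightarrow> l" for i
    unfolding Cauchy_convergent_iff convergent_def .
  then obtain g where g: "\<And>i. (\<lambda>n. coord (X n) i) \<longlonglongrightarrow> g i"
    by metis
  have bound: "\<exists>N. \<forall>n\<ge>N. \<forall>F. finite F \<longrightarrow> (\<Sum>i\<in>F. (norm (coord (X n) i - g i))\<^sup>2) \<le> e\<^sup>2"
    if "e > 0" for e
  proof -
    obtain N where N: "\<And>m n. m \<ge> N \<Longrightarrow> n \<ge> N \<Longrightarrow> norm (X n - X m) < e"
      using metric_CauchyD[OF X \<open>e > 0\<close>] unfolding dist_norm by metis
    have "(\<Sum>i\<in>F. (norm (coord (X n) i - g i))\<^sup>2) \<le> e\<^sup>2" if "n \<ge> N" "finite F" for n F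
    proof (rule tendsto_upperbound)
      show "(\<lambda>m. \<Sum>i\<in>F. (norm (coord (X n) i - coord (X m) i))\<^sup>2)
          \<longlonglongrightarrow> (\<Sum>i\<in>F. (norm (coord (X n) i - g i))\<^sup>2)"
        by (intro tendsto_intros g)
      have "(\<Sum>i\<in>F. (norm (coord (X n) i - coord (X m) i))\<^sup>2) \<le> e\<^sup>2" if "m \<ge> N" for m
      proof -
        have "(\<Sum>i\<in>F. (norm (coord (X n - X m) i))\<^sup>2) \<le> (norm (X n - X m))\<^sup>2"
          unfolding norm_ell2_sq by (rule finite_sum_le_infsum[OF coord_summable]) (use \<open>finite F\<close> in auto)
        also have "\<dots> \<le> e\<^sup>2"
          using N[OF \<open>m \<ge> N\<close> \<open>n \<ge> N\<close>] by (simp add: power_mono)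
        finally show ?thesis by (simp add: minus_ell2.rep_eq)
      qed
      then show "\<forall>\<^sub>F m in sequentially. (\<Sum>i\<in>F. (norm (coord (X n) i - coord (X m) i))\<^sup>2) \<le> e\<^sup>2"
        by (auto simp: eventually_sequentially)
    qed simp
    then show ?thesis by blast
  qed
  have diff: "(\<lambda>i. (norm (coord (X n) i - g i))\<^sup>2) summable_on UNIV"
    if "\<forall>F. finite F \<longrightarrow> (\<Sum>i\<in>F. (norm (coord (X n) i - g i))\<^sup>2) \<le> e\<^sup>2" for n e
    by (intro nonneg_bdd_above_summable_on bdd_aboveI2[where M = "e\<^sup>2"]) (use that in auto)
  obtain N where "\<forall>F. finite F \<longrightarrow> (\<Sum>i\<in>F. (norm (coord (X N) i - g i))\<^sup>2) \<le> 1\<^sup>2"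
    using bound[of 1] by auto
  from diff[OF this] have "(\<lambda>i. (norm (g i - coord (X N) i))\<^sup>2) summable_on UNIV"
    by (simp add: norm_minus_commute)
  from square_summable_add[OF this coord_summable[of "X N"]]
  have gs: "(\<lambda>i. (norm (g i))\<^sup>2) summable_on UNIV"
    by simp
  define G where "G = Abs_ell2 g"
  have G: "coord G = g"
    using gs by (simp add: G_def Abs_ell2_inverse)
  have "X \<longlonglongrightarrow> G"
  proof (rule metric_LIMSEQ_I)
    fix e :: real assume "e > 0"
    then obtain N where N: "\<And>n. n \<ge> N \<Longrightarrow>
        \<forall>F. finite F \<longrightarrow> (\<Sum>i\<in>F. (norm (coord (X n) i - g i))\<^sup>2) \<le> (e/2)\<^sup>2"
      using bound[of "e/2"] by auto
    have "dist (X n) G < e" if "n \<ge> N" for n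
    proof -
      have "(norm (X n - G))\<^sup>2 \<le> (e/2)\<^sup>2"
        unfolding norm_ell2_sq minus_ell2.rep_eq G
        by (rule infsum_le_finite_sums[OF diff[OF N[OF that]]]) (use N[OF that] in auto)
      then have "norm (X n - G) \<le> e/2"
        by (rule power2_le_imp_le) (use \<open>e > 0\<close> in simp)
      then show ?thesis using \<open>e > 0\<close> by (simp add: dist_norm)
    qed
    then show "\<exists>N. \<forall>n\<ge>N. dist (X n) G < e" by blast
  qed
  then show "convergent X" by (auto simp: convergent_def)
qed

lemma cinner_summable:
  fixes f g :: "'i \<Rightarrow> 'h::complex_inner"
  assumes "(\<lambda>i. (norm (f i))\<^sup>2) summable_on A" "(\<lambda>i. (norm (g i))\<^sup>2) summable_on A"
  shows "(\<lambda>i. cinner (f i) (g i)) summable_on A"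
proof -
  have "(\<lambda>i. inner (f i) (g i)) summable_on A"
    by (rule inner_summable[OF assms])
  moreover have "(\<lambda>i. inner (\<i> *\<^sub>C f i) (g i)) summable_on A"
    by (rule inner_summable) (simp_all add: assms norm_scaleC)
  ultimately have "(\<lambda>i. complex_of_real (inner (f i) (g i))
      + (- \<i>) * complex_of_real (inner (\<i> *\<^sub>C f i) (g i))) summable_on A"
    by (intro summable_on_add summable_on_cmult_right summable_on_of_real)
  moreover have "(\<lambda>i. cinner (f i) (g i)) = (\<lambda>i. complex_of_real (inner (f i) (g i))
      + (- \<i>) * complex_of_real (inner (\<i> *\<^sub>C f i) (g i)))"
    by (rule ext, subst cinner_eq_inner) (simp add: complex_eq_iff)
  ultimately show ?thesis by simp
qed

instantiation ell2 :: (type, chilbert_space) chilbert_space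
begin

lift_definition scaleC_ell2 :: "complex \<Rightarrow> ('a, 'b) ell2 \<Rightarrow> ('a, 'b) ell2"
  is "\<lambda>c f i. c *\<^sub>C f i"
  by (simp add: norm_scaleC power_mult_distrib summable_on_cmult_right)

definition cinner_ell2 :: "('a, 'b) ell2 \<Rightarrow> ('a, 'b) ell2 \<Rightarrow> complex" where
  "cinner_ell2 f g = (\<Sum>\<^sub>\<infinity>i. cinner (coord f i) (coord g i))"

instance
proof
  fix f g h :: "('a, 'b) ell2" and b c :: complex and t :: real
  note summ = cinner_summable[OF coord_summable coord_summable]
  show "c *\<^sub>C (f + g) = c *\<^sub>C f + c *\<^sub>C g" by transfer (simp add: scaleC_add_right)
  show "(b + c) *\<^sub>C f = b *\<^sub>C f + c *\<^sub>C f" by transfer (simp add: scaleC_add_left)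
  show "b *\<^sub>C c *\<^sub>C f = (b * c) *\<^sub>C f" by transfer (simp add: scaleC_scaleC)
  show "complex_of_real t *\<^sub>C f = t *\<^sub>R f" by transfer (simp add: scaleC_of_real)
  show "cinner f g = cnj (cinner g f)"
    unfolding cinner_ell2_def infsum_cnj[symmetric] by (rule infsum_cong, rule cinner_commute)
  show "cinner (f + g) h = cinner f h + cinner g h"
    by (simp add: cinner_ell2_def plus_ell2.rep_eq cinner_add_left infsum_add summ)
  show "cinner (c *\<^sub>C f) g = c * cinner f g"
    by (simp add: cinner_ell2_def scaleC_ell2.rep_eq cinner_scaleC_left infsum_cmult_right')
  show "Re (cinner f g) = inner f g"
    unfolding cinner_ell2_def inner_ell2_def infsum_Re[OF summ, symmetric] Re_cinner ..
qed

end

text \<open>The elementary tensor \<open>\<delta>\<^sub>i \<otimes> \<xi>\<close> of \<open>\<ell>\<^sup>2('i) \<otimes> 'h\<close>.\<close>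

lift_definition delta :: "'i \<Rightarrow> 'h::chilbert_space \<Rightarrow> ('i, 'h) ell2"
  is "\<lambda>i \<xi> j. if j = i then \<xi> else 0"
proof -
  fix i :: 'i and \<xi> :: 'h
  have "(\<lambda>j. (norm (if j = i then \<xi> else 0))\<^sup>2) summable_on {i}" by simp
  then show "(\<lambda>j. (norm (if j = i then \<xi> else 0))\<^sup>2) summable_on UNIV"
    by (rule summable_on_cong_neutral[THEN iffD1, rotated -1]) auto
qed


section \<open>Operators\<close>

text \<open>
  A Hilbert space is rendered as a closed complex subspace \<open>S\<close> of some type of class
  \<open>chilbert_space\<close>. Operators on \<open>S\<close> are functions on the type; only their values on \<open>S\<close> matter.
\<close>

definition csubspace :: "'a::complex_inner set \<Rightarrow> bool" where
  "csubspace S \<longleftrightarrow> 0 \<in> S \<and> (\<forall>x\<in>S. \<forall>y\<in>S. x + y \<in> S) \<and> (\<forall>c. \<forall>x\<in>S. c *\<^sub>C x \<in> S)"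

definition closed_csubspace :: "'a::chilbert_space set \<Rightarrow> bool" where
  "closed_csubspace S \<longleftrightarrow> csubspace S \<and> closed S"

definition closed_cspan :: "'a::chilbert_space set \<Rightarrow> 'a set" where
  "closed_cspan X = closure (csubspace hull X)"

definition clinear_on :: "'a::complex_inner set \<Rightarrow> ('a \<Rightarrow> 'b::complex_inner) \<Rightarrow> bool" where
  "clinear_on S T \<longleftrightarrow> (\<forall>x\<in>S. \<forall>y\<in>S. T (x + y) = T x + T y) \<and> (\<forall>c. \<forall>x\<in>S. T (c *\<^sub>C x) = c *\<^sub>C T x)"

definition bounded_op :: "'a::chilbert_space set \<Rightarrow> ('a \<Rightarrow> 'a) \<Rightarrow> bool" where
  "bounded_op S T \<longleftrightarrow> T \<in> S \<rightarrow> S \<and> clinear_on S T \<and> (\<exists>B. \<forall>x\<in>S. norm (T x) \<le> B * norm x)"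

definition adj :: "'a::chilbert_space set \<Rightarrow> ('a \<Rightarrow> 'a) \<Rightarrow> 'a \<Rightarrow> 'a" where
  "adj S T y = (THE z. z \<in> S \<and> (\<forall>x\<in>S. cinner (T x) y = cinner x z))"

definition op_nonneg :: "'a::chilbert_space set \<Rightarrow> ('a \<Rightarrow> 'a) \<Rightarrow> bool" where
  "op_nonneg S T \<longleftrightarrow> (\<forall>x\<in>S. cinner (T x) x \<in> \<real>\<^sub>\<ge>\<^sub>0)"

definition op_le :: "'a::chilbert_space set \<Rightarrow> ('a \<Rightarrow> 'a) \<Rightarrow> ('a \<Rightarrow> 'a) \<Rightarrow> bool" where
  "op_le S A B \<longleftrightarrow> op_nonneg S (\<lambda>x. B x - A x)"

definition orth_projection :: "'a::chilbert_space set \<Rightarrow> ('a \<Rightarrow> 'a) \<Rightarrow> bool" where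
  "orth_projection S T \<longleftrightarrow> bounded_op S T \<and> (\<forall>x\<in>S. T (T x) = T x) \<and> (\<forall>x\<in>S. adj S T x = T x)"

definition partial_isometry :: "'a::chilbert_space set \<Rightarrow> ('a \<Rightarrow> 'a) \<Rightarrow> bool" where
  "partial_isometry S T \<longleftrightarrow> bounded_op S T \<and>
     (\<forall>x\<in>S. (\<forall>y\<in>S. T y = 0 \<longrightarrow> cinner x y = 0) \<longrightarrow> norm (T x) = norm x)"

definition proj_onto :: "'a::chilbert_space set \<Rightarrow> 'a \<Rightarrow> 'a" where
  "proj_onto M x = (THE y. y \<in> M \<and> (\<forall>z\<in>M. cinner (x - y) z = 0))"

definition isometry_on ::
    "'a::chilbert_space set \<Rightarrow> 'b::chilbert_space set \<Rightarrow> ('a \<Rightarrow> 'b) \<Rightarrow> bool" where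
  "isometry_on S S' U \<longleftrightarrow> U \<in> S \<rightarrow> S' \<and> clinear_on S U \<and> (\<forall>x\<in>S. \<forall>y\<in>S. cinner (U x) (U y) = cinner x y)"

definition unitary_on ::
    "'a::chilbert_space set \<Rightarrow> 'b::chilbert_space set \<Rightarrow> ('a \<Rightarrow> 'b) \<Rightarrow> bool" where
  "unitary_on S S' U \<longleftrightarrow> isometry_on S S' U \<and> U ` S = S'"


section \<open>Higher-rank graphs\<close>

text \<open>The rank is the cardinality of the finite index type \<open>'r\<close>; shapes are vectors in \<open>nat ^ 'r\<close>.\<close>

record ('l, 'r::finite) rank_graph_data =
  mor :: "'l set"
  obj :: "'l set"
  rng :: "'l \<Rightarrow> 'l"
  src :: "'l \<Rightarrow> 'l"
  cmp :: "'l \<Rightarrow> 'l \<Rightarrow> 'l"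
  deg :: "'l \<Rightarrow> nat ^ 'r"

locale rank_graph =
  fixes \<Lambda> :: "('l, 'r::finite) rank_graph_data"
  assumes obj_mor: "obj \<Lambda> \<subseteq> mor \<Lambda>"
    and rng_obj: "l \<in> mor \<Lambda> \<Longrightarrow> rng \<Lambda> l \<in> obj \<Lambda>"
    and src_obj: "l \<in> mor \<Lambda> \<Longrightarrow> src \<Lambda> l \<in> obj \<Lambda>"
    and rng_id: "a \<in> obj \<Lambda> \<Longrightarrow> rng \<Lambda> a = a"
    and src_id: "a \<in> obj \<Lambda> \<Longrightarrow> src \<Lambda> a = a"
    and cmp_mor: "\<lbrakk>l \<in> mor \<Lambda>; m \<in> mor \<Lambda>; src \<Lambda> l = rng \<Lambda> m\<rbrakk> \<Longrightarrow> cmp \<Lambda> l m \<in> mor \<Lambda>"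
    and rng_cmp: "\<lbrakk>l \<in> mor \<Lambda>; m \<in> mor \<Lambda>; src \<Lambda> l = rng \<Lambda> m\<rbrakk> \<Longrightarrow> rng \<Lambda> (cmp \<Lambda> l m) = rng \<Lambda> l"
    and src_cmp: "\<lbrakk>l \<in> mor \<Lambda>; m \<in> mor \<Lambda>; src \<Lambda> l = rng \<Lambda> m\<rbrakk> \<Longrightarrow> src \<Lambda> (cmp \<Lambda> l m) = src \<Lambda> m"
    and cmp_assoc: "\<lbrakk>k \<in> mor \<Lambda>; l \<in> mor \<Lambda>; m \<in> mor \<Lambda>; src \<Lambda> k = rng \<Lambda> l; src \<Lambda> l = rng \<Lambda> m\<rbrakk> \<Longrightarrow>
           cmp \<Lambda> (cmp \<Lambda> k l) m = cmp \<Lambda> k (cmp \<Lambda> l m)"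
    and cmp_id_left: "l \<in> mor \<Lambda> \<Longrightarrow> cmp \<Lambda> (rng \<Lambda> l) l = l"
    and cmp_id_right: "l \<in> mor \<Lambda> \<Longrightarrow> cmp \<Lambda> l (src \<Lambda> l) = l"
    and deg_id: "a \<in> obj \<Lambda> \<Longrightarrow> deg \<Lambda> a = 0"
    and deg_cmp: "\<lbrakk>l \<in> mor \<Lambda>; m \<in> mor \<Lambda>; src \<Lambda> l = rng \<Lambda> m\<rbrakk> \<Longrightarrow>
           deg \<Lambda> (cmp \<Lambda> l m) = deg \<Lambda> l + deg \<Lambda> m"
    and factorisation: "\<lbrakk>l \<in> mor \<Lambda>; deg \<Lambda> l = p + q\<rbrakk> \<Longrightarrow>
           \<exists>!(\<mu>, \<nu>). \<mu> \<in> mor \<Lambda> \<and> \<nu> \<in> mor \<Lambda> \<and> deg \<Lambda> \<mu> = p \<and> deg \<Lambda> \<nu> = q \<and>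
             src \<Lambda> \<mu> = rng \<Lambda> \<nu> \<and> l = cmp \<Lambda> \<mu> \<nu>"

definition mor_deg :: "('l, 'r::finite) rank_graph_data \<Rightarrow> nat ^ 'r \<Rightarrow> 'l set" where
  "mor_deg \<Lambda> n = {l \<in> mor \<Lambda>. deg \<Lambda> l = n}"

definition e_vec :: "'r::finite set \<Rightarrow> nat ^ 'r" where
  "e_vec u = (\<Sum>i\<in>u. axis i 1)"


section \<open>Contractions, Toeplitz families and dilations\<close>

text \<open>Strong operator sums are the unconditional pointwise sums \<open>infsum\<close>.\<close>

definition contraction ::
    "('l, 'r::finite) rank_graph_data \<Rightarrow> 'a::chilbert_space set \<Rightarrow> ('l \<Rightarrow> 'a \<Rightarrow> 'a) \<Rightarrow> bool" where
  "contraction \<Lambda> S V \<longleftrightarrow>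
     (\<forall>l\<in>mor \<Lambda>. bounded_op S (V l)) \<and>
     (\<forall>l\<in>mor \<Lambda>. \<forall>m\<in>mor \<Lambda>. src \<Lambda> l \<noteq> rng \<Lambda> m \<longrightarrow> (\<forall>x\<in>S. V l (V m x) = 0)) \<and>
     (\<forall>l\<in>mor \<Lambda>. \<forall>m\<in>mor \<Lambda>. src \<Lambda> l = rng \<Lambda> m \<longrightarrow> (\<forall>x\<in>S. V l (V m x) = V (cmp \<Lambda> l m) x)) \<and>
     (\<forall>n. (\<forall>x\<in>S. (\<lambda>l. V l (adj S (V l) x)) summable_on mor_deg \<Lambda> n) \<and>
          op_le S (\<lambda>x. \<Sum>\<^sub>\<infinity>l\<in>mor_deg \<Lambda> n. V l (adj S (V l) x)) (\<lambda>x. x)) \<and>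
     (\<forall>a\<in>obj \<Lambda>. orth_projection S (V a))"

definition toeplitz_family ::
    "('l, 'r::finite) rank_graph_data \<Rightarrow> 'a::chilbert_space set \<Rightarrow> ('l \<Rightarrow> 'a \<Rightarrow> 'a) \<Rightarrow> bool" where
  "toeplitz_family \<Lambda> S X \<longleftrightarrow>
     (\<forall>l\<in>mor \<Lambda>. partial_isometry S (X l)) \<and>
     (\<forall>a\<in>obj \<Lambda>. orth_projection S (X a)) \<and>
     (\<forall>a\<in>obj \<Lambda>. \<forall>b\<in>obj \<Lambda>. a \<noteq> b \<longrightarrow> (\<forall>x\<in>S. X a (X b x) = 0)) \<and>
     (\<forall>l\<in>mor \<Lambda>. \<forall>m\<in>mor \<Lambda>. src \<Lambda> l = rng \<Lambda> m \<longrightarrow> (\<forall>x\<in>S. X l (X m x) = X (cmp \<Lambda> l m) x)) \<and>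
     (\<forall>l\<in>mor \<Lambda>. \<forall>x\<in>S. adj S (X l) (X l x) = X (src \<Lambda> l) x) \<and>
     (\<forall>n. \<forall>a\<in>obj \<Lambda>. \<forall>F. n \<noteq> 0 \<longrightarrow> finite F \<longrightarrow> F \<subseteq> {l \<in> mor_deg \<Lambda> n. rng \<Lambda> l = a} \<longrightarrow>
        op_le S (\<lambda>x. \<Sum>l\<in>F. X l (adj S (X l) x)) (X a))"

text \<open>The direct sum over the vertices \<open>a\<close> of the spaces \<open>\<ell>\<^sup>2\<close> of families in \<open>V a H\<close> indexed by
  the morphisms of shape \<open>e_vec v\<close> with source \<open>a\<close>. These index sets partition
  \<open>mor_deg \<Lambda> (e_vec v)\<close>, so an element is one square-summable family on that set, with entry at
  \<open>\<kappa>\<close> in \<open>V (src \<Lambda> \<kappa>) H\<close>.\<close>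

definition E_space ::
    "('l, 'r::finite) rank_graph_data \<Rightarrow> ('l \<Rightarrow> 'h::chilbert_space \<Rightarrow> 'h) \<Rightarrow> 'r set \<Rightarrow> ('l, 'h) ell2 set" where
  "E_space \<Lambda> V v = {f. \<forall>\<kappa>. if \<kappa> \<in> mor_deg \<Lambda> (e_vec v) then coord f \<kappa> \<in> range (V (src \<Lambda> \<kappa>)) else coord f \<kappa> = 0}"

text \<open>Vanishing off \<open>E_space\<close> only fixes irrelevant values, so that the description is definite.
  The sum over \<open>l\<close> merges the direct sum over \<open>a\<close> with the sums over the \<open>l\<close> with source \<open>a\<close>.\<close>

definition P_op ::
    "('l, 'r::finite) rank_graph_data \<Rightarrow> ('l \<Rightarrow> 'h::chilbert_space \<Rightarrow> 'h) \<Rightarrow> 'r set \<Rightarrow> 'r set \<Rightarrow>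
     ('l, 'h) ell2 \<Rightarrow> ('l, 'h) ell2" where
  "P_op \<Lambda> V u v = (THE T. bounded_op (E_space \<Lambda> V v) T \<and> (\<forall>f. f \<notin> E_space \<Lambda> V v \<longrightarrow> T f = 0) \<and>
     (\<forall>\<mu>\<in>mor_deg \<Lambda> (e_vec v - e_vec u). \<forall>\<nu>\<in>mor_deg \<Lambda> (e_vec u). rng \<Lambda> \<nu> = src \<Lambda> \<mu> \<longrightarrow>
       (\<forall>\<xi>\<in>range (V (src \<Lambda> \<nu>)).
          T (delta (cmp \<Lambda> \<mu> \<nu>) \<xi>) =
            (\<Sum>\<^sub>\<infinity>l\<in>{l \<in> mor_deg \<Lambda> (e_vec u). rng \<Lambda> l = src \<Lambda> \<mu>}.
               delta (cmp \<Lambda> \<mu> l) (adj UNIV (V l) (V \<nu> \<xi>))))))"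

text \<open>The inclusion of \<open>H\<close>, the whole type \<open>'h\<close>, into \<open>K\<close> is an isometry \<open>J\<close>; the subspace
  written \<open>H\<close> on the side of \<open>K\<close> is \<open>range J\<close>. The vectors of \<open>H\<close> and of the \<open>W l H\<close> are
  indexed by \<open>'l option \<times> 'h\<close>, so a Hilbert space spanned by them always embeds in
  \<open>('l option \<times> 'h, complex) ell2\<close>: existence of \<open>K\<close> can be stated over that type.\<close>

definition toeplitz_dilation ::
    "('l, 'r::finite) rank_graph_data \<Rightarrow> ('l \<Rightarrow> 'h::chilbert_space \<Rightarrow> 'h) \<Rightarrow>
     'k::chilbert_space set \<Rightarrow> ('h \<Rightarrow> 'k) \<Rightarrow> ('l \<Rightarrow> 'k \<Rightarrow> 'k) \<Rightarrow> bool" where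
  "toeplitz_dilation \<Lambda> V K J W \<longleftrightarrow>
     closed_csubspace K \<and> isometry_on UNIV K J \<and>
     contraction \<Lambda> K W \<and> toeplitz_family \<Lambda> K W \<and>
     (\<forall>l\<in>mor \<Lambda>. adj K (W l) ` range J \<subseteq> range J) \<and>
     (\<forall>l\<in>mor \<Lambda>. \<forall>m\<in>mor \<Lambda>. (\<forall>j. deg \<Lambda> l $ j \<noteq> 0 \<longrightarrow> deg \<Lambda> m $ j = 0) \<longrightarrow>
        (\<forall>h. proj_onto (range J) (adj K (W l) (W m (J h))) = J (adj UNIV (V l) (V m h))))"

definition minimal_dilation ::
    "('l, 'r::finite) rank_graph_data \<Rightarrow> 'k::chilbert_space set \<Rightarrow> ('h \<Rightarrow> 'k) \<Rightarrow>
     ('l \<Rightarrow> 'k \<Rightarrow> 'k) \<Rightarrow> bool" where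
  "minimal_dilation \<Lambda> K J W \<longleftrightarrow> K = closed_cspan (\<Union>l\<in>mor \<Lambda>. W l ` range J)"

definition unitarily_equivalent ::
    "('l, 'r::finite) rank_graph_data \<Rightarrow> 'k::chilbert_space set \<Rightarrow> ('l \<Rightarrow> 'k \<Rightarrow> 'k) \<Rightarrow>
     'm::chilbert_space set \<Rightarrow> ('l \<Rightarrow> 'm \<Rightarrow> 'm) \<Rightarrow> bool" where
  "unitarily_equivalent \<Lambda> K W K' W' \<longleftrightarrow>
     (\<exists>U. unitary_on K K' U \<and> (\<forall>l\<in>mor \<Lambda>. \<forall>x\<in>K. U (W l x) = W' l (U x)))"

text \<open>A minimal dilation forces nondegeneracy: for a vertex \<open>a\<close>, \<open>W a\<close> extends \<open>V a\<close>, so a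
  vector of \<open>H\<close> killed by every \<open>V a\<close> is orthogonal to the range of every \<open>W l\<close>. For
  instance, \<open>V = 0\<close> on a nonzero space is a contraction that dilates trivially, but not minimally.\<close>

definition nondegenerate ::
    "('l, 'r::finite) rank_graph_data \<Rightarrow> ('l \<Rightarrow> 'h::chilbert_space \<Rightarrow> 'h) \<Rightarrow> bool" where
  "nondegenerate \<Lambda> V \<longleftrightarrow> (\<forall>x. ((\<lambda>a. V a x) has_sum x) (obj \<Lambda>))"

end

theory Submission
  imports Defs
begin

text \<open>
  In a Toeplitz dilation the inner product of \<open>W l h\<close> and \<open>W m k\<close> is forced. Split off from \<open>l\<close>
  and \<open>m\<close> the prefixes of degree \<open>p = min (deg l) (deg m)\<close>. If they differ, the ranges are
  orthogonal; if they agree, they cancel and leave the inner product of \<open>V l' h\<close> and \<open>V m' k\<close>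
  for the suffixes \<open>l'\<close> and \<open>m'\<close>. So a minimal dilation is unique, and it exists once this kernel
  is positive definite.

  For positivity, put \<open>g \<mu> = (\<Sum>\<nu>. V \<nu> (h (\<mu>\<nu>)))\<close> for a finitely supported family \<open>h\<close>. Since
  \<open>(\<Sum>u. (-1) ^ card u)\<close> over the \<open>u\<close> with \<open>e_vec u \<le> p\<close> vanishes unless \<open>p = 0\<close>, the quadratic form of
  the kernel at \<open>h\<close> is the sum over \<open>\<mu>\<close> and \<open>u\<close> of \<open>(-1) ^ card u\<close> times the squared norm of
  \<open>(\<Sum>\<alpha>. V \<alpha> (g (\<mu>\<alpha>)))\<close>, where \<open>\<alpha>\<close> has degree \<open>e_vec u\<close>. Collecting the terms in which
  \<open>\<mu>\<alpha>\<close> has a given degree \<open>n\<close> produces values of the quadratic form of the hypothesis for the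
  support \<open>v\<close> of \<open>n\<close>.
\<close>

section \<open>Inner product spaces\<close>

text \<open>Positive definiteness of the kernel alone would not suffice. Without nondegeneracy the
  original space need not lie in the closed span of the vectors \<open>W l h\<close>, so its vectors
  \<open>h\<close> are adjoined as generators of their own, paired with \<open>W l k\<close> through
  \<open>V l k\<close>. Completing the square then asks the kernel form of a family to dominate the
  squared norm of the sum of the \<open>V l (h l)\<close>. The count by degree gives exactly this:
  the terms of total degree zero add up to that squared norm, and every other degree contributes a
  nonnegative amount.

  Two obstacles shape the rest. \<open>P_op\<close> is described only by its values on elementary
  tensors, so a bounded operator with these values has to be produced before the hypothesis can be
  used; its boundedness comes from the Bessel inequality of a contraction and the dual inequality
  for rows. And \<open>K\<close> has to be a subset of a fixed type, so instead of a quotient and a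
  completion the kernel is realised by vectors of a square-summable sequence space over its own
  index set. Operators on \<open>K\<close> are then prescribed on generators, and each Toeplitz
  relation becomes an identity of the kernel.\<close>

lemma bounded_bilinear_scaleC:
  "bounded_bilinear (scaleC :: complex \<Rightarrow> 'a::complex_inner \<Rightarrow> 'a)"
proof
  fix a a' :: complex and b b' :: 'a and r :: real
  show "(a + a') *\<^sub>C b = a *\<^sub>C b + a' *\<^sub>C b" by (rule scaleC_add_left)
  show "a *\<^sub>C (b + b') = a *\<^sub>C b + a *\<^sub>C b'" by (rule scaleC_add_right)
  show "(r *\<^sub>R a) *\<^sub>C b = r *\<^sub>R a *\<^sub>C b"
    by (simp add: scaleR_conv_of_real scaleC_scaleC flip: scaleC_of_real)
  show "a *\<^sub>C r *\<^sub>R b = r *\<^sub>R a *\<^sub>C b"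
    by (simp add: scaleC_scaleC mult.commute flip: scaleC_of_real)
  show "\<exists>K. \<forall>(a::complex) (b::'a). norm (a *\<^sub>C b) \<le> norm a * norm b * K"
    by (rule exI[of _ 1]) (simp add: norm_scaleC)
qed

interpretation scaleC: bounded_bilinear "scaleC :: complex \<Rightarrow> 'a::complex_inner \<Rightarrow> 'a"
  by (rule bounded_bilinear_scaleC)

lemma scaleC_one [simp]: "1 *\<^sub>C x = x"
  using scaleC_of_real[of 1 x] by simp

lemma scaleC_minus_one: "(- 1) *\<^sub>C x = - x"
  by (simp add: scaleC.minus_left)

lemma cinner_add_right: "cinner x (y + z) = cinner x y + cinner x z"
  by (subst (1 2 3) cinner_commute) (simp add: cinner_add_left)

lemma cinner_scaleC_right: "cinner x (c *\<^sub>C y) = cnj c * cinner x y"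
  by (subst (1 2) cinner_commute) (simp add: cinner_scaleC_left)

lemma cinner_self: "cinner x x = complex_of_real ((norm x)\<^sup>2)"
proof (rule complex_eqI)
  show "Re (cinner x x) = Re (complex_of_real ((norm x)\<^sup>2))"
    by (simp add: Re_cinner power2_norm_eq_inner)
  show "Im (cinner x x) = Im (complex_of_real ((norm x)\<^sup>2))"
    using arg_cong[OF cinner_commute[of x x], of Im] by simp
qed

text \<open>Multiplying \<open>x\<close> by the phase \<open>c\<close> makes the inner product equal
  to its modulus, so the real Cauchy-Schwarz inequality applies.\<close>

lemma norm_cinner_le: "cmod (cinner x y) \<le> norm x * norm y"
proof -
  define z where "z = cinner x y"
  define c where "c = cnj (sgn z)"
  have c: "cmod c \<le> 1" by (simp add: c_def norm_sgn)
  have "c * z = complex_of_real (cmod z)"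
    by (cases "z = 0")
      (auto simp: c_def sgn_eq complex_norm_square[symmetric] power2_eq_square field_simps)
  then have "cmod z = Re (cinner (c *\<^sub>C x) y)"
    by (simp add: cinner_scaleC_left z_def)
  also have "\<dots> \<le> norm (c *\<^sub>C x) * norm y"
    unfolding Re_cinner by (rule norm_cauchy_schwarz)
  also have "\<dots> \<le> norm x * norm y"
    using mult_right_mono[OF c, of "norm x"] by (simp add: norm_scaleC mult_right_mono)
  finally show ?thesis by (simp add: z_def)
qed

lemma bounded_bilinear_cinner:
  "bounded_bilinear (cinner :: 'a::complex_inner \<Rightarrow> 'a \<Rightarrow> complex)"
proof
  fix x x' y y' :: 'a and r :: real
  show "cinner (x + x') y = cinner x y + cinner x' y" by (rule cinner_add_left)
  show "cinner x (y + y') = cinner x y + cinner x y'" by (rule cinner_add_right)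
  show "cinner (r *\<^sub>R x) y = r *\<^sub>R cinner x y"
    by (simp add: cinner_scaleC_left scaleR_conv_of_real flip: scaleC_of_real)
  show "cinner x (r *\<^sub>R y) = r *\<^sub>R cinner x y"
    by (simp add: cinner_scaleC_right scaleR_conv_of_real flip: scaleC_of_real)
  show "\<exists>K. \<forall>(x::'a) y. norm (cinner x y) \<le> norm x * norm y * K"
    by (rule exI[of _ 1]) (simp add: norm_cinner_le)
qed

interpretation cinner: bounded_bilinear "cinner :: 'a::complex_inner \<Rightarrow> 'a \<Rightarrow> complex"
  by (rule bounded_bilinear_cinner)

lemma cinner_self_eq_0: "cinner x x = 0 \<longleftrightarrow> x = 0"
  by (simp add: cinner_self)

lemma cinner_ext:
  assumes "\<And>y. cinner x y = cinner z y"
  shows "x = z"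
proof -
  have "cinner (x - z) (x - z) = 0" by (simp only: cinner.diff_left assms diff_self)
  then show ?thesis by (simp add: cinner_self)
qed

lemma norm_eq_of_cinner:
  fixes x :: "'a::complex_inner" and y :: "'b::complex_inner"
  shows "cinner x x = cinner y y \<Longrightarrow> norm x = norm y"
  unfolding cinner_self of_real_eq_iff by simp

text \<open>The hypothesis says that \<open>y\<close> is orthogonal to \<open>x - y\<close>, as for
  the image of \<open>x\<close> under an orthogonal projection. This is how operators given only by
  inner products are shown to be contractive.\<close>

lemma norm_le_of_cinner:
  assumes "cinner y y = cinner y x"
  shows "norm y \<le> norm x"
proof -
  have "(norm y)\<^sup>2 = cmod (cinner y y)" by (simp add: cinner_self norm_power)
  also have "\<dots> \<le> norm y * norm x" unfolding assms by (rule norm_cinner_le)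
  finally show ?thesis
    by (cases "y = 0") (auto simp: power2_eq_square mult_le_cancel_left)
qed

lemma norm_diff_sq: "(norm (x - y))\<^sup>2 = (norm x)\<^sup>2 - 2 * Re (cinner x y) + (norm y)\<^sup>2"
  unfolding Re_cinner power2_norm_eq_inner by (simp add: inner_diff inner_commute)

lemma norm_add_sq: "(norm (x + y))\<^sup>2 = (norm x)\<^sup>2 + 2 * Re (cinner x y) + (norm y)\<^sup>2"
  unfolding Re_cinner power2_norm_eq_inner by (simp add: inner_add inner_commute)

text \<open>Norms of sums determine the real parts of inner products, and replacing \<open>x\<close>
  by \<open>\<i> *\<^sub>C x\<close> turns imaginary parts into real ones.\<close>

lemma polarization:
  fixes f :: "'a::complex_inner \<Rightarrow> 'b::complex_inner"
  assumes S: "csubspace S" and f: "clinear_on S f" and norm: "\<And>x. x \<in> S \<Longrightarrow> norm (f x) = norm x"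
    and x: "x \<in> S" and y: "y \<in> S"
  shows "cinner (f x) (f y) = cinner x y"
proof -
  have re: "Re (cinner (f x) (f y)) = Re (cinner x y)" if "x \<in> S" "y \<in> S" for x y
  proof -
    have "x + y \<in> S" using S that by (auto simp: csubspace_def)
    moreover have "f (x + y) = f x + f y" using f that by (auto simp: clinear_on_def)
    ultimately have "(norm (f x + f y))\<^sup>2 = (norm (x + y))\<^sup>2"
      using norm by metis
    then show ?thesis using norm that by (simp add: norm_add_sq)
  qed
  have ix: "\<i> *\<^sub>C x \<in> S" "f (\<i> *\<^sub>C x) = \<i> *\<^sub>C f x"
    using S f x by (auto simp: csubspace_def clinear_on_def)
  show ?thesis
    using re[OF x y] re[OF ix(1) y] by (intro complex_eqI) (simp_all add: ix cinner_scaleC_left)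
qed

text \<open>The defect of linearity, paired with itself, expands into inner products of values of
  \<open>f\<close>; these equal the inner products of the arguments, whose defect is zero.\<close>

lemma clinear_on_of_cinner:
  fixes f :: "'a::complex_inner \<Rightarrow> 'b::complex_inner"
  assumes S: "csubspace S" and f: "\<And>x y. x \<in> S \<Longrightarrow> y \<in> S \<Longrightarrow> cinner (f x) (f y) = cinner x y"
  shows "clinear_on S f"
proof -
  have "f (x + y) = f x + f y" if "x \<in> S" "y \<in> S" for x y
  proof -
    have xy: "x + y \<in> S" using S that by (auto simp: csubspace_def)
    have "cinner (f (x + y) - (f x + f y)) (f (x + y) - (f x + f y)) = 0"
      using that xy by (simp add: cinner.diff_left cinner.diff_right cinner.add_left cinner.add_right f)
    then show ?thesis by (simp add: cinner_self)
  qed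
  moreover have "f (c *\<^sub>C x) = c *\<^sub>C f x" if "x \<in> S" for c x
  proof -
    have cx: "c *\<^sub>C x \<in> S" using S that by (auto simp: csubspace_def)
    have "cinner (f (c *\<^sub>C x) - c *\<^sub>C f x) (f (c *\<^sub>C x) - c *\<^sub>C f x) = 0"
      using that cx by (simp add: cinner.diff_left cinner.diff_right cinner_scaleC_left
          cinner_scaleC_right f)
    then show ?thesis by (simp add: cinner_self)
  qed
  ultimately show ?thesis by (auto simp: clinear_on_def)
qed

section \<open>Subspaces\<close>

lemma csubspace_0: "csubspace S \<Longrightarrow> 0 \<in> S"
  and csubspace_add: "csubspace S \<Longrightarrow> x \<in> S \<Longrightarrow> y \<in> S \<Longrightarrow> x + y \<in> S"
  and csubspace_scaleC: "csubspace S \<Longrightarrow> x \<in> S \<Longrightarrow> c *\<^sub>C x \<in> S"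
  by (auto simp: csubspace_def)

lemma csubspace_minus: "csubspace S \<Longrightarrow> x \<in> S \<Longrightarrow> - x \<in> S"
  using csubspace_scaleC[of S x "- 1"] by (simp add: scaleC_minus_one)

lemma csubspace_diff: "csubspace S \<Longrightarrow> x \<in> S \<Longrightarrow> y \<in> S \<Longrightarrow> x - y \<in> S"
  using csubspace_add[of S x "- y"] by (simp add: csubspace_minus)

lemma csubspace_scaleR: "csubspace S \<Longrightarrow> x \<in> S \<Longrightarrow> r *\<^sub>R x \<in> S"
  by (metis csubspace_scaleC scaleC_of_real)

lemma csubspace_sum: "csubspace S \<Longrightarrow> (\<And>i. i \<in> A \<Longrightarrow> f i \<in> S) \<Longrightarrow> sum f A \<in> S"
  by (induction A rule: infinite_finite_induct) (auto simp: csubspace_0 csubspace_add)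

lemma csubspace_UNIV [simp]: "csubspace UNIV"
  by (simp add: csubspace_def)

lemma closed_csubspace_UNIV [simp]: "closed_csubspace UNIV"
  by (simp add: closed_csubspace_def)

lemma csubspace_hull [simp]: "csubspace (csubspace hull X)"
  by (rule hull_in) (auto simp: csubspace_def)

lemma csubspace_closure: "csubspace S \<Longrightarrow> csubspace (closure S)"
  unfolding csubspace_def
proof (elim conjE, intro conjI ballI allI)
  assume 0: "0 \<in> S" and add: "\<forall>x\<in>S. \<forall>y\<in>S. x + y \<in> S" and scale: "\<forall>c. \<forall>x\<in>S. c *\<^sub>C x \<in> S"
  show "0 \<in> closure S" using 0 closure_subset by blast
  show "x + y \<in> closure S" if xy: "x \<in> closure S" "y \<in> closure S" for x y
  proof -
    obtain f g where "\<forall>n. f n \<in> S" "f \<longlonglongrightarrow> x" "\<forall>n. g n \<in> S" "g \<longlonglongrightarrow> y"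
      using xy unfolding closure_sequential by auto
    then have "(\<forall>n. f n + g n \<in> S) \<and> (\<lambda>n. f n + g n) \<longlonglongrightarrow> x + y"
      using add by (auto intro: tendsto_add)
    then show ?thesis unfolding closure_sequential by (rule exI[of _ "\<lambda>n. f n + g n"])
  qed
  show "c *\<^sub>C x \<in> closure S" if x: "x \<in> closure S" for c x
  proof -
    obtain f where "\<forall>n. f n \<in> S" "f \<longlonglongrightarrow> x"
      using x unfolding closure_sequential by auto
    then have "(\<forall>n. c *\<^sub>C f n \<in> S) \<and> (\<lambda>n. c *\<^sub>C f n) \<longlonglongrightarrow> c *\<^sub>C x"
      using scale by (auto intro: scaleC.tendsto)
    then show ?thesis unfolding closure_sequential by (rule exI[of _ "\<lambda>n. c *\<^sub>C f n"])
  qed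
qed

lemma closed_csubspace_cspan [simp]: "closed_csubspace (closed_cspan X)"
  by (simp add: closed_csubspace_def closed_cspan_def csubspace_closure)

lemma closed_cspan_superset: "X \<subseteq> closed_cspan X"
  unfolding closed_cspan_def using closure_subset hull_subset by (metis order_trans)

lemma closed_cspan_base: "x \<in> X \<Longrightarrow> x \<in> closed_cspan X"
  using closed_cspan_superset by blast

lemma closed_cspan_minimal:
  assumes "X \<subseteq> S" "closed_csubspace S"
  shows "closed_cspan X \<subseteq> S"
  unfolding closed_cspan_def
  using assms by (simp add: closed_csubspace_def closure_minimal hull_minimal)

lemma closed_cspan_mono: "X \<subseteq> Y \<Longrightarrow> closed_cspan X \<subseteq> closed_cspan Y"
  by (rule closed_cspan_minimal) (use closed_cspan_superset in auto)

lemma closed_csubspace_INT: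
  "(\<And>i. i \<in> I \<Longrightarrow> closed_csubspace (S i)) \<Longrightarrow> closed_csubspace (\<Inter>i\<in>I. S i)"
  unfolding closed_csubspace_def csubspace_def by auto

lemma closed_csubspace_cinner_eq: "closed_csubspace {y. cinner y a = cinner y b}"
  unfolding closed_csubspace_def csubspace_def
  by (auto simp: cinner.add_left cinner_scaleC_left cinner.zero_left
      intro!: closed_Collect_eq continuous_intros cinner.continuous_on)

lemma cinner_cspan_eq_0:
  assumes "\<And>x. x \<in> X \<Longrightarrow> cinner x z = 0" and "y \<in> closed_cspan X"
  shows "cinner y z = 0"
proof -
  have "closed_cspan X \<subseteq> {y. cinner y z = cinner y 0}"
    by (rule closed_cspan_minimal[OF _ closed_csubspace_cinner_eq])
      (use assms(1) in \<open>auto simp: cinner.zero_right\<close>)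
  then show ?thesis using assms(2) by (auto simp: cinner.zero_right)
qed

lemma cspan_eqI:
  assumes "y \<in> closed_cspan X" "y' \<in> closed_cspan X"
    and "\<And>x. x \<in> X \<Longrightarrow> cinner x y = cinner x y'"
  shows "y = y'"
proof -
  have "y - y' \<in> closed_cspan X"
    using assms closed_csubspace_cspan unfolding closed_csubspace_def by (blast intro: csubspace_diff)
  then have "cinner (y - y') (y - y') = 0"
    by (rule cinner_cspan_eq_0[rotated]) (simp add: cinner.diff_right assms(3))
  then show ?thesis by (simp add: cinner_self)
qed

section \<open>Projections, functionals and adjoints\<close>

lemma projection_exists:
  fixes x :: "'a::chilbert_space"
  assumes M: "closed_csubspace M"
  shows "\<exists>y\<in>M. \<forall>z\<in>M. cinner (x - y) z = 0"
proof -
  have sub: "csubspace M" and cl: "closed M" using M by (auto simp: closed_csubspace_def)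
  define d where "d = (INF z\<in>M. norm (x - z))"
  have ne: "M \<noteq> {}" using csubspace_0[OF sub] by auto
  have bdd: "bdd_below ((\<lambda>z. norm (x - z)) ` M)" by (rule bdd_belowI2[of _ 0]) simp
  have d_le: "d \<le> norm (x - z)" if "z \<in> M" for z
    unfolding d_def by (rule cINF_lower[OF bdd that])
  have d0: "0 \<le> d" unfolding d_def by (rule cINF_greatest[OF ne]) simp
  have "\<exists>z\<in>M. norm (x - z) < d + 1 / Suc n" for n
    using cInf_lessD[of "(\<lambda>z. norm (x - z)) ` M" "d + 1 / Suc n"] ne unfolding d_def by auto
  then obtain z where zM: "\<And>n. z n \<in> M" and zd: "\<And>n. norm (x - z n) < d + 1 / Suc n"
    by metis
  have lim: "(\<lambda>n. norm (x - z n)) \<longlonglongrightarrow> d"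
  proof (rule tendsto_sandwich[of "\<lambda>_. d" _ _ "\<lambda>n. d + 1 / Suc n"])
    show "(\<lambda>n. d + 1 / Suc n) \<longlonglongrightarrow> d"
      using tendsto_add[OF tendsto_const LIMSEQ_Suc[OF lim_1_over_n]] by simp
    show "\<forall>\<^sub>F n in sequentially. norm (x - z n) \<le> d + 1 / Suc n"
      using zd by (intro always_eventually allI less_imp_le)
  qed (use zM d_le in \<open>auto intro!: always_eventually\<close>)
  \<comment> \<open>The parallelogram law, with the midpoint of \<open>z m\<close> and
    \<open>z n\<close> at distance at least \<open>d\<close> from \<open>x\<close>; it makes the
    minimising sequence Cauchy.\<close>
  have par: "(norm (z m - z n))\<^sup>2 \<le> 2 * ((norm (x - z m))\<^sup>2 - d\<^sup>2) + 2 * ((norm (x - z n))\<^sup>2 - d\<^sup>2)" for m n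
  proof -
    have "(1/2) *\<^sub>R (z m + z n) \<in> M" by (intro csubspace_scaleR csubspace_add sub zM)
    then have "d\<^sup>2 \<le> (norm (x - (1/2) *\<^sub>R (z m + z n)))\<^sup>2"
      using d_le d0 by (simp add: power_mono)
    moreover have "(norm (z m - z n))\<^sup>2 + 4 * (norm (x - (1/2) *\<^sub>R (z m + z n)))\<^sup>2
      = 2 * (norm (x - z m))\<^sup>2 + 2 * (norm (x - z n))\<^sup>2"
      unfolding power2_norm_eq_inner by (simp add: inner_diff inner_add inner_commute algebra_simps)
    ultimately show ?thesis by simp
  qed
  have "Cauchy z"
  proof (rule metric_CauchyI)
    fix e :: real assume "e > 0"
    have "(\<lambda>n. (norm (x - z n))\<^sup>2 - d\<^sup>2) \<longlonglongrightarrow> d\<^sup>2 - d\<^sup>2"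
      by (intro tendsto_intros lim)
    then have "\<forall>\<^sub>F n in sequentially. (norm (x - z n))\<^sup>2 - d\<^sup>2 < e\<^sup>2 / 4"
      by (rule order_tendstoD(2)) (use \<open>e > 0\<close> in simp)
    then obtain N where N: "\<And>n. n \<ge> N \<Longrightarrow> (norm (x - z n))\<^sup>2 - d\<^sup>2 < e\<^sup>2 / 4"
      by (auto simp: eventually_sequentially)
    have "dist (z m) (z n) < e" if "m \<ge> N" "n \<ge> N" for m n
    proof -
      have "(norm (z m - z n))\<^sup>2 < 2 * (e\<^sup>2 / 4) + 2 * (e\<^sup>2 / 4)"
        by (rule le_less_trans[OF par]) (intro add_strict_mono mult_strict_left_mono N that; simp)
      then have "(norm (z m - z n))\<^sup>2 < e\<^sup>2" by simp
      then show ?thesis unfolding dist_norm by (rule power2_less_imp_less) (use \<open>e > 0\<close> in simp)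
    qed
    then show "\<exists>N. \<forall>m\<ge>N. \<forall>n\<ge>N. dist (z m) (z n) < e" by blast
  qed
  then obtain y where y: "z \<longlonglongrightarrow> y" by (auto simp: Cauchy_convergent_iff convergent_def)
  have yM: "y \<in> M" using closed_sequentially[OF cl] zM y by blast
  have yd: "norm (x - y) = d"
    by (rule LIMSEQ_unique[OF _ lim]) (intro tendsto_intros y)
  have re: "Re (cinner (x - y) w) = 0" if w: "w \<in> M" for w
  proof (cases "w = 0")
    case False
    \<comment> \<open>This \<open>t\<close> minimises the quadratic polynomial
      \<open>t \<mapsto> (norm ((x - y) - t *\<^sub>R w))\<^sup>2\<close>, whose value at 0 is
      already the least possible.\<close>
    define t where "t = Re (cinner (x - y) w) / (norm w)\<^sup>2"
    have "y + t *\<^sub>R w \<in> M" by (intro csubspace_scaleR csubspace_add sub yM w)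
    then have "d\<^sup>2 \<le> (norm (x - (y + t *\<^sub>R w)))\<^sup>2"
      using d_le d0 by (simp add: power_mono)
    also have "x - (y + t *\<^sub>R w) = (x - y) - t *\<^sub>R w" by simp
    also have "(norm ((x - y) - t *\<^sub>R w))\<^sup>2 = d\<^sup>2 - 2 * t * Re (cinner (x - y) w) + t\<^sup>2 * (norm w)\<^sup>2"
      by (simp add: norm_diff_sq yd cinner.scaleR_right power_mult_distrib)
    also have "\<dots> = d\<^sup>2 - (Re (cinner (x - y) w))\<^sup>2 / (norm w)\<^sup>2"
      using False by (simp add: t_def field_simps power2_eq_square)
    finally have "(Re (cinner (x - y) w))\<^sup>2 / (norm w)\<^sup>2 \<le> 0" by simp
    then show ?thesis using False by (simp add: divide_le_0_iff power2_eq_square mult_le_0_iff)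
        (metis mult_le_0_iff order.antisym linorder_le_cases)
  qed (simp add: cinner.zero_right)
  have "cinner (x - y) w = 0" if w: "w \<in> M" for w
  proof (rule complex_eqI)
    show "Re (cinner (x - y) w) = Re 0" using re[OF w] by simp
    show "Im (cinner (x - y) w) = Im 0"
      using re[OF csubspace_scaleC[OF sub w, of "\<i>"]] by (simp add: cinner_scaleC_right)
  qed
  then show ?thesis using yM by blast
qed

lemma proj_onto_eq:
  assumes "csubspace M" "y \<in> M" "\<And>z. z \<in> M \<Longrightarrow> cinner (x - y) z = 0"
  shows "proj_onto M x = y"
  unfolding proj_onto_def
proof (rule the_equality)
  show "y' = y" if y': "y' \<in> M \<and> (\<forall>z\<in>M. cinner (x - y') z = 0)" for y'
  proof -
    have "y - y' \<in> M" using assms y' by (blast intro: csubspace_diff)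
    then have "cinner (x - y') (y - y') = 0" "cinner (x - y) (y - y') = 0"
      using assms y' by auto
    then have "cinner (y - y') (y - y') = 0"
      by (simp add: cinner.diff_left)
    then show ?thesis by (simp add: cinner_self)
  qed
qed (use assms in auto)

lemma cinner_proj_onto:
  assumes M: "closed_csubspace M" and z: "z \<in> M"
  shows "cinner (proj_onto M x) z = cinner x z"
proof -
  obtain y where "y \<in> M" "\<forall>z\<in>M. cinner (x - y) z = 0"
    using projection_exists[OF M] by blast
  moreover from this have "proj_onto M x = y"
    by (intro proj_onto_eq) (use M in \<open>auto simp: closed_csubspace_def\<close>)
  ultimately show ?thesis using z by (simp add: cinner.diff_left)
qed


lemma clinear_onD:
  assumes "clinear_on S T"
  shows "x \<in> S \<Longrightarrow> y \<in> S \<Longrightarrow> T (x + y) = T x + T y" and "x \<in> S \<Longrightarrow> T (c *\<^sub>C x) = c *\<^sub>C T x"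
  using assms by (auto simp: clinear_on_def)

lemma clinear_on_0: "csubspace S \<Longrightarrow> clinear_on S T \<Longrightarrow> T 0 = 0"
  using clinear_onD(2)[of S T 0 0] by (simp add: csubspace_0 scaleC.zero_left)

lemma clinear_on_diff:
  "csubspace S \<Longrightarrow> clinear_on S T \<Longrightarrow> x \<in> S \<Longrightarrow> y \<in> S \<Longrightarrow> T (x - y) = T x - T y"
  using clinear_onD(1)[of S T "x - y" y] by (simp add: csubspace_diff)

lemma clinear_on_sum:
  assumes S: "csubspace S" and T: "clinear_on S T"
  shows "(\<And>i. i \<in> A \<Longrightarrow> f i \<in> S) \<Longrightarrow> T (sum f A) = (\<Sum>i\<in>A. T (f i))"
  by (induction A rule: infinite_finite_induct)
    (auto simp: clinear_on_0[OF S T] clinear_onD[OF T] csubspace_sum[OF S])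

text \<open>\<open>T\<close> is controlled on \<open>S\<close> only and need not be continuous on
  the whole type, hence the argument by sequences inside \<open>S\<close>.\<close>

lemma closed_csubspace_kernel:
  fixes T :: "'a::chilbert_space \<Rightarrow> 'b::complex_inner"
  assumes S: "closed_csubspace S" and T: "clinear_on S T"
    and B: "\<And>x. x \<in> S \<Longrightarrow> norm (T x) \<le> B * norm x"
  shows "closed_csubspace {x \<in> S. T x = 0}"
proof -
  have sub: "csubspace S" and cl: "closed S" using S by (auto simp: closed_csubspace_def)
  have "csubspace {x \<in> S. T x = 0}"
    using sub clinear_on_0[OF sub T]
    by (auto simp: csubspace_def clinear_onD[OF T] scaleC.zero_right)
  moreover have "closed {x \<in> S. T x = 0}"
    unfolding closed_sequential_limits
  proof (intro allI impI)
    fix f l assume "(\<forall>n. f n \<in> {x \<in> S. T x = 0}) \<and> f \<longlonglongrightarrow> l"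
    then have f: "\<And>n. f n \<in> S" "\<And>n. T (f n) = 0" "f \<longlonglongrightarrow> l" by auto
    have l: "l \<in> S" using closed_sequentially[OF cl] f by blast
    have "norm (T l) \<le> B * norm (l - f n)" for n
      using B[OF csubspace_diff[OF sub l f(1)[of n]]] by (simp add: clinear_on_diff[OF sub T] l f)
    moreover have "(\<lambda>n. B * norm (l - f n)) \<longlonglongrightarrow> B * norm (l - l)"
      by (intro tendsto_intros f)
    ultimately have "norm (T l) \<le> B * norm (l - l)"
      by (intro LIMSEQ_le_const) auto
    then show "l \<in> {x \<in> S. T x = 0}" using l by simp
  qed
  ultimately show ?thesis by (simp add: closed_csubspace_def)
qed

lemma riesz_representation:
  fixes T :: "'a::chilbert_space \<Rightarrow> complex"
  assumes S: "closed_csubspace S" and T: "clinear_on S T"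
    and B: "\<And>x. x \<in> S \<Longrightarrow> cmod (T x) \<le> B * norm x"
  shows "\<exists>y\<in>S. \<forall>x\<in>S. T x = cinner x y"
proof -
  have sub: "csubspace S" using S by (auto simp: closed_csubspace_def)
  note diff = clinear_on_diff[OF sub T]
  have scale: "T (c *\<^sub>C x) = c * T x" if "x \<in> S" for x c
    using T that by (auto simp: clinear_on_def scaleC_complex_def)
  define N where "N = {x\<in>S. T x = 0}"
  have N: "closed_csubspace N"
    unfolding N_def by (rule closed_csubspace_kernel[OF S T B])
  show ?thesis
  proof (cases "N = S")
    case True
    then show ?thesis using csubspace_0[OF sub]
      by (intro bexI[of _ 0]) (auto simp: N_def cinner.zero_right)
  next
    case False
    then obtain x0 where x0: "x0 \<in> S" "T x0 \<noteq> 0" by (auto simp: N_def)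
    obtain p where p: "p \<in> N" "\<forall>z\<in>N. cinner (x0 - p) z = 0"
      using projection_exists[OF N] by blast
    define w where "w = x0 - p"
    have w: "w \<in> S" using x0 p csubspace_diff[OF sub] by (auto simp: w_def N_def)
    have Tw: "T w \<noteq> 0" using x0 p by (auto simp: w_def N_def diff)
    then have w0: "norm w \<noteq> 0" using clinear_on_0[OF sub T] by auto
    \<comment> \<open>\<open>w\<close> is normal to the kernel \<open>N\<close>; the factor is
      chosen so that \<open>cinner w y = T w\<close>.\<close>
    define y where "y = (cnj (T w) / complex_of_real ((norm w)\<^sup>2)) *\<^sub>C w"
    have "T x = cinner x y" if x: "x \<in> S" for x
    proof -
      have "x - (T x / T w) *\<^sub>C w \<in> N"
        using x w Tw by (auto simp: N_def diff scale csubspace_diff[OF sub] csubspace_scaleC[OF sub])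
      then have "cinner (x - (T x / T w) *\<^sub>C w) w = 0"
        using p(2) by (subst cinner_commute) (simp add: w_def)
      then have "cinner x w = T x / T w * complex_of_real ((norm w)\<^sup>2)"
        by (simp add: cinner.diff_left cinner_scaleC_left cinner_self)
      then show ?thesis
        using Tw w0 by (simp add: y_def cinner_scaleC_right)
    qed
    moreover have "y \<in> S" by (simp add: y_def csubspace_scaleC[OF sub w])
    ultimately show ?thesis by blast
  qed
qed

lemma bounded_opD:
  assumes "bounded_op S T"
  shows "x \<in> S \<Longrightarrow> T x \<in> S" and "clinear_on S T"
  using assms by (auto simp: bounded_op_def)

lemma bounded_opI:
  assumes "\<And>x. x \<in> S \<Longrightarrow> T x \<in> S" "clinear_on S T" "\<And>x. x \<in> S \<Longrightarrow> norm (T x) \<le> B * norm x"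
  shows "bounded_op S T"
  using assms unfolding bounded_op_def by blast

lemma bounded_op_bound:
  assumes "bounded_op S T"
  obtains B where "B \<ge> 0" "\<And>x. x \<in> S \<Longrightarrow> norm (T x) \<le> B * norm x"
proof -
  obtain B where B: "\<And>x. x \<in> S \<Longrightarrow> norm (T x) \<le> B * norm x"
    using assms by (auto simp: bounded_op_def)
  show ?thesis
  proof (rule that[of "\<bar>B\<bar>"])
    show "norm (T x) \<le> \<bar>B\<bar> * norm x" if "x \<in> S" for x
      using B[OF that] mult_right_mono[OF abs_ge_self[of B] norm_ge_zero[of x]] by linarith
  qed simp
qed

lemma bounded_op_compose:
  assumes "bounded_op S A" "bounded_op S B"
  shows "bounded_op S (\<lambda>x. A (B x))"
proof -
  obtain a where a: "a \<ge> 0" "\<And>x. x \<in> S \<Longrightarrow> norm (A x) \<le> a * norm x"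
    using bounded_op_bound[OF assms(1)] by blast
  obtain b where b: "b \<ge> 0" "\<And>x. x \<in> S \<Longrightarrow> norm (B x) \<le> b * norm x"
    using bounded_op_bound[OF assms(2)] by blast
  have "norm (A (B x)) \<le> (a * b) * norm x" if "x \<in> S" for x
    using a(2)[OF bounded_opD(1)[OF assms(2) that]] mult_left_mono[OF b(2)[OF that] a(1)] by simp
  then show ?thesis
    by (rule bounded_opI[rotated 2])
      (use bounded_opD[OF assms(1)] bounded_opD[OF assms(2)] in \<open>auto simp: clinear_on_def\<close>)
qed

lemma bounded_op_id: "bounded_op S (\<lambda>x. x)"
  unfolding bounded_op_def clinear_on_def by (auto intro: exI[of _ 1])

lemma bounded_op_zero: "csubspace S \<Longrightarrow> bounded_op S (\<lambda>x. 0)"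
  unfolding bounded_op_def clinear_on_def by (auto simp: csubspace_0 scaleC.zero_right intro: exI[of _ 0])

lemma adj_eqI:
  assumes S: "csubspace S" and z: "z \<in> S" "\<And>x. x \<in> S \<Longrightarrow> cinner (T x) y = cinner x z"
  shows "adj S T y = z"
  unfolding adj_def
proof (rule the_equality)
  fix z' assume z': "z' \<in> S \<and> (\<forall>x\<in>S. cinner (T x) y = cinner x z')"
  have "z' - z \<in> S" using z z' S by (blast intro: csubspace_diff)
  then have "cinner (z' - z) (z' - z) = 0"
    using z z' by (simp add: cinner.diff_right)
  then show "z' = z" by (simp add: cinner_self)
qed (use z in auto)

context
  fixes S :: "'a::chilbert_space set" and T :: "'a \<Rightarrow> 'a"
  assumes S: "closed_csubspace S" and T: "bounded_op S T"
begin

lemma adj_spec: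
  assumes y: "y \<in> S"
  shows "adj S T y \<in> S \<and> (\<forall>x\<in>S. cinner (T x) y = cinner x (adj S T y))"
proof -
  obtain B where B: "B \<ge> 0" "\<And>x. x \<in> S \<Longrightarrow> norm (T x) \<le> B * norm x"
    using bounded_op_bound[OF T] by blast
  have "\<exists>z\<in>S. \<forall>x\<in>S. cinner (T x) y = cinner x z"
  proof (rule riesz_representation[OF S])
    show "clinear_on S (\<lambda>x. cinner (T x) y)"
      using bounded_opD(2)[OF T]
      by (simp add: clinear_on_def cinner.add_left cinner_scaleC_left scaleC_complex_def)
    show "cmod (cinner (T x) y) \<le> (B * norm y) * norm x" if "x \<in> S" for x
      using order_trans[OF norm_cinner_le mult_right_mono[OF B(2)[OF that], of "norm y"]]
      by (simp add: mult_ac)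
  qed
  then obtain z where "z \<in> S" "\<forall>x\<in>S. cinner (T x) y = cinner x z" by blast
  moreover from this have "adj S T y = z"
    by (intro adj_eqI) (use S in \<open>auto simp: closed_csubspace_def\<close>)
  ultimately show ?thesis by simp
qed

lemma adj_in: "y \<in> S \<Longrightarrow> adj S T y \<in> S"
  using adj_spec by blast

lemma cinner_adj_right: "x \<in> S \<Longrightarrow> y \<in> S \<Longrightarrow> cinner x (adj S T y) = cinner (T x) y"
  using adj_spec by metis

lemma cinner_adj_left: "x \<in> S \<Longrightarrow> y \<in> S \<Longrightarrow> cinner (adj S T y) x = cinner y (T x)"
  by (subst (1 2) cinner_commute) (simp add: cinner_adj_right)

lemma norm_adj_le:
  assumes B: "\<And>x. x \<in> S \<Longrightarrow> norm (T x) \<le> B * norm x" and y: "y \<in> S"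
  shows "norm (adj S T y) \<le> B * norm y"
proof (cases "adj S T y = 0")
  case True
  have "0 \<le> B * norm y" using order_trans[OF norm_ge_zero B[OF y]] .
  then show ?thesis using True by simp
next
  case False
  let ?z = "adj S T y"
  have "complex_of_real ((norm ?z)\<^sup>2) = cinner (T ?z) y"
    using cinner_adj_right[OF adj_in[OF y] y] by (simp add: cinner_self)
  then have "(norm ?z)\<^sup>2 = cmod (cinner (T ?z) y)"
    by (metis abs_power2 norm_of_real real_norm_def)
  also have "\<dots> \<le> B * norm ?z * norm y"
    by (rule order_trans[OF norm_cinner_le mult_right_mono[OF B]]) (use adj_in y in auto)
  finally have "norm ?z * norm ?z \<le> (B * norm y) * norm ?z"
    by (simp add: power2_eq_square mult_ac)
  then show ?thesis using False by (simp add: mult_le_cancel_right)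
qed

lemma bounded_op_adj: "bounded_op S (adj S T)"
proof -
  have sub: "csubspace S" using S by (simp add: closed_csubspace_def)
  obtain B where B: "B \<ge> 0" "\<And>x. x \<in> S \<Longrightarrow> norm (T x) \<le> B * norm x"
    using bounded_op_bound[OF T] by blast
  have "adj S T (x + y) = adj S T x + adj S T y" if "x \<in> S" "y \<in> S" for x y
    by (rule adj_eqI[OF sub])
      (use that in \<open>simp_all add: csubspace_add[OF sub] adj_in cinner.add_right cinner_adj_right\<close>)
  moreover have "adj S T (c *\<^sub>C x) = c *\<^sub>C adj S T x" if "x \<in> S" for x c
    by (rule adj_eqI[OF sub])
      (use that in \<open>simp_all add: csubspace_scaleC[OF sub] adj_in cinner_scaleC_right cinner_adj_right\<close>)
  ultimately show ?thesis
    by (intro bounded_opI[of _ _ B] norm_adj_le B(2)) (auto simp: clinear_on_def adj_in)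
qed

end

text \<open>The kernel of the difference is a closed subspace containing the generators. Operator
  identities below are reduced to generators in this way.\<close>

lemma bounded_op_eq_on_cspan:
  assumes S: "S = closed_cspan X" and A: "bounded_op S A" and B: "bounded_op S B"
    and eq: "\<And>x. x \<in> X \<Longrightarrow> A x = B x" and x: "x \<in> S"
  shows "A x = B x"
proof -
  have S': "closed_csubspace S" by (simp add: S)
  obtain a where a: "a \<ge> 0" "\<And>x. x \<in> S \<Longrightarrow> norm (A x) \<le> a * norm x"
    using bounded_op_bound[OF A] by blast
  obtain b where b: "b \<ge> 0" "\<And>x. x \<in> S \<Longrightarrow> norm (B x) \<le> b * norm x"
    using bounded_op_bound[OF B] by blast
  have "closed_csubspace {x \<in> S. A x - B x = 0}"
  proof (rule closed_csubspace_kernel[OF S'])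
    show "clinear_on S (\<lambda>x. A x - B x)"
      using bounded_opD(2)[OF A] bounded_opD(2)[OF B]
      by (auto simp: clinear_on_def scaleC.diff_right)
    show "norm (A x - B x) \<le> (a + b) * norm x" if "x \<in> S" for x
      using a(2)[OF that] b(2)[OF that] norm_triangle_ineq4[of "A x" "B x"]
      by (simp add: distrib_right)
  qed
  moreover have "X \<subseteq> {x \<in> S. A x - B x = 0}"
    using eq closed_cspan_superset by (auto simp: S)
  ultimately have "closed_cspan X \<subseteq> {x \<in> S. A x - B x = 0}"
    by (rule closed_cspan_minimal[rotated])
  then show ?thesis using x by (auto simp: S)
qed

section \<open>Summable families of vectors\<close>

text \<open>Orthogonal families are in general not absolutely summable, so comparison of norms
  cannot give convergence. A bound on the squared norms of partial sums still makes their net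
  Cauchy.\<close>

lemma summable_on_norm_sum_bound:
  fixes f :: "'i \<Rightarrow> 'a::chilbert_space" and g :: "'i \<Rightarrow> real"
  assumes g: "g summable_on A"
    and le: "\<And>F. finite F \<Longrightarrow> F \<subseteq> A \<Longrightarrow> (norm (\<Sum>i\<in>F. f i))\<^sup>2 \<le> (\<Sum>i\<in>F. g i)"
  shows "f summable_on A" and "(norm (\<Sum>\<^sub>\<infinity>i\<in>A. f i))\<^sup>2 \<le> (\<Sum>\<^sub>\<infinity>i\<in>A. g i)"
proof -
  have g0: "0 \<le> g i" if "i \<in> A" for i
    using le[of "{i}"] that by simp (meson order_trans zero_le_power2)
  define L where "L = infsum g A"
  have gL: "sum g F \<le> L" if "finite F" "F \<subseteq> A" for F
    unfolding L_def by (rule finite_sum_le_infsum[OF g that]) (use g0 in auto)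
  have lim: "(sum g \<longlongrightarrow> L) (finite_subsets_at_top A)"
    unfolding L_def using g by (rule infsum_tendsto)
  have "\<exists>P. eventually P (finite_subsets_at_top A) \<and>
      (\<forall>F F'. P F \<and> P F' \<longrightarrow> dist (sum f F) (sum f F') < e)" if e: "e > 0" for e
  proof (intro exI conjI allI impI)
    \<comment> \<open>Such an \<open>F\<close> leaves less than \<open>(e/2)\<^sup>2\<close> of the
      mass of \<open>g\<close> outside, so enlarging it moves the sum of \<open>f\<close> by less
      than \<open>e/2\<close>.\<close>
    define P where "P F \<longleftrightarrow> finite F \<and> F \<subseteq> A \<and> L - (e/2)\<^sup>2 < sum g F" for F
    have "\<forall>\<^sub>F F in finite_subsets_at_top A. L - (e/2)\<^sup>2 < sum g F"
      by (rule order_tendstoD(1)[OF lim]) (use e in simp)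
    then show "eventually P (finite_subsets_at_top A)"
      unfolding P_def by (auto simp: eventually_conj_iff eventually_finite_subsets_at_top_weakI)
    show "dist (sum f F) (sum f F') < e" if P: "P F \<and> P F'" for F F'
    proof -
      define G where "G = F \<union> F'"
      have half: "norm (sum f G - sum f H) < e/2" if "P H" "H \<subseteq> G" for H
      proof -
        have G: "finite G" "G \<subseteq> A" using P by (auto simp: G_def P_def)
        have "(norm (sum f G - sum f H))\<^sup>2 = (norm (sum f (G - H)))\<^sup>2"
          using that G by (simp add: sum_diff)
        also have "\<dots> \<le> sum g (G - H)"
          by (rule le) (use G in auto)
        also have "\<dots> = sum g G - sum g H"
          using that G by (simp add: sum_diff)
        also have "\<dots> < (e/2)\<^sup>2"
          using gL[OF G] that by (simp add: P_def)
        finally show ?thesis by (rule power2_less_imp_less) (use e in simp)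
      qed
      have "sum f F - sum f F' = (sum f G - sum f F') - (sum f G - sum f F)" by simp
      also have "norm \<dots> \<le> norm (sum f G - sum f F') + norm (sum f G - sum f F)"
        by (rule norm_triangle_ineq4)
      also have "\<dots> < e/2 + e/2"
        by (intro add_strict_mono half) (use P in \<open>auto simp: G_def\<close>)
      finally show ?thesis by (simp add: dist_norm)
    qed
  qed
  then have "cauchy_filter (filtermap (sum f) (finite_subsets_at_top A))"
    by (simp add: cauchy_filter_metric_filtermap)
  moreover have "complete (UNIV::'a set)"
    by (meson Cauchy_convergent UNIV_I complete_def convergent_def)
  ultimately obtain l where "(sum f \<longlongrightarrow> l) (finite_subsets_at_top A)"
    using complete_uniform[where S=UNIV] by (force simp add: filterlim_def)
  then have l: "(f has_sum l) A" by (simp add: has_sum_def)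
  then show "f summable_on A" by (auto simp: summable_on_def)
  have "(norm l)\<^sup>2 \<le> L"
  proof (rule tendsto_upperbound)
    show "((\<lambda>F. (norm (sum f F))\<^sup>2) \<longlongrightarrow> (norm l)\<^sup>2) (finite_subsets_at_top A)"
      using l by (intro tendsto_intros) (simp add: has_sum_def)
    show "\<forall>\<^sub>F F in finite_subsets_at_top A. (norm (sum f F))\<^sup>2 \<le> L"
      by (rule eventually_finite_subsets_at_top_weakI) (use le gL order_trans in blast)
  qed simp
  then show "(norm (\<Sum>\<^sub>\<infinity>i\<in>A. f i))\<^sup>2 \<le> (\<Sum>\<^sub>\<infinity>i\<in>A. g i)"
    using l by (simp add: infsumI L_def)
qed

lemma norm_sum_orthogonal:
  fixes f :: "'i \<Rightarrow> 'a::complex_inner"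
  assumes "finite F" "\<And>i j. i \<in> F \<Longrightarrow> j \<in> F \<Longrightarrow> i \<noteq> j \<Longrightarrow> cinner (f i) (f j) = 0"
  shows "(norm (\<Sum>i\<in>F. f i))\<^sup>2 = (\<Sum>i\<in>F. (norm (f i))\<^sup>2)"
  using assms
proof (induction F rule: finite_induct)
  case (insert a F)
  have "cinner (f a) (sum f F) = 0"
    using insert by (auto simp: cinner.sum_right intro!: sum.neutral)
  then show ?case using insert by (simp add: norm_add_sq)
qed simp

lemma coord_delta: "coord (delta i x) j = (if j = i then x else 0)"
  by (simp add: delta.rep_eq)

lemma coord_inject_eq: "(\<And>i. coord f i = coord g i) \<Longrightarrow> f = g"
  by (metis coord_inject ext)

lemma cinner_delta_right: "cinner f (delta i x) = cinner (coord f i) x"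
proof -
  have "cinner f (delta i x) = (\<Sum>\<^sub>\<infinity>j. cinner (coord f j) (if j = i then x else 0))"
    by (simp add: cinner_ell2_def coord_delta)
  also have "\<dots> = cinner (coord f i) x"
  proof -
    have "(\<Sum>\<^sub>\<infinity>j. cinner (coord f j) (if j = i then x else 0)) = (\<Sum>\<^sub>\<infinity>j\<in>{i}. cinner (coord f j) x)"
      by (rule infsum_cong_neutral) (auto simp: cinner.zero_right)
    then show ?thesis by simp
  qed
  finally show ?thesis .
qed

lemma norm_delta: "norm (delta i x) = norm x"
  by (rule norm_eq_of_cinner) (simp add: cinner_delta_right coord_delta)

lemma has_sum_coord:
  assumes "(f has_sum s) A"
  shows "((\<lambda>i. coord (f i) k) has_sum coord s k) A"
proof (rule has_sum_bounded_linear[OF _ assms])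
  show "bounded_linear (\<lambda>f. coord f k)"
    by (rule bounded_linear_intro[of _ 1])
      (auto simp: plus_ell2.rep_eq scaleR_ell2.rep_eq norm_coord_le)
qed

lemma summable_delta:
  assumes "(\<lambda>i. (norm (x i))\<^sup>2) summable_on A" "inj_on k A"
  shows "(\<lambda>i. delta (k i) (x i)) summable_on A"
proof (rule summable_on_norm_sum_bound[OF assms(1)])
  fix F assume F: "finite F" "F \<subseteq> A"
  have "(norm (\<Sum>i\<in>F. delta (k i) (x i)))\<^sup>2 = (\<Sum>i\<in>F. (norm (delta (k i) (x i)))\<^sup>2)"
    by (rule norm_sum_orthogonal[OF F(1)])
      (use F assms(2) in \<open>auto simp: cinner_delta_right coord_delta cinner.zero_left dest: inj_onD\<close>)
  then show "(norm (\<Sum>i\<in>F. delta (k i) (x i)))\<^sup>2 \<le> (\<Sum>i\<in>F. (norm (x i))\<^sup>2)"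
    by (simp add: norm_delta)
qed

lemma has_sum_delta:
  assumes "\<And>i. i \<notin> A \<Longrightarrow> coord f i = 0"
  shows "((\<lambda>i. delta i (coord f i)) has_sum f) A"
proof -
  have "(\<lambda>i. delta i (coord f i)) summable_on A"
    by (rule summable_delta[OF summable_on_subset_banach[OF coord_summable]]) auto
  then have s: "((\<lambda>i. delta i (coord f i)) has_sum (\<Sum>\<^sub>\<infinity>i\<in>A. delta i (coord f i))) A"
    by (rule has_sum_infsum)
  have "(\<Sum>\<^sub>\<infinity>i\<in>A. delta i (coord f i)) = f"
  proof (rule coord_inject_eq)
    fix k
    have "((\<lambda>i. coord (delta i (coord f i)) k) has_sum coord f k) A"
    proof (cases "k \<in> A")
      case True
      then have "((\<lambda>i. coord (delta i (coord f i)) k) has_sum coord f k) {k}"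
        by (simp add: coord_delta has_sum_finite_iff)
      then show ?thesis
        by (rule has_sum_cong_neutral[THEN iffD1, rotated -1]) (use True in \<open>auto simp: coord_delta\<close>)
    next
      case False
      then show ?thesis by (auto simp: assms coord_delta intro!: has_sum_0)
    qed
    then show "coord (\<Sum>\<^sub>\<infinity>i\<in>A. delta i (coord f i)) k = coord f k"
      using has_sum_unique has_sum_coord[OF s] by blast
  qed
  then show ?thesis using s by simp
qed

section \<open>Extending families of vectors\<close>

lemma sum_scaleC_merge:
  fixes x :: "'i \<Rightarrow> 'a::complex_inner"
  assumes "finite A" "finite B"
  shows "(\<Sum>i\<in>A. c i *\<^sub>C x i) + (\<Sum>i\<in>B. d i *\<^sub>C x i)
    = (\<Sum>i\<in>A \<union> B. ((if i \<in> A then c i else 0) + (if i \<in> B then d i else 0)) *\<^sub>C x i)"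
proof -
  have "(\<Sum>i\<in>A. c i *\<^sub>C x i) = (\<Sum>i\<in>A \<union> B. (if i \<in> A then c i else 0) *\<^sub>C x i)"
    using assms by (intro sum.mono_neutral_cong_left) (auto simp: scaleC.zero_left)
  moreover have "(\<Sum>i\<in>B. d i *\<^sub>C x i) = (\<Sum>i\<in>A \<union> B. (if i \<in> B then d i else 0) *\<^sub>C x i)"
    using assms by (intro sum.mono_neutral_cong_left) (auto simp: scaleC.zero_left)
  ultimately show ?thesis by (simp add: scaleC_add_left sum.distrib)
qed

lemma cspan_explicit:
  "csubspace hull (x ` I) = {\<Sum>i\<in>A. c i *\<^sub>C x i | A c. finite A \<and> A \<subseteq> I}"
    (is "_ = ?R")
proof (rule hull_unique)
  show "x ` I \<subseteq> ?R"
  proof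
    fix y assume "y \<in> x ` I"
    then obtain i where "i \<in> I" "y = x i" by auto
    then show "y \<in> ?R"
      by (intro CollectI exI[of _ "{i}"] exI[of _ "\<lambda>_. 1"]) simp
  qed
  show "csubspace ?R"
    unfolding csubspace_def
  proof (intro conjI ballI allI)
    show "0 \<in> ?R" by (intro CollectI exI[of _ "{}"]) simp
    show "y + z \<in> ?R" if yz: "y \<in> ?R" "z \<in> ?R" for y z
    proof -
      from yz(1) obtain A c where A: "finite A" "A \<subseteq> I" "y = (\<Sum>i\<in>A. c i *\<^sub>C x i)"
        by blast
      from yz(2) obtain B d where B: "finite B" "B \<subseteq> I" "z = (\<Sum>i\<in>B. d i *\<^sub>C x i)"
        by blast
      show ?thesis
        unfolding A(3) B(3) sum_scaleC_merge[OF A(1) B(1)]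
        by (rule CollectI, intro exI conjI, rule refl) (use A B in auto)
    qed
    show "c *\<^sub>C y \<in> ?R" if "y \<in> ?R" for c y
      using that by (fastforce simp: scaleC.sum_right scaleC_scaleC)
  qed
  show "?R \<subseteq> T" if "x ` I \<subseteq> T" "csubspace T" for T
    using that by (auto intro!: csubspace_sum csubspace_scaleC)
qed

text \<open>The extension is the closure of the graph \<open>L\<close> of the map on the algebraic span.\<close>

lemma extend_family:
  fixes x :: "'i \<Rightarrow> 'a::chilbert_space" and y :: "'i \<Rightarrow> 'b::chilbert_space"
  assumes le: "\<And>A c. finite A \<Longrightarrow> A \<subseteq> I \<Longrightarrow>
    norm (\<Sum>i\<in>A. c i *\<^sub>C y i) \<le> B * norm (\<Sum>i\<in>A. c i *\<^sub>C x i)"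
  obtains T where "clinear_on (closed_cspan (x ` I)) T"
    "\<And>z. z \<in> closed_cspan (x ` I) \<Longrightarrow> T z \<in> closed_cspan (y ` I)"
    "\<And>i. i \<in> I \<Longrightarrow> T (x i) = y i"
    "\<And>z. z \<in> closed_cspan (x ` I) \<Longrightarrow> norm (T z) \<le> B * norm z"
proof -
  let ?X = "closed_cspan (x ` I)" and ?Y = "closed_cspan (y ` I)"
  define L where "L = {(\<Sum>i\<in>A. c i *\<^sub>C x i, \<Sum>i\<in>A. c i *\<^sub>C y i) | A c. finite A \<and> A \<subseteq> I}"
  define R where "R z w \<longleftrightarrow> (\<exists>f g. (\<forall>n. (f n, g n) \<in> L) \<and> f \<longlonglongrightarrow> z \<and> g \<longlonglongrightarrow> w)" for z w
  have Ladd: "(a + a', b + b') \<in> L" if "(a, b) \<in> L" "(a', b') \<in> L" for a b a' b'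
  proof -
    from that(1) obtain A c where A: "finite A" "A \<subseteq> I" "a = (\<Sum>i\<in>A. c i *\<^sub>C x i)" "b = (\<Sum>i\<in>A. c i *\<^sub>C y i)"
      unfolding L_def by blast
    from that(2) obtain C d where C: "finite C" "C \<subseteq> I" "a' = (\<Sum>i\<in>C. d i *\<^sub>C x i)" "b' = (\<Sum>i\<in>C. d i *\<^sub>C y i)"
      unfolding L_def by blast
    show ?thesis
      unfolding A(3,4) C(3,4) sum_scaleC_merge[OF A(1) C(1)] L_def
      by (rule CollectI, intro exI conjI, rule refl) (use A C in auto)
  qed
  have Lscale: "(s *\<^sub>C a, s *\<^sub>C b) \<in> L" if "(a, b) \<in> L" for a b s
    using that unfolding L_def by (fastforce simp: scaleC.sum_right scaleC_scaleC)
  have Lle: "norm b \<le> B * norm a" if "(a, b) \<in> L" for a b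
    using that le unfolding L_def by auto
  have Radd: "R (z + z') (w + w')" if Rzw: "R z w" "R z' w'" for z w z' w'
  proof -
    obtain f g where "\<And>n. (f n, g n) \<in> L" "f \<longlonglongrightarrow> z" "g \<longlonglongrightarrow> w" using Rzw(1) unfolding R_def by blast
    moreover obtain f' g' where "\<And>n. (f' n, g' n) \<in> L" "f' \<longlonglongrightarrow> z'" "g' \<longlonglongrightarrow> w'" using Rzw(2) unfolding R_def by blast
    ultimately show ?thesis
      unfolding R_def
      by (intro exI[of _ "\<lambda>n. f n + f' n"] exI[of _ "\<lambda>n. g n + g' n"]) (auto intro: Ladd tendsto_add)
  qed
  have Rscale: "R (s *\<^sub>C z) (s *\<^sub>C w)" if Rzw: "R z w" for z w s
  proof -
    obtain f g where "\<And>n. (f n, g n) \<in> L" "f \<longlonglongrightarrow> z" "g \<longlonglongrightarrow> w" using Rzw unfolding R_def by blast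
    then show ?thesis
      unfolding R_def
      by (intro exI[of _ "\<lambda>n. s *\<^sub>C f n"] exI[of _ "\<lambda>n. s *\<^sub>C g n"]) (auto intro: Lscale scaleC.tendsto)
  qed
  have Rle: "norm w \<le> B * norm z" if Rzw: "R z w" for z w
  proof -
    obtain f g where fg: "\<And>n. (f n, g n) \<in> L" "f \<longlonglongrightarrow> z" "g \<longlonglongrightarrow> w" using Rzw unfolding R_def by blast
    have "(\<lambda>n. norm (g n)) \<longlonglongrightarrow> norm w" "(\<lambda>n. B * norm (f n)) \<longlonglongrightarrow> B * norm z"
      by (intro tendsto_intros fg)+
    then show ?thesis by (rule LIMSEQ_le) (use Lle fg in auto)
  qed
  \<comment> \<open>The difference \<open>w - w'\<close> is related to 0, so the bound
    \<open>Rle\<close> forces it to vanish.\<close>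
  have Runique: "w = w'" if "R z w" "R z w'" for z w w'
    using Rle[OF Radd[OF that(1) Rscale[OF that(2), of "- 1"]]] by (simp add: scaleC_minus_one)
  have Lfst: "\<exists>b. (a, b) \<in> L" if "a \<in> csubspace hull (x ` I)" for a
    using that unfolding cspan_explicit L_def by blast
  have Lsnd: "b \<in> csubspace hull (y ` I)" if "(a, b) \<in> L" for a b
    using that unfolding cspan_explicit L_def by blast
  have Rex: "\<exists>w. R z w" if z: "z \<in> ?X" for z
  proof -
    obtain f where f: "\<And>n. f n \<in> csubspace hull (x ` I)" "f \<longlonglongrightarrow> z"
      using z unfolding closed_cspan_def closure_sequential by auto
    have "\<forall>n. \<exists>b. (f n, b) \<in> L" using Lfst f(1) by blast
    then obtain g where g: "\<And>n. (f n, g n) \<in> L" using choice[of "\<lambda>n b. (f n, b) \<in> L"] by blast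
    have "Cauchy g"
    proof (rule metric_CauchyI)
      fix e :: real assume e: "e > 0"
      have "Cauchy f" using f(2) by (rule LIMSEQ_imp_Cauchy)
      \<comment> \<open>The modulus and the \<open>+ 1\<close> keep the divisor positive whatever
        the value of \<open>B\<close>.\<close>
      then obtain N where N: "\<And>m n. m \<ge> N \<Longrightarrow> n \<ge> N \<Longrightarrow> dist (f m) (f n) < e / (\<bar>B\<bar> + 1)"
        using e by (metis metric_CauchyD abs_ge_zero add_nonneg_pos divide_pos_pos zero_less_one)
      have "dist (g m) (g n) < e" if "m \<ge> N" "n \<ge> N" for m n
      proof -
        have "(f m - f n, g m - g n) \<in> L"
          using Ladd[OF g[of m] Lscale[OF g[of n], of "- 1"]] by (simp add: scaleC_minus_one)
        then have "dist (g m) (g n) \<le> B * dist (f m) (f n)"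
          unfolding dist_norm by (rule Lle)
        also have "\<dots> \<le> (\<bar>B\<bar> + 1) * dist (f m) (f n)"
          by (rule mult_right_mono) auto
        also have "\<dots> < (\<bar>B\<bar> + 1) * (e / (\<bar>B\<bar> + 1))"
          by (rule mult_strict_left_mono[OF N[OF that]]) simp
        also have "\<dots> = e" by (simp add: field_simps add_nonneg_eq_0_iff)
        finally show ?thesis .
      qed
      then show "\<exists>N. \<forall>m\<ge>N. \<forall>n\<ge>N. dist (g m) (g n) < e" by blast
    qed
    then obtain w where "g \<longlonglongrightarrow> w" by (auto simp: Cauchy_convergent_iff convergent_def)
    then show ?thesis unfolding R_def using f g by blast
  qed
  have RY: "w \<in> ?Y" if "R z w" for z w
    using that Lsnd unfolding R_def closed_cspan_def closure_sequential by blast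
  define T where "T z = (THE w. R z w)" for z
  have T: "T z = w" if "R z w" for z w
    unfolding T_def using that Runique by blast
  have RT: "R z (T z)" if "z \<in> ?X" for z
    using Rex[OF that] T by metis
  show ?thesis
  proof (rule that)
    show "clinear_on ?X T"
      unfolding clinear_on_def using RT by (auto intro!: T Radd Rscale)
    show "T z \<in> ?Y" if "z \<in> ?X" for z using RY RT[OF that] by blast
    show "norm (T z) \<le> B * norm z" if "z \<in> ?X" for z using Rle RT[OF that] by blast
    show "T (x i) = y i" if i: "i \<in> I" for i
    proof (rule T)
      have "(x i, y i) \<in> L"
        unfolding L_def by (intro CollectI exI[of _ "{i}"] exI[of _ "\<lambda>_. 1"]) (simp add: i)
      then show "R (x i) (y i)"
        unfolding R_def by (intro exI[of _ "\<lambda>_. x i"] exI[of _ "\<lambda>_. y i"]) auto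
    qed
  qed
qed

lemma norm_gram:
  fixes x :: "'i \<Rightarrow> 'a::complex_inner"
  shows "complex_of_real ((norm (\<Sum>i\<in>A. c i *\<^sub>C x i))\<^sup>2)
    = (\<Sum>i\<in>A. \<Sum>j\<in>A. c i * cnj (c j) * cinner (x i) (x j))"
  unfolding cinner_self[symmetric]
  by (simp add: cinner.sum_left cinner.sum_right cinner_scaleC_left cinner_scaleC_right
      sum_distrib_left mult_ac)
    (rule sum.swap)

text \<open>Equal Gram matrices give equal norms to corresponding linear combinations. So the
  assignment of \<open>y i\<close> to \<open>x i\<close> and its reverse both extend to
  contractions; these are inverse to each other and hence isometric.\<close>

lemma unitary_of_gram:
  fixes x :: "'i \<Rightarrow> 'a::chilbert_space" and y :: "'i \<Rightarrow> 'b::chilbert_space"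
  assumes gram: "\<And>i j. i \<in> I \<Longrightarrow> j \<in> I \<Longrightarrow> cinner (x i) (x j) = cinner (y i) (y j)"
  obtains U where "unitary_on (closed_cspan (x ` I)) (closed_cspan (y ` I)) U"
    "\<And>i. i \<in> I \<Longrightarrow> U (x i) = y i"
proof -
  let ?X = "closed_cspan (x ` I)" and ?Y = "closed_cspan (y ` I)"
  have eq: "norm (\<Sum>i\<in>A. c i *\<^sub>C x i) = norm (\<Sum>i\<in>A. c i *\<^sub>C y i)" if A: "A \<subseteq> I" for A c
  proof -
    have "complex_of_real ((norm (\<Sum>i\<in>A. c i *\<^sub>C x i))\<^sup>2) = complex_of_real ((norm (\<Sum>i\<in>A. c i *\<^sub>C y i))\<^sup>2)"
      unfolding norm_gram using A gram by (intro sum.cong refl arg_cong2[of _ _ _ _ times]) auto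
    then show ?thesis unfolding of_real_eq_iff by simp
  qed
  obtain U where U: "clinear_on ?X U" "\<And>z. z \<in> ?X \<Longrightarrow> U z \<in> ?Y" "\<And>i. i \<in> I \<Longrightarrow> U (x i) = y i"
    "\<And>z. z \<in> ?X \<Longrightarrow> norm (U z) \<le> 1 * norm z"
    by (rule extend_family[of I y 1 x]) (auto simp: eq)
  obtain U' where U': "clinear_on ?Y U'" "\<And>z. z \<in> ?Y \<Longrightarrow> U' z \<in> ?X" "\<And>i. i \<in> I \<Longrightarrow> U' (y i) = x i"
    "\<And>z. z \<in> ?Y \<Longrightarrow> norm (U' z) \<le> 1 * norm z"
    by (rule extend_family[of I x 1 y]) (auto simp: eq)
  have inv1: "U' (U z) = z" if "z \<in> ?X" for z
  proof (rule bounded_op_eq_on_cspan[OF refl _ bounded_op_id _ that])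
    show "bounded_op ?X (\<lambda>z. U' (U z))"
    proof (rule bounded_opI[of _ _ 1])
      show "norm (U' (U z)) \<le> 1 * norm z" if "z \<in> ?X" for z
        using U(4)[OF that] U'(4)[OF U(2)[OF that]] by simp
    qed (use U U' in \<open>auto simp: clinear_on_def\<close>)
  qed (use U U' in auto)
  have inv2: "U (U' z) = z" if "z \<in> ?Y" for z
  proof (rule bounded_op_eq_on_cspan[OF refl _ bounded_op_id _ that])
    show "bounded_op ?Y (\<lambda>z. U (U' z))"
    proof (rule bounded_opI[of _ _ 1])
      show "norm (U (U' z)) \<le> 1 * norm z" if "z \<in> ?Y" for z
        using U'(4)[OF that] U(4)[OF U'(2)[OF that]] by simp
    qed (use U U' in \<open>auto simp: clinear_on_def\<close>)
  qed (use U U' in auto)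
  have norm: "norm (U z) = norm z" if "z \<in> ?X" for z
    using U(4)[OF that] U'(4)[OF U(2)[OF that]] inv1[OF that] by simp
  have "csubspace ?X" using closed_csubspace_cspan by (auto simp: closed_csubspace_def)
  then have "isometry_on ?X ?Y U"
    unfolding isometry_on_def using U(1,2) polarization[OF _ U(1) norm] by auto
  moreover have "U ` ?X = ?Y"
    using U(2) U'(2) inv2 by (auto simp: image_iff) (metis)
  ultimately have "unitary_on ?X ?Y U" by (simp add: unitary_on_def)
  then show ?thesis using U(3) that by blast
qed

section \<open>Positive definite kernels\<close>

text \<open>One step of a Cholesky decomposition: \<open>y\<close> is to be the projection of the
  missing vector \<open>n\<close> onto the span of the earlier ones. Its inner products with them
  are prescribed by \<open>k\<close>; positivity bounds the resulting functional, and Riesz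
  representation gives \<open>y\<close>.\<close>

lemma gram_extend:
  fixes x :: "'i \<Rightarrow> 'a::chilbert_space" and k :: "'i \<Rightarrow> 'i \<Rightarrow> complex"
  assumes herm: "\<And>i j. k j i = cnj (k i j)"
    and pos: "\<And>A c. finite A \<Longrightarrow> 0 \<le> Re (\<Sum>i\<in>A. \<Sum>j\<in>A. c i * cnj (c j) * k i j)"
    and x: "\<And>i j. i \<in> L \<Longrightarrow> j \<in> L \<Longrightarrow> cinner (x i) (x j) = k i j"
    and n: "n \<notin> L"
  shows "\<exists>y\<in>closed_cspan (x ` L). (\<forall>j\<in>L. cinner (x j) y = k j n) \<and> (norm y)\<^sup>2 \<le> Re (k n n)"
proof -
  define K where "K = Re (k n n)"
  have kK: "k n n = complex_of_real K"
    using arg_cong[OF herm[of n n], of Im] by (simp add: K_def complex_eq_iff)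
  have K0: "0 \<le> K" using pos[of "{n}" "\<lambda>_. 1"] by (simp add: K_def)
  have bound: "norm (\<Sum>j\<in>A. c j *\<^sub>C k j n) \<le> sqrt K * norm (\<Sum>j\<in>A. c j *\<^sub>C x j)"
    if A: "finite A" "A \<subseteq> L" for A c
  proof -
    define s where "s = (\<Sum>j\<in>A. c j * k j n)"
    define N where "N = (norm (\<Sum>j\<in>A. c j *\<^sub>C x j))\<^sup>2"
    have N: "(\<Sum>i\<in>A. \<Sum>j\<in>A. c i * cnj (c j) * k i j) = complex_of_real N"
      unfolding N_def norm_gram using A
      by (intro sum.cong refl arg_cong2[of _ _ _ _ times] x[symmetric]) auto
    have cnjs: "cnj s = (\<Sum>j\<in>A. cnj (c j) * k n j)"
      by (simp add: s_def herm[of n])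
    \<comment> \<open>Positivity of the form at the coefficients \<open>c\<close>, extended by
      \<open>- t\<close> at the new index \<open>n\<close>.\<close>
    have quad: "0 \<le> N - 2 * Re (cnj t * s) + (cmod t)\<^sup>2 * K" for t
    proof -
      define d where "d i = (if i = n then - t else c i)" for i
      have nA: "n \<notin> A" using A n by auto
      have d: "d n = - t" "j \<in> A \<Longrightarrow> d j = c j" for j using nA by (auto simp: d_def)
      have row: "(\<Sum>j\<in>insert n A. a * cnj (d j) * k i j)
          = (\<Sum>j\<in>A. a * cnj (c j) * k i j) - a * (cnj t * k i n)" for i a
        using A nA by (simp add: d cong: sum.cong)
      have "(\<Sum>i\<in>insert n A. \<Sum>j\<in>insert n A. d i * cnj (d j) * k i j)
        = (\<Sum>i\<in>A. \<Sum>j\<in>A. c i * cnj (c j) * k i j) - (\<Sum>i\<in>A. c i * (cnj t * k i n))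
          + ((\<Sum>j\<in>A. - t * cnj (c j) * k n j) + t * (cnj t * k n n))"
        unfolding row using A nA by (simp add: d sum_subtractf cong: sum.cong)
      also have "(\<Sum>j\<in>A. - t * cnj (c j) * k n j) = - t * cnj s"
        unfolding cnjs sum_distrib_left by (simp add: mult.assoc)
      also have "(\<Sum>i\<in>A. c i * (cnj t * k i n)) = cnj t * s"
        unfolding s_def sum_distrib_left by (simp add: mult_ac)
      also have "(\<Sum>i\<in>A. \<Sum>j\<in>A. c i * cnj (c j) * k i j) - cnj t * s
          + (- t * cnj s + t * (cnj t * k n n))
        = t * cnj t * K - t * cnj s - cnj t * s + complex_of_real N"
        unfolding N kK by (simp add: algebra_simps)
      finally have "Re (\<Sum>i\<in>insert n A. \<Sum>j\<in>insert n A. d i * cnj (d j) * k i j)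
          = Re (t * cnj t * K - t * cnj s - cnj t * s + complex_of_real N)" by simp
      also have "\<dots> = N - 2 * Re (cnj t * s) + (cmod t)\<^sup>2 * K"
        by (simp add: cmod_power2) (simp add: algebra_simps power2_eq_square)
      finally show ?thesis using pos[of "insert n A" d] A by simp
    qed
    have "(cmod s)\<^sup>2 \<le> K * N"
    proof (cases "K = 0")
      case True
      have "s = 0"
      proof (rule ccontr)
        assume "s \<noteq> 0"
        then have pos: "(cmod s)\<^sup>2 > 0" by simp
        \<comment> \<open>With \<open>K = 0\<close> the quadratic is affine along multiples of
          \<open>s\<close>, and this multiple makes it \<open>N - 2 * (N + 1)\<close>, which is
          negative.\<close>
        define r where "r = (N + 1) / (cmod s)\<^sup>2"
        have "Re (cnj (complex_of_real r * s) * s) = r * (cmod s)\<^sup>2"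
          by (simp add: cmod_power2) (simp add: algebra_simps power2_eq_square)
        also have "\<dots> = N + 1" using pos by (simp add: r_def)
        finally have "0 \<le> N - 2 * (N + 1)" using quad[of "complex_of_real r * s"] True by simp
        moreover have "0 \<le> N" by (simp add: N_def)
        ultimately show False by simp
      qed
      then show ?thesis using True by simp
    next
      case False
      then have Kpos: "K > 0" using K0 by simp
      \<comment> \<open>The choice \<open>t = s / K\<close> minimises the quadratic, as in the proof
        of the Cauchy-Schwarz inequality.\<close>
      have 1: "Re (cnj (s / K) * s) = (cmod s)\<^sup>2 / K"
        by (simp add: cmod_power2) (simp add: add_divide_distrib power2_eq_square)
      have 2: "(cmod (s / K))\<^sup>2 * K = (cmod s)\<^sup>2 / K"
        using Kpos by (simp add: norm_divide power_divide power2_eq_square)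
      have "(cmod s)\<^sup>2 / K \<le> N" using quad[of "s / K"] unfolding 1 2 by linarith
      then show ?thesis using Kpos by (simp add: field_simps)
    qed
    then have "sqrt ((cmod s)\<^sup>2) \<le> sqrt (K * N)" by (rule real_sqrt_le_mono)
    then show ?thesis by (simp add: s_def scaleC_complex_def real_sqrt_mult N_def)
  qed
  obtain T where T: "clinear_on (closed_cspan (x ` L)) T" "\<And>i. i \<in> L \<Longrightarrow> T (x i) = k i n"
    "\<And>z. z \<in> closed_cspan (x ` L) \<Longrightarrow> norm (T z) \<le> sqrt K * norm z"
    using extend_family[of L "\<lambda>j. k j n" "sqrt K" x, OF bound] by (metis (no_types, lifting))
  obtain y where y: "y \<in> closed_cspan (x ` L)" "\<And>z. z \<in> closed_cspan (x ` L) \<Longrightarrow> T z = cinner z y"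
    using riesz_representation[OF closed_csubspace_cspan T(1,3)] by blast
  have "(norm y)\<^sup>2 = cmod (T y)"
    using y by (simp add: cinner_self del: of_real_power)
  also have "\<dots> \<le> sqrt K * norm y" by (rule T(3)[OF y(1)])
  finally have "norm y \<le> sqrt K"
    by (cases "y = 0") (auto simp: power2_eq_square K0)
  then have "(norm y)\<^sup>2 \<le> K"
    using K0 by (metis norm_ge_zero power_mono real_sqrt_pow2)
  moreover have "cinner (x j) y = k j n" if "j \<in> L" for j
    using that T(2) y(2)[of "x j"] by (simp add: closed_cspan_base)
  ultimately show ?thesis using y(1) unfolding K_def by blast
qed

text \<open>A Cholesky decomposition along a well-order of the index type: \<open>x i\<close> lies in the closed
  span of the earlier vectors plus a multiple of the new coordinate \<open>delta i 1\<close>.\<close>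

lemma gram_realisation:
  fixes k :: "'i \<Rightarrow> 'i \<Rightarrow> complex"
  assumes herm: "\<And>i j. k j i = cnj (k i j)"
    and pos: "\<And>A c. finite A \<Longrightarrow> 0 \<le> Re (\<Sum>i\<in>A. \<Sum>j\<in>A. c i * cnj (c j) * k i j)"
  obtains x :: "'i \<Rightarrow> ('i, complex) ell2" where "\<And>i j. cinner (x i) (x j) = k i j"
proof -
  obtain r :: "'i rel" where r: "Well_order r" "Field r = UNIV"
    using well_ordering[where 'a = 'i] by (elim exE conjE) (rule that)
  define R where "R = r - Id"
  have wfR: "wf R" using r by (simp add: R_def well_order_on_def)
  have tri: "(i, j) \<in> R \<or> i = j \<or> (j, i) \<in> R" for i j
    using r by (auto simp: R_def well_order_on_def linear_order_on_def total_on_def)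
  have transR: "trans R"
    using r unfolding R_def well_order_on_def linear_order_on_def partial_order_on_def preorder_on_def
    by (metis trans_diff_Id)
  \<comment> \<open>The last clause makes the construction triangular: the vector of
    \<open>i\<close> has no component at indices after \<open>i\<close>, so coordinate
    \<open>n\<close> is still free when the vector of \<open>n\<close> is chosen.\<close>
  define P :: "('i \<Rightarrow> ('i, complex) ell2) \<Rightarrow> 'i \<Rightarrow> ('i, complex) ell2 \<Rightarrow> bool" where
    "P f i v \<longleftrightarrow> (\<forall>j. (j, i) \<in> R \<longrightarrow> cinner (f j) v = k j i) \<and> cinner v v = k i i \<and>
      (\<forall>l. (l, i) \<notin> R \<and> l \<noteq> i \<longrightarrow> cinner v (delta l 1) = 0)" for f i v
  have "\<exists>x. \<forall>i. P x i (x i)"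
  proof (rule dependent_wf_choice[OF wfR])
    show "P f i v = P g i v" if "\<And>z. (z, i) \<in> R \<Longrightarrow> f z = g z" for f g i v
      unfolding P_def using that by auto
    fix n and f :: "'i \<Rightarrow> ('i, complex) ell2"
    assume IH: "\<And>y. (y, n) \<in> R \<Longrightarrow> P f y (f y)"
    define L where "L = {i. (i, n) \<in> R}"
    have gram: "cinner (f i) (f j) = k i j" if "i \<in> L" "j \<in> L" for i j
      using tri[of i j]
    proof (elim disjE)
      show ?thesis if "(j, i) \<in> R"
        using IH[of i] that \<open>i \<in> L\<close>
        by (subst cinner_commute, subst herm) (simp add: L_def P_def)
    qed (use that IH in \<open>auto simp: L_def P_def\<close>)
    have nL: "n \<notin> L" by (auto simp: L_def R_def)
    obtain y where y: "y \<in> closed_cspan (f ` L)" "\<And>j. j \<in> L \<Longrightarrow> cinner (f j) y = k j n"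
      "(norm y)\<^sup>2 \<le> Re (k n n)"
      using gram_extend[OF herm pos gram nL] by blast
    have ydelta: "cinner y (delta l 1) = 0" if l: "l \<notin> L" for l
    proof (rule cinner_cspan_eq_0[OF _ y(1)])
      fix v assume "v \<in> f ` L"
      then obtain i where i: "i \<in> L" "v = f i" by auto
      have "(l, i) \<notin> R" "l \<noteq> i"
        using l i transR unfolding L_def by (auto dest: transD)
      then show "cinner v (delta l 1) = 0"
        using IH[of i] i by (auto simp: L_def P_def)
    qed
    \<comment> \<open>The length that \<open>y\<close> lacks; it is placed in coordinate
      \<open>n\<close>, where neither \<open>y\<close> nor any earlier vector has a
      component.\<close>
    define s where "s = sqrt (Re (k n n) - (norm y)\<^sup>2)"
    have s: "s\<^sup>2 = Re (k n n) - (norm y)\<^sup>2" using y(3) by (simp add: s_def)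
    define v where "v = y + delta n (complex_of_real s)"
    have ddelta: "cinner y (delta n (complex_of_real s)) = 0"
      using ydelta[OF nL] by (simp add: cinner_delta_right cinner_complex_def)
    have fdelta: "cinner (f j) (delta n c) = 0" if "j \<in> L" for j c
    proof -
      have "(n, j) \<notin> R" "n \<noteq> j"
        using that transR nL unfolding L_def by (auto dest: transD)
      then show ?thesis using IH[of j] that
        by (auto simp: L_def P_def cinner_delta_right cinner_complex_def)
    qed
    have "cinner v v = k n n"
    proof -
      have "Im (k n n) = 0" using arg_cong[OF herm[of n n], of Im] by simp
      moreover have "(norm v)\<^sup>2 = Re (k n n)"
        using s by (simp add: v_def norm_add_sq ddelta norm_delta)
      ultimately show ?thesis unfolding cinner_self by (simp add: complex_eq_iff)
    qed
    moreover have "cinner (f j) v = k j n" if "(j, n) \<in> R" for j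
      using that y(2) fdelta by (simp add: v_def cinner.add_right L_def)
    moreover have "cinner v (delta l 1) = 0" if "(l, n) \<notin> R" "l \<noteq> n" for l
      using ydelta[of l] that by (simp add: v_def L_def cinner.add_left cinner_delta_right
          plus_ell2.rep_eq coord_delta cinner.zero_left)
    ultimately show "\<exists>v. P f n v" unfolding P_def by blast
  qed
  then obtain x where x: "\<And>i. P x i (x i)" by blast
  have "cinner (x i) (x j) = k i j" for i j
    using tri[of i j]
  proof (elim disjE)
    show ?thesis if "(j, i) \<in> R"
      using x[of i] that by (subst cinner_commute, subst herm) (simp add: P_def)
  qed (use x in \<open>auto simp: P_def\<close>)
  then show ?thesis by (rule that)
qed

section \<open>Prefixes and suffixes of morphisms\<close>

lemma vec_diff_add: "p \<le> n \<Longrightarrow> p + (n - p) = n" for p n :: "nat ^ 'r::finite"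
  by (simp add: vec_eq_iff less_eq_vec_def)

lemma vec_zero_le: "0 \<le> n" for n :: "nat ^ 'r::finite"
  by (simp add: less_eq_vec_def)

lemma vec_diff_le: "n - p \<le> n" for p n :: "nat ^ 'r::finite"
  by (simp add: less_eq_vec_def)

lemma vec_le_add: "p \<le> p + q" "p \<le> q + p" for p q :: "nat ^ 'r::finite"
  by (simp_all add: less_eq_vec_def)

definition vmin :: "nat ^ 'r::finite \<Rightarrow> nat ^ 'r \<Rightarrow> nat ^ 'r" where
  "vmin p q = (\<chi> j. min (p $ j) (q $ j))"

lemma vmin_le: "vmin p q \<le> p" "vmin p q \<le> q"
  by (simp_all add: vmin_def less_eq_vec_def)

lemma vmin_greatest: "s \<le> p \<Longrightarrow> s \<le> q \<Longrightarrow> s \<le> vmin p q"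
  by (simp add: vmin_def less_eq_vec_def)

lemma vmin_commute: "vmin p q = vmin q p"
  by (simp add: vmin_def min.commute)

lemma vmin_add: "vmin (s + p) (s + q) = s + vmin p q"
  by (simp add: vmin_def vec_eq_iff min_def)

lemma vmin_eq_0:
  assumes "\<And>j. p $ j \<noteq> 0 \<Longrightarrow> q $ j = 0"
  shows "vmin p q = 0"
proof -
  have "min (p $ j) (q $ j) = 0" for j using assms[of j] by (cases "p $ j = 0") auto
  then show ?thesis by (simp add: vmin_def vec_eq_iff)
qed

lemma e_vec_nth: "e_vec u $ j = (if j \<in> u then 1 else 0)"
proof -
  have "(\<Sum>i\<in>u. axis i (1::nat)) $ j = (\<Sum>i\<in>u. if i = j then 1 else 0)"
    by (simp add: axis_def)
  then show ?thesis by (simp add: e_vec_def)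
qed

lemma e_vec_mono: "u \<subseteq> v \<Longrightarrow> e_vec u \<le> e_vec v"
  by (auto simp: less_eq_vec_def e_vec_nth)

lemma e_vec_empty: "e_vec {} = 0"
  by (simp add: e_vec_def)

context rank_graph
begin

definition composable :: "'l \<Rightarrow> 'l \<Rightarrow> bool" where
  "composable \<mu> \<nu> \<longleftrightarrow> \<mu> \<in> mor \<Lambda> \<and> \<nu> \<in> mor \<Lambda> \<and> src \<Lambda> \<mu> = rng \<Lambda> \<nu>"

text \<open>The degree of \<open>\<nu>\<close> is left out because additivity and cancellation
  determine it, so the factorisation property still gives uniqueness. \<open>pre\<close> and
  \<open>suf\<close> are meaningful for \<open>p \<le> deg \<Lambda> l\<close>.\<close>

definition factors :: "'l \<Rightarrow> nat ^ 'r \<Rightarrow> 'l \<Rightarrow> 'l \<Rightarrow> bool" where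
  "factors l p \<mu> \<nu> \<longleftrightarrow> composable \<mu> \<nu> \<and> deg \<Lambda> \<mu> = p \<and> l = cmp \<Lambda> \<mu> \<nu>"

definition pre :: "'l \<Rightarrow> nat ^ 'r \<Rightarrow> 'l" where
  "pre l p = (THE \<mu>. \<exists>\<nu>. factors l p \<mu> \<nu>)"

definition suf :: "'l \<Rightarrow> nat ^ 'r \<Rightarrow> 'l" where
  "suf l p = (THE \<nu>. \<exists>\<mu>. factors l p \<mu> \<nu>)"

lemma composableD:
  assumes "composable \<mu> \<nu>"
  shows "\<mu> \<in> mor \<Lambda>" "\<nu> \<in> mor \<Lambda>" "src \<Lambda> \<mu> = rng \<Lambda> \<nu>" "cmp \<Lambda> \<mu> \<nu> \<in> mor \<Lambda>"
    "deg \<Lambda> (cmp \<Lambda> \<mu> \<nu>) = deg \<Lambda> \<mu> + deg \<Lambda> \<nu>" "rng \<Lambda> (cmp \<Lambda> \<mu> \<nu>) = rng \<Lambda> \<mu>"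
    "src \<Lambda> (cmp \<Lambda> \<mu> \<nu>) = src \<Lambda> \<nu>"
  using assms by (auto simp: composable_def cmp_mor deg_cmp rng_cmp src_cmp)

lemma factors_unique:
  assumes "factors l p \<mu> \<nu>" "factors l p \<mu>' \<nu>'"
  shows "\<mu> = \<mu>' \<and> \<nu> = \<nu>'"
proof -
  have l: "l \<in> mor \<Lambda>" "deg \<Lambda> l = p + deg \<Lambda> \<nu>" "deg \<Lambda> l = p + deg \<Lambda> \<nu>'"
    using assms composableD(4,5)[of \<mu> \<nu>] composableD(5)[of \<mu>' \<nu>'] by (auto simp: factors_def)
  then have "deg \<Lambda> \<nu>' = deg \<Lambda> \<nu>" by simp
  then show ?thesis
    using factorisation[OF l(1,2)] assms unfolding factors_def composable_def by blast
qed

lemma factors_pre_suf: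
  assumes "factors l p \<mu> \<nu>"
  shows "pre l p = \<mu>" "suf l p = \<nu>"
  unfolding pre_def suf_def using assms factors_unique by blast+

lemma pre_suf_cmp:
  assumes "composable \<mu> \<nu>"
  shows "pre (cmp \<Lambda> \<mu> \<nu>) (deg \<Lambda> \<mu>) = \<mu>" "suf (cmp \<Lambda> \<mu> \<nu>) (deg \<Lambda> \<mu>) = \<nu>"
proof -
  have "factors (cmp \<Lambda> \<mu> \<nu>) (deg \<Lambda> \<mu>) \<mu> \<nu>" using assms by (simp add: factors_def)
  then show "pre (cmp \<Lambda> \<mu> \<nu>) (deg \<Lambda> \<mu>) = \<mu>" "suf (cmp \<Lambda> \<mu> \<nu>) (deg \<Lambda> \<mu>) = \<nu>"
    by (rule factors_pre_suf)+
qed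

lemma factors_pre_suf':
  assumes "l \<in> mor \<Lambda>" "p \<le> deg \<Lambda> l"
  shows "factors l p (pre l p) (suf l p)"
proof -
  have "deg \<Lambda> l = p + (deg \<Lambda> l - p)" using assms by (simp add: vec_diff_add)
  from factorisation[OF assms(1) this] obtain \<mu> \<nu> where "factors l p \<mu> \<nu>"
    unfolding factors_def composable_def by blast
  then show ?thesis using factors_pre_suf by metis
qed

lemma pre_suf:
  assumes "l \<in> mor \<Lambda>" "p \<le> deg \<Lambda> l"
  shows "composable (pre l p) (suf l p)" "pre l p \<in> mor \<Lambda>" "suf l p \<in> mor \<Lambda>"
    "deg \<Lambda> (pre l p) = p" "deg \<Lambda> (suf l p) = deg \<Lambda> l - p"
    "src \<Lambda> (pre l p) = rng \<Lambda> (suf l p)" "cmp \<Lambda> (pre l p) (suf l p) = l"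
    "rng \<Lambda> (pre l p) = rng \<Lambda> l" "src \<Lambda> (suf l p) = src \<Lambda> l"
proof -
  have f: "composable (pre l p) (suf l p)" "deg \<Lambda> (pre l p) = p" "cmp \<Lambda> (pre l p) (suf l p) = l"
    using factors_pre_suf'[OF assms] by (auto simp: factors_def)
  note c = composableD[OF f(1), unfolded f(2,3)]
  show "composable (pre l p) (suf l p)" "pre l p \<in> mor \<Lambda>" "suf l p \<in> mor \<Lambda>"
    "deg \<Lambda> (pre l p) = p" "src \<Lambda> (pre l p) = rng \<Lambda> (suf l p)" "cmp \<Lambda> (pre l p) (suf l p) = l"
    "rng \<Lambda> (pre l p) = rng \<Lambda> l" "src \<Lambda> (suf l p) = src \<Lambda> l" "deg \<Lambda> (suf l p) = deg \<Lambda> l - p"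
    using f c by simp_all
qed

lemma composable_id:
  "l \<in> mor \<Lambda> \<Longrightarrow> composable (rng \<Lambda> l) l" "l \<in> mor \<Lambda> \<Longrightarrow> composable l (src \<Lambda> l)"
  using obj_mor by (auto simp: composable_def rng_obj src_obj rng_id src_id)

lemma composable_assoc:
  assumes "composable k l" "composable l m"
  shows "composable (cmp \<Lambda> k l) m" "composable k (cmp \<Lambda> l m)"
    "cmp \<Lambda> (cmp \<Lambda> k l) m = cmp \<Lambda> k (cmp \<Lambda> l m)"
  using assms by (auto simp: composable_def cmp_mor src_cmp rng_cmp cmp_assoc)

lemma pre_suf_0: "l \<in> mor \<Lambda> \<Longrightarrow> pre l 0 = rng \<Lambda> l" "l \<in> mor \<Lambda> \<Longrightarrow> suf l 0 = l"
  using pre_suf_cmp[OF composable_id(1)] by (auto simp: cmp_id_left deg_id rng_obj)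

lemma pre_suf_deg: "l \<in> mor \<Lambda> \<Longrightarrow> pre l (deg \<Lambda> l) = l" "l \<in> mor \<Lambda> \<Longrightarrow> suf l (deg \<Lambda> l) = src \<Lambda> l"
  using pre_suf_cmp[OF composable_id(2)] by (auto simp: cmp_id_right)

text \<open>Cutting \<open>l\<close> at degree 0 leaves its range as prefix, and cutting at its own
  degree leaves \<open>l\<close> itself; here both cuts coincide.\<close>

lemma deg_0_obj: "l \<in> mor \<Lambda> \<Longrightarrow> deg \<Lambda> l = 0 \<Longrightarrow> l \<in> obj \<Lambda>"
  using pre_suf_0(1)[of l] pre_suf_deg(1)[of l] rng_obj[of l] by simp

text \<open>The cut falls inside the first factor; associativity exhibits a factorisation of the
  right degree, and uniqueness identifies it. \<open>pre_suf_cmp_ge\<close> treats a cut inside the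
  second factor.\<close>

lemma pre_suf_cmp_le:
  assumes c: "composable \<mu> \<nu>" and p: "p \<le> deg \<Lambda> \<mu>"
  shows "pre (cmp \<Lambda> \<mu> \<nu>) p = pre \<mu> p" "suf (cmp \<Lambda> \<mu> \<nu>) p = cmp \<Lambda> (suf \<mu> p) \<nu>"
    "composable (suf \<mu> p) \<nu>"
proof -
  note \<mu> = pre_suf[OF composableD(1)[OF c] p]
  show c': "composable (suf \<mu> p) \<nu>"
    using c \<mu> by (simp add: composable_def)
  note a = composable_assoc[OF \<mu>(1) c']
  have "factors (cmp \<Lambda> \<mu> \<nu>) p (pre \<mu> p) (cmp \<Lambda> (suf \<mu> p) \<nu>)"
    using a \<mu> by (simp add: factors_def)
  then show "pre (cmp \<Lambda> \<mu> \<nu>) p = pre \<mu> p" "suf (cmp \<Lambda> \<mu> \<nu>) p = cmp \<Lambda> (suf \<mu> p) \<nu>"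
    by (rule factors_pre_suf)+
qed

lemma pre_suf_cmp_ge:
  assumes c: "composable \<mu> \<nu>" and q: "q \<le> deg \<Lambda> \<nu>"
  shows "pre (cmp \<Lambda> \<mu> \<nu>) (deg \<Lambda> \<mu> + q) = cmp \<Lambda> \<mu> (pre \<nu> q)"
    "suf (cmp \<Lambda> \<mu> \<nu>) (deg \<Lambda> \<mu> + q) = suf \<nu> q" "composable \<mu> (pre \<nu> q)"
proof -
  note \<nu> = pre_suf[OF composableD(2)[OF c] q]
  show c': "composable \<mu> (pre \<nu> q)"
    using c \<nu> by (simp add: composable_def)
  note a = composable_assoc[OF c' \<nu>(1)]
  have "factors (cmp \<Lambda> \<mu> \<nu>) (deg \<Lambda> \<mu> + q) (cmp \<Lambda> \<mu> (pre \<nu> q)) (suf \<nu> q)"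
    using a \<nu> composableD[OF c'] by (simp add: factors_def)
  then show "pre (cmp \<Lambda> \<mu> \<nu>) (deg \<Lambda> \<mu> + q) = cmp \<Lambda> \<mu> (pre \<nu> q)"
    "suf (cmp \<Lambda> \<mu> \<nu>) (deg \<Lambda> \<mu> + q) = suf \<nu> q"
    by (rule factors_pre_suf)+
qed

lemma pre_pre:
  assumes "l \<in> mor \<Lambda>" "q \<le> deg \<Lambda> l" "p \<le> q"
  shows "pre (pre l q) p = pre l p" "suf l p = cmp \<Lambda> (suf (pre l q) p) (suf l q)"
    "composable (suf (pre l q) p) (suf l q)"
  using pre_suf_cmp_le[OF pre_suf(1)[OF assms(1,2)], of p] assms by (auto simp: pre_suf)

lemma pre_eq_mono:
  assumes "l \<in> mor \<Lambda>" "m \<in> mor \<Lambda>" "q \<le> deg \<Lambda> l" "q \<le> deg \<Lambda> m" "p \<le> q" "pre l q = pre m q"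
  shows "pre l p = pre m p"
  using pre_pre(1)[OF assms(1,3,5)] pre_pre(1)[OF assms(2,4,5)] assms(6) by simp

lemma cmp_cancel_left:
  assumes "composable k l" "composable k m" "cmp \<Lambda> k l = cmp \<Lambda> k m"
  shows "l = m"
  using pre_suf_cmp(2)[OF assms(1)] pre_suf_cmp(2)[OF assms(2)] assms(3) by metis

lemma mor_degD: "l \<in> mor_deg \<Lambda> n \<Longrightarrow> l \<in> mor \<Lambda>" "l \<in> mor_deg \<Lambda> n \<Longrightarrow> deg \<Lambda> l = n"
  by (auto simp: mor_deg_def)

end

section \<open>Contractions\<close>

locale graph_contraction = rank_graph \<Lambda>
  for \<Lambda> :: "('l, 'r::finite) rank_graph_data" +
  fixes V :: "'l \<Rightarrow> 'h::chilbert_space \<Rightarrow> 'h"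
  assumes contr: "contraction \<Lambda> UNIV V"
begin

abbreviation Vs :: "'l \<Rightarrow> 'h \<Rightarrow> 'h" where "Vs l \<equiv> adj UNIV (V l)"

lemma V_bounded: "l \<in> mor \<Lambda> \<Longrightarrow> bounded_op UNIV (V l)"
  using contr by (auto simp: contraction_def)

lemma V_linear: "l \<in> mor \<Lambda> \<Longrightarrow> clinear_on UNIV (V l)"
  using V_bounded bounded_opD(2) by blast

lemma V_add: "l \<in> mor \<Lambda> \<Longrightarrow> V l (x + y) = V l x + V l y"
  using V_linear clinear_onD(1) by blast

lemma V_scaleC: "l \<in> mor \<Lambda> \<Longrightarrow> V l (c *\<^sub>C x) = c *\<^sub>C V l x"
  using V_linear clinear_onD(2) by blast

lemma V_0: "l \<in> mor \<Lambda> \<Longrightarrow> V l 0 = 0"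
  using clinear_on_0[OF csubspace_UNIV V_linear] .

lemma V_sum: "l \<in> mor \<Lambda> \<Longrightarrow> V l (sum f A) = (\<Sum>i\<in>A. V l (f i))"
  by (rule clinear_on_sum[OF csubspace_UNIV V_linear]) auto

lemma cinner_Vs_right: "l \<in> mor \<Lambda> \<Longrightarrow> cinner x (Vs l y) = cinner (V l x) y"
  using cinner_adj_right[OF closed_csubspace_UNIV V_bounded] by blast

lemma cinner_Vs_left: "l \<in> mor \<Lambda> \<Longrightarrow> cinner (Vs l y) x = cinner y (V l x)"
  using cinner_adj_left[OF closed_csubspace_UNIV V_bounded] by blast

lemma Vs_linear: "l \<in> mor \<Lambda> \<Longrightarrow> clinear_on UNIV (Vs l)"
  using bounded_op_adj[OF closed_csubspace_UNIV V_bounded] bounded_opD(2) by blast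

lemma V_cmp: "composable l m \<Longrightarrow> V l (V m x) = V (cmp \<Lambda> l m) x"
  using contr by (auto simp: contraction_def composable_def)

lemma V_not_composable:
  "l \<in> mor \<Lambda> \<Longrightarrow> m \<in> mor \<Lambda> \<Longrightarrow> src \<Lambda> l \<noteq> rng \<Lambda> m \<Longrightarrow> V l (V m x) = 0"
  using contr by (auto simp: contraction_def)

lemma V_src: "l \<in> mor \<Lambda> \<Longrightarrow> V l (V (src \<Lambda> l) x) = V l x"
  using V_cmp[OF composable_id(2)] by (simp add: cmp_id_right)

lemma V_rng: "l \<in> mor \<Lambda> \<Longrightarrow> V (rng \<Lambda> l) (V l x) = V l x"
  using V_cmp[OF composable_id(1)] by (simp add: cmp_id_left)

lemma V_obj_idem: "a \<in> obj \<Lambda> \<Longrightarrow> V a (V a x) = V a x"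
  using contr by (auto simp: contraction_def orth_projection_def)

lemma cinner_V_obj: "a \<in> obj \<Lambda> \<Longrightarrow> cinner (V a x) y = cinner x (V a y)"
  using contr cinner_Vs_right[of a x y] obj_mor
  by (auto simp: contraction_def orth_projection_def)

lemma cinner_V_rng: "l \<in> mor \<Lambda> \<Longrightarrow> cinner (V l x) (V (rng \<Lambda> l) y) = cinner (V l x) y"
  by (simp add: cinner_V_obj[symmetric] rng_obj V_rng)

lemma cinner_V_diff_rng:
  assumes "l \<in> mor \<Lambda>" "m \<in> mor \<Lambda>" "rng \<Lambda> l \<noteq> rng \<Lambda> m"
  shows "cinner (V l x) (V m y) = 0"
proof -
  have "cinner (V l x) (V m y) = cinner (V (rng \<Lambda> m) (V l x)) (V m y)"
    using assms by (simp add: cinner_V_obj rng_obj V_rng)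
  also have "\<dots> = 0"
    using assms obj_mor by (subst V_not_composable) (auto simp: rng_obj src_id cinner.zero_left)
  finally show ?thesis .
qed

lemma range_V_iff: "a \<in> obj \<Lambda> \<Longrightarrow> x \<in> range (V a) \<longleftrightarrow> V a x = x"
  using V_obj_idem by (metis rangeE rangeI)

lemma Vs_range: "l \<in> mor \<Lambda> \<Longrightarrow> Vs l x \<in> range (V (src \<Lambda> l))"
proof -
  assume l: "l \<in> mor \<Lambda>"
  have "cinner z (V (src \<Lambda> l) (Vs l x)) = cinner z (Vs l x)" for z
    using l by (simp add: cinner_V_obj[symmetric] src_obj cinner_Vs_right V_src)
  then have "cinner (V (src \<Lambda> l) (Vs l x) - Vs l x) (V (src \<Lambda> l) (Vs l x) - Vs l x) = 0"
    by (simp add: cinner.diff_right)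
  then show ?thesis by (simp add: range_V_iff l src_obj cinner_self)
qed

text \<open>Pairing the defining operator inequality with \<open>x\<close> turns each term
  \<open>V l (Vs l x)\<close> into a squared norm.\<close>

lemma bessel:
  assumes F: "finite F" "F \<subseteq> mor_deg \<Lambda> n"
  shows "(\<Sum>l\<in>F. (norm (Vs l x))\<^sup>2) \<le> (norm x)\<^sup>2"
proof -
  have summ: "(\<lambda>l. V l (Vs l x)) summable_on mor_deg \<Lambda> n"
    and le: "op_le UNIV (\<lambda>x. \<Sum>\<^sub>\<infinity>l\<in>mor_deg \<Lambda> n. V l (Vs l x)) (\<lambda>x. x)"
    using contr by (auto simp: contraction_def)
  define s where "s = (\<Sum>\<^sub>\<infinity>l\<in>mor_deg \<Lambda> n. V l (Vs l x))"
  have "cinner (x - s) x \<in> \<real>\<^sub>\<ge>\<^sub>0"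
    using le unfolding op_le_def op_nonneg_def s_def by blast
  then have "0 \<le> Re (cinner (x - s) x)" by (simp add: complex_nonneg_Reals_iff)
  then have s_le: "Re (cinner s x) \<le> (norm x)\<^sup>2"
    by (simp add: cinner.diff_left cinner_self del: of_real_power)
  have "((\<lambda>l. inner (V l (Vs l x)) x) has_sum inner s x) (mor_deg \<Lambda> n)"
    using has_sum_infsum[OF summ] unfolding s_def
    by (rule has_sum_bounded_linear[OF bounded_linear_inner_left])
  moreover have "inner (V l (Vs l x)) x = (norm (Vs l x))\<^sup>2" if "l \<in> mor_deg \<Lambda> n" for l
    using mor_degD(1)[OF that]
    by (simp add: Re_cinner[symmetric] cinner_Vs_right[symmetric] cinner_self del: of_real_power)
  ultimately have hs: "((\<lambda>l. (norm (Vs l x))\<^sup>2) has_sum inner s x) (mor_deg \<Lambda> n)"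
    by (subst (asm) has_sum_cong) auto
  have "(\<Sum>l\<in>F. (norm (Vs l x))\<^sup>2) \<le> (\<Sum>\<^sub>\<infinity>l\<in>mor_deg \<Lambda> n. (norm (Vs l x))\<^sup>2)"
    by (rule finite_sum_le_infsum[OF has_sum_imp_summable[OF hs] F]) simp
  then show ?thesis using s_le by (simp add: infsumI[OF hs] Re_cinner)
qed

text \<open>This is dual to \<open>bessel\<close>: the column formed by the adjoints is contractive,
  hence so is the row. Writing \<open>y\<close> for the row sum, \<open>(norm y)\<^sup>2\<close> is
  a sum of inner products of \<open>x l\<close> with \<open>Vs l y\<close>; the inequality between
  the two means bounds it, and half of \<open>(norm y)\<^sup>2\<close> is absorbed on the
  left.\<close>

lemma row_contraction:
  assumes F: "finite F" "F \<subseteq> mor_deg \<Lambda> n"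
  shows "(norm (\<Sum>l\<in>F. V l (x l)))\<^sup>2 \<le> (\<Sum>l\<in>F. (norm (x l))\<^sup>2)"
proof -
  define y where "y = (\<Sum>l\<in>F. V l (x l))"
  have "(\<Sum>l\<in>F. cinner (x l) (Vs l y)) = cinner y y"
    unfolding y_def cinner.sum_left using F mor_degD(1)
    by (intro sum.cong refl cinner_Vs_right) blast
  then have "(norm y)\<^sup>2 = Re (\<Sum>l\<in>F. cinner (x l) (Vs l y))"
    by (simp add: cinner_self del: of_real_power Re_sum)
  also have "\<dots> = (\<Sum>l\<in>F. Re (cinner (x l) (Vs l y)))" by simp
  also have "\<dots> \<le> (\<Sum>l\<in>F. ((norm (x l))\<^sup>2 + (norm (Vs l y))\<^sup>2) / 2)"
  proof (rule sum_mono)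
    fix l
    have "Re (cinner (x l) (Vs l y)) \<le> norm (x l) * norm (Vs l y)"
      unfolding Re_cinner by (rule norm_cauchy_schwarz)
    also have "\<dots> \<le> ((norm (x l))\<^sup>2 + (norm (Vs l y))\<^sup>2) / 2"
      using sum_squares_bound[of "norm (x l)" "norm (Vs l y)"] by simp
    finally show "Re (cinner (x l) (Vs l y)) \<le> ((norm (x l))\<^sup>2 + (norm (Vs l y))\<^sup>2) / 2" .
  qed
  also have "\<dots> = ((\<Sum>l\<in>F. (norm (x l))\<^sup>2) + (\<Sum>l\<in>F. (norm (Vs l y))\<^sup>2)) / 2"
    by (simp add: sum_divide_distrib[symmetric] sum.distrib)
  also have "\<dots> \<le> ((\<Sum>l\<in>F. (norm (x l))\<^sup>2) + (norm y)\<^sup>2) / 2"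
    using bessel[OF F, of y] by simp
  finally show ?thesis by (simp add: y_def)
qed

end

section \<open>The operators of the positivity condition\<close>

lemma sum_infsum_disjoint_le:
  fixes g :: "'i \<Rightarrow> real"
  assumes "finite M" "disjoint_family_on C M" "g summable_on UNIV" "\<And>i. 0 \<le> g i"
  shows "(\<Sum>m\<in>M. infsum g (C m)) \<le> infsum g UNIV"
proof -
  have summ: "g summable_on A" for A
    using assms(3) by (rule summable_on_subset_banach) simp
  have "(\<Sum>m\<in>M. infsum g (C m)) = infsum g (\<Union>m\<in>M. C m)"
    using assms(1,2)
  proof (induction M rule: finite_induct)
    case (insert m M)
    have "C m \<inter> (\<Union>m\<in>M. C m) = {}"
      using insert by (force simp: disjoint_family_on_def)
    then have "infsum g (\<Union>m\<in>insert m M. C m) = infsum g (C m) + infsum g (\<Union>m\<in>M. C m)"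
      using infsum_Un_disjoint[OF summ summ, of "C m" "\<Union>m\<in>M. C m"] by simp
    then show ?case
      using insert disjoint_family_on_mono[of M "insert m M" C] by auto
  qed simp
  also have "\<dots> \<le> infsum g UNIV"
    by (rule infsum_mono_neutral[OF summ summ]) (use assms in auto)
  finally show ?thesis .
qed

lemma closed_csubspace_has_sum:
  assumes S: "closed_csubspace S" and f: "\<And>i. i \<in> A \<Longrightarrow> f i \<in> S" and s: "(f has_sum s) A"
  shows "s \<in> S"
proof (rule Lim_in_closed_set)
  show "closed S" using S by (simp add: closed_csubspace_def)
  show "(sum f \<longlongrightarrow> s) (finite_subsets_at_top A)" using s by (simp add: has_sum_def)
  show "\<forall>\<^sub>F F in finite_subsets_at_top A. sum f F \<in> S"
    by (rule eventually_finite_subsets_at_top_weakI)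
      (use S f in \<open>auto simp: closed_csubspace_def intro!: csubspace_sum\<close>)
qed simp

context graph_contraction
begin

lemma bessel_inj:
  assumes "finite F" "inj_on s F" "s ` F \<subseteq> mor_deg \<Lambda> n"
  shows "(\<Sum>i\<in>F. (norm (Vs (s i) x))\<^sup>2) \<le> (norm x)\<^sup>2"
  using bessel[of "s ` F" n x] assms by (simp add: sum.reindex)

lemma row_contraction_inj:
  assumes "finite F" "inj_on s F" "s ` F \<subseteq> mor_deg \<Lambda> n"
  shows "(norm (\<Sum>i\<in>F. V (s i) (x i)))\<^sup>2 \<le> (\<Sum>i\<in>F. (norm (x i))\<^sup>2)"
  using row_contraction[of "s ` F" n "x \<circ> inv_into F s"] assms by (simp add: sum.reindex)

definition fiber :: "nat ^ 'r \<Rightarrow> nat ^ 'r \<Rightarrow> 'l \<Rightarrow> 'l set" where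
  "fiber n q \<mu> = {\<kappa> \<in> mor_deg \<Lambda> n. pre \<kappa> q = \<mu>}"

definition row_sum :: "nat ^ 'r \<Rightarrow> nat ^ 'r \<Rightarrow> 'l \<Rightarrow> ('l, 'h) ell2 \<Rightarrow> 'h" where
  "row_sum n q \<mu> f = (\<Sum>\<^sub>\<infinity>\<kappa>\<in>fiber n q \<mu>. V (suf \<kappa> q) (coord f \<kappa>))"

text \<open>This is the direct sum, over the prefixes \<mu> of degree \<open>q\<close>, of the row
  operator \<open>row_sum n q \<mu>\<close> followed by its adjoint. For \<open>n = e_vec v\<close>
  and \<open>q = e_vec v - e_vec u\<close> it is the operator of the positivity condition for
  \<open>u\<close> and \<open>v\<close>.\<close>

definition block_op :: "nat ^ 'r \<Rightarrow> nat ^ 'r \<Rightarrow> ('l, 'h) ell2 \<Rightarrow> ('l, 'h) ell2" where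
  "block_op n q f =
    Abs_ell2 (\<lambda>\<kappa>. if \<kappa> \<in> mor_deg \<Lambda> n then Vs (suf \<kappa> q) (row_sum n q (pre \<kappa> q) f) else 0)"

context
  fixes n q :: "nat ^ 'r"
  assumes qn: "q \<le> n"
begin

lemma fiber_mor:
  assumes "\<kappa> \<in> mor_deg \<Lambda> n"
  shows "\<kappa> \<in> mor \<Lambda>" "q \<le> deg \<Lambda> \<kappa>" "suf \<kappa> q \<in> mor \<Lambda>" "suf \<kappa> q \<in> mor_deg \<Lambda> (n - q)"
    "src \<Lambda> (suf \<kappa> q) = src \<Lambda> \<kappa>"
  using assms qn by (auto simp: mor_deg_def pre_suf)

lemma inj_on_suf: "inj_on (\<lambda>\<kappa>. suf \<kappa> q) (fiber n q \<mu>)"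
proof (rule inj_onI)
  fix \<kappa> \<kappa>' assume k: "\<kappa> \<in> fiber n q \<mu>" "\<kappa>' \<in> fiber n q \<mu>" "suf \<kappa> q = suf \<kappa>' q"
  then have "cmp \<Lambda> (pre \<kappa> q) (suf \<kappa> q) = cmp \<Lambda> (pre \<kappa>' q) (suf \<kappa>' q)" by (simp add: fiber_def)
  moreover have "cmp \<Lambda> (pre \<kappa> q) (suf \<kappa> q) = \<kappa>" if "\<kappa> \<in> fiber n q \<mu>" for \<kappa>
    by (rule pre_suf(7)) (use that fiber_mor(1,2) in \<open>auto simp: fiber_def\<close>)
  note this[OF k(1)] this[OF k(2)]
  ultimately show "\<kappa> = \<kappa>'" by simp
qed

lemma row_summable:
  shows "(\<lambda>\<kappa>. V (suf \<kappa> q) (coord f \<kappa>)) summable_on fiber n q \<mu>"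
    and "(norm (row_sum n q \<mu> f))\<^sup>2 \<le> (\<Sum>\<^sub>\<infinity>\<kappa>\<in>fiber n q \<mu>. (norm (coord f \<kappa>))\<^sup>2)"
proof -
  have summ: "(\<lambda>\<kappa>. (norm (coord f \<kappa>))\<^sup>2) summable_on fiber n q \<mu>"
    by (rule summable_on_subset_banach[OF coord_summable]) simp
  have le: "(norm (\<Sum>\<kappa>\<in>F. V (suf \<kappa> q) (coord f \<kappa>)))\<^sup>2 \<le> (\<Sum>\<kappa>\<in>F. (norm (coord f \<kappa>))\<^sup>2)"
    if F: "finite F" "F \<subseteq> fiber n q \<mu>" for F
    by (rule row_contraction_inj[OF F(1) inj_on_subset[OF inj_on_suf F(2)], of "n - q"])
      (use F fiber_mor in \<open>auto simp: fiber_def\<close>)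
  show "(\<lambda>\<kappa>. V (suf \<kappa> q) (coord f \<kappa>)) summable_on fiber n q \<mu>"
    by (rule summable_on_norm_sum_bound(1)[OF summ le])
  show "(norm (row_sum n q \<mu> f))\<^sup>2 \<le> (\<Sum>\<^sub>\<infinity>\<kappa>\<in>fiber n q \<mu>. (norm (coord f \<kappa>))\<^sup>2)"
    unfolding row_sum_def by (rule summable_on_norm_sum_bound(2)[OF summ le])
qed

lemma row_sum_add: "row_sum n q \<mu> (f + g) = row_sum n q \<mu> f + row_sum n q \<mu> g"
proof -
  have "row_sum n q \<mu> (f + g) =
      (\<Sum>\<^sub>\<infinity>\<kappa>\<in>fiber n q \<mu>. V (suf \<kappa> q) (coord f \<kappa>) + V (suf \<kappa> q) (coord g \<kappa>))"
    unfolding row_sum_def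
    by (rule infsum_cong) (simp add: fiber_def fiber_mor plus_ell2.rep_eq V_add)
  then show ?thesis
    using infsum_add[OF row_summable(1) row_summable(1)] by (simp add: row_sum_def)
qed

lemma row_sum_scaleC: "row_sum n q \<mu> (c *\<^sub>C f) = c *\<^sub>C row_sum n q \<mu> f"
proof -
  have "row_sum n q \<mu> (c *\<^sub>C f) = (\<Sum>\<^sub>\<infinity>\<kappa>\<in>fiber n q \<mu>. c *\<^sub>C V (suf \<kappa> q) (coord f \<kappa>))"
    unfolding row_sum_def
    by (rule infsum_cong) (simp add: fiber_def fiber_mor scaleC_ell2.rep_eq V_scaleC)
  also have "\<dots> = c *\<^sub>C row_sum n q \<mu> f"
    unfolding row_sum_def
    by (rule infsumI, rule has_sum_bounded_linear[OF scaleC.bounded_linear_right])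
      (rule has_sum_infsum[OF row_summable(1)])
  finally show ?thesis .
qed

lemma row_sum_delta:
  assumes \<kappa>: "\<kappa> \<in> mor_deg \<Lambda> n"
  shows "row_sum n q \<mu> (delta \<kappa> \<xi>) = (if pre \<kappa> q = \<mu> then V (suf \<kappa> q) \<xi> else 0)"
proof (cases "pre \<kappa> q = \<mu>")
  case True
  have "row_sum n q \<mu> (delta \<kappa> \<xi>) = (\<Sum>\<^sub>\<infinity>\<kappa>'\<in>{\<kappa>}. V (suf \<kappa>' q) \<xi>)"
    unfolding row_sum_def
    by (rule infsum_cong_neutral) (use True \<kappa> in \<open>auto simp: fiber_def fiber_mor coord_delta V_0\<close>)
  then show ?thesis using True by simp
next
  case False
  then show ?thesis
    unfolding row_sum_def by (auto intro!: infsum_0 simp: fiber_def fiber_mor coord_delta V_0)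
qed

text \<open>On each fiber \<open>bessel\<close> bounds the adjoint by the row sum,
  \<open>row_summable\<close> bounds the row sum by the mass of \<open>f\<close> there, and fibers
  are disjoint. It is stated for finite \<open>F\<close> because it also has to prove that the
  values of \<open>block_op\<close> are square-summable.\<close>

lemma block_bound:
  assumes F: "finite F"
  shows "(\<Sum>\<kappa>\<in>F. (norm (if \<kappa> \<in> mor_deg \<Lambda> n then Vs (suf \<kappa> q) (row_sum n q (pre \<kappa> q) f) else 0))\<^sup>2)
    \<le> (norm f)\<^sup>2"
proof -
  let ?t = "\<lambda>\<kappa>. Vs (suf \<kappa> q) (row_sum n q (pre \<kappa> q) f)"
  define G where "G = F \<inter> mor_deg \<Lambda> n"
  have G: "finite G" "G \<subseteq> mor_deg \<Lambda> n" using F by (auto simp: G_def)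
  have "(\<Sum>\<kappa>\<in>F. (norm (if \<kappa> \<in> mor_deg \<Lambda> n then ?t \<kappa> else 0))\<^sup>2)
      = (\<Sum>\<kappa>\<in>G. (norm (?t \<kappa>))\<^sup>2)"
    unfolding G_def by (rule sum.mono_neutral_cong_right) (use F in auto)
  also have "\<dots> = (\<Sum>\<mu>\<in>(\<lambda>\<kappa>. pre \<kappa> q) ` G.
      \<Sum>\<kappa>\<in>{\<kappa>\<in>G. pre \<kappa> q = \<mu>}. (norm (?t \<kappa>))\<^sup>2)"
    by (rule sum.image_gen[OF G(1)])
  also have "\<dots> \<le> (\<Sum>\<mu>\<in>(\<lambda>\<kappa>. pre \<kappa> q) ` G. (\<Sum>\<^sub>\<infinity>\<kappa>\<in>fiber n q \<mu>. (norm (coord f \<kappa>))\<^sup>2))"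
  proof (rule sum_mono)
    fix \<mu>
    have sub: "{\<kappa>\<in>G. pre \<kappa> q = \<mu>} \<subseteq> fiber n q \<mu>" using G by (auto simp: fiber_def)
    have "(\<Sum>\<kappa>\<in>{\<kappa>\<in>G. pre \<kappa> q = \<mu>}. (norm (?t \<kappa>))\<^sup>2)
        = (\<Sum>\<kappa>\<in>{\<kappa>\<in>G. pre \<kappa> q = \<mu>}. (norm (Vs (suf \<kappa> q) (row_sum n q \<mu> f)))\<^sup>2)"
      by (rule sum.cong) auto
    also have "\<dots> \<le> (norm (row_sum n q \<mu> f))\<^sup>2"
      by (rule bessel_inj[OF _ inj_on_subset[OF inj_on_suf sub], of "n - q"])
        (use G fiber_mor in auto)
    also note row_summable(2)
    finally show "(\<Sum>\<kappa>\<in>{\<kappa>\<in>G. pre \<kappa> q = \<mu>}. (norm (?t \<kappa>))\<^sup>2)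
        \<le> (\<Sum>\<^sub>\<infinity>\<kappa>\<in>fiber n q \<mu>. (norm (coord f \<kappa>))\<^sup>2)" .
  qed
  also have "\<dots> \<le> (\<Sum>\<^sub>\<infinity>\<kappa>. (norm (coord f \<kappa>))\<^sup>2)"
    by (rule sum_infsum_disjoint_le[OF _ _ coord_summable])
      (use G in \<open>auto simp: disjoint_family_on_def fiber_def\<close>)
  also have "\<dots> = (norm f)\<^sup>2" by (rule norm_ell2_sq[symmetric])
  finally show ?thesis .
qed

lemma coord_block_op:
  "coord (block_op n q f) \<kappa>
    = (if \<kappa> \<in> mor_deg \<Lambda> n then Vs (suf \<kappa> q) (row_sum n q (pre \<kappa> q) f) else 0)"
proof -
  have "(\<lambda>\<kappa>. (norm (if \<kappa> \<in> mor_deg \<Lambda> n then Vs (suf \<kappa> q) (row_sum n q (pre \<kappa> q) f) else 0))\<^sup>2)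
      summable_on UNIV"
    by (intro nonneg_bdd_above_summable_on bdd_aboveI2[where M = "(norm f)\<^sup>2"])
      (use block_bound in auto)
  then show ?thesis
    unfolding block_op_def by (subst Abs_ell2_inverse) auto
qed

lemma norm_block_op: "norm (block_op n q f) \<le> norm f"
proof -
  have "(norm (block_op n q f))\<^sup>2 \<le> (norm f)\<^sup>2"
    unfolding norm_ell2_sq[of "block_op n q f"]
    by (rule infsum_le_finite_sums[OF coord_summable]) (simp add: coord_block_op block_bound)
  then show ?thesis by (rule power2_le_imp_le) simp
qed

lemma clinear_block_op: "clinear_on S (block_op n q)"
proof -
  have "block_op n q (f + g) = block_op n q f + block_op n q g" for f g
    by (rule coord_inject_eq)
      (simp add: plus_ell2.rep_eq coord_block_op row_sum_add fiber_mor
        clinear_onD(1)[OF Vs_linear])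
  moreover have "block_op n q (c *\<^sub>C f) = c *\<^sub>C block_op n q f" for c f
    by (rule coord_inject_eq)
      (simp add: scaleC_ell2.rep_eq coord_block_op row_sum_scaleC fiber_mor scaleC.zero_right
        clinear_onD(2)[OF Vs_linear])
  ultimately show ?thesis by (simp add: clinear_on_def)
qed

end

section \<open>The space of the positivity condition and the identification of
  \<open>P_op\<close>\<close>

lemma E_space_coord:
  assumes "f \<in> E_space \<Lambda> V v"
  shows "\<kappa> \<in> mor_deg \<Lambda> (e_vec v) \<Longrightarrow> coord f \<kappa> \<in> range (V (src \<Lambda> \<kappa>))"
    "\<kappa> \<notin> mor_deg \<Lambda> (e_vec v) \<Longrightarrow> coord f \<kappa> = 0"
  using assms by (auto simp: E_space_def split: if_splits)

lemma src_deg_obj: "\<kappa> \<in> mor_deg \<Lambda> n \<Longrightarrow> src \<Lambda> \<kappa> \<in> obj \<Lambda>"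
  by (simp add: mor_deg_def src_obj)

lemma E_space_iff:
  "f \<in> E_space \<Lambda> V v \<longleftrightarrow> (\<forall>\<kappa>. if \<kappa> \<in> mor_deg \<Lambda> (e_vec v)
    then V (src \<Lambda> \<kappa>) (coord f \<kappa>) = coord f \<kappa> else coord f \<kappa> = 0)"
  by (auto simp: E_space_def range_V_iff src_deg_obj cong: if_cong)

lemma delta_E_space:
  "\<kappa> \<in> mor_deg \<Lambda> (e_vec v) \<Longrightarrow> \<xi> \<in> range (V (src \<Lambda> \<kappa>)) \<Longrightarrow> delta \<kappa> \<xi> \<in> E_space \<Lambda> V v"
  using obj_mor src_deg_obj
  by (auto simp: E_space_iff coord_delta range_V_iff V_obj_idem intro!: V_0)

text \<open>Tested against all \<open>y\<close>, the condition on a coordinate becomes an equality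
  of two inner products with \<open>f\<close>, because vertex projections are self-adjoint. So the
  space is an intersection of closed subspaces.\<close>

lemma closed_csubspace_E_space: "closed_csubspace (E_space \<Lambda> V v)"
proof -
  let ?b = "\<lambda>\<kappa> y. if \<kappa> \<in> mor_deg \<Lambda> (e_vec v) then delta \<kappa> (V (src \<Lambda> \<kappa>) y) else 0"
  have ext: "x = z \<longleftrightarrow> (\<forall>y. cinner x y = cinner z y)" for x z :: 'h
    using cinner_ext by metis
  have "(if \<kappa> \<in> mor_deg \<Lambda> (e_vec v) then V (src \<Lambda> \<kappa>) (coord f \<kappa>) = coord f \<kappa> else coord f \<kappa> = 0)
      \<longleftrightarrow> (\<forall>y. cinner f (delta \<kappa> y) = cinner f (?b \<kappa> y))" for f \<kappa>
  proof (cases "\<kappa> \<in> mor_deg \<Lambda> (e_vec v)")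
    case True
    then show ?thesis
      unfolding ext[of "V _ _"] using cinner_V_obj[OF src_deg_obj[OF True]]
      by (auto simp: cinner_delta_right)
  next
    case False
    then show ?thesis
      unfolding ext[of "coord f \<kappa>" 0] by (simp add: cinner_delta_right cinner.zero_left cinner.zero_right)
  qed
  then have "E_space \<Lambda> V v = (\<Inter>(\<kappa>, y). {f. cinner f (delta \<kappa> y) = cinner f (?b \<kappa> y)})"
    unfolding set_eq_iff E_space_iff by auto
  moreover have "closed_csubspace \<dots>"
    by (rule closed_csubspace_INT) (auto intro: closed_csubspace_cinner_eq)
  ultimately show ?thesis by simp
qed

text \<open>Every element is the sum of the elementary tensors of its coordinates. This gives the
  uniqueness needed for \<open>P_op\<close>, which is prescribed on these tensors only.\<close>

lemma E_space_eq_cspan: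
  "E_space \<Lambda> V v = closed_cspan {delta \<kappa> \<xi> | \<kappa> \<xi>. \<kappa> \<in> mor_deg \<Lambda> (e_vec v) \<and> \<xi> \<in> range (V (src \<Lambda> \<kappa>))}"
    (is "_ = closed_cspan ?X")
proof
  show "closed_cspan ?X \<subseteq> E_space \<Lambda> V v"
    by (rule closed_cspan_minimal[OF _ closed_csubspace_E_space]) (use delta_E_space in blast)
  show "E_space \<Lambda> V v \<subseteq> closed_cspan ?X"
  proof
    fix f assume f: "f \<in> E_space \<Lambda> V v"
    show "f \<in> closed_cspan ?X"
    proof (rule closed_csubspace_has_sum[OF closed_csubspace_cspan])
      show "((\<lambda>\<kappa>. delta \<kappa> (coord f \<kappa>)) has_sum f) (mor_deg \<Lambda> (e_vec v))"
        by (rule has_sum_delta) (rule E_space_coord[OF f])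
      show "delta \<kappa> (coord f \<kappa>) \<in> closed_cspan ?X" if "\<kappa> \<in> mor_deg \<Lambda> (e_vec v)" for \<kappa>
        by (rule closed_cspan_base) (use E_space_coord(1)[OF f that] that in blast)
    qed
  qed
qed

lemma block_op_delta:
  assumes c: "composable \<mu> \<nu>"
  shows "block_op (deg \<Lambda> \<mu> + deg \<Lambda> \<nu>) (deg \<Lambda> \<mu>) (delta (cmp \<Lambda> \<mu> \<nu>) \<xi>) =
    (\<Sum>\<^sub>\<infinity>l\<in>{l \<in> mor_deg \<Lambda> (deg \<Lambda> \<nu>). rng \<Lambda> l = src \<Lambda> \<mu>}. delta (cmp \<Lambda> \<mu> l) (Vs l (V \<nu> \<xi>)))"
    (is "?f = infsum _ ?N")
proof -
  let ?n = "deg \<Lambda> \<mu> + deg \<Lambda> \<nu>" and ?q = "deg \<Lambda> \<mu>"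
  have qn: "?q \<le> ?n" by (rule vec_le_add)
  have cN: "composable \<mu> l" if "l \<in> ?N" for l
    using that composableD(1)[OF c] by (auto simp: composable_def mor_deg_def)
  have inj: "inj_on (cmp \<Lambda> \<mu>) ?N"
    using cmp_cancel_left cN by (auto intro!: inj_onI)
  have mem: "cmp \<Lambda> \<mu> \<nu> \<in> mor_deg \<Lambda> ?n" using composableD[OF c] by (simp add: mor_deg_def)
  have img: "\<kappa> \<in> cmp \<Lambda> \<mu> ` ?N" if "\<kappa> \<in> mor_deg \<Lambda> ?n" "pre \<kappa> ?q = \<mu>" for \<kappa>
  proof -
    have k: "\<kappa> \<in> mor \<Lambda>" "deg \<Lambda> \<kappa> = ?n" using that by (auto simp: mor_deg_def)
    note p = pre_suf[OF k(1), of ?q, unfolded k(2), OF qn]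
    have "suf \<kappa> ?q \<in> ?N" using p that by (simp add: mor_deg_def)
    moreover have "\<kappa> = cmp \<Lambda> \<mu> (suf \<kappa> ?q)" using p that by simp
    ultimately show ?thesis by blast
  qed
  have coord_f: "coord ?f (cmp \<Lambda> \<mu> l) = Vs l (V \<nu> \<xi>)" if "l \<in> ?N" for l
  proof -
    have "cmp \<Lambda> \<mu> l \<in> mor_deg \<Lambda> ?n"
      using composableD[OF cN[OF that]] that by (simp add: mor_deg_def)
    then show ?thesis
      by (simp add: coord_block_op[OF qn] row_sum_delta[OF qn mem] pre_suf_cmp[OF c]
          pre_suf_cmp[OF cN[OF that]])
  qed
  have "((\<lambda>\<kappa>. delta \<kappa> (coord ?f \<kappa>)) has_sum ?f) (cmp \<Lambda> \<mu> ` ?N)"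
  proof (rule has_sum_delta)
    fix \<kappa> assume k: "\<kappa> \<notin> cmp \<Lambda> \<mu> ` ?N"
    show "coord ?f \<kappa> = 0"
    proof (cases "\<kappa> \<in> mor_deg \<Lambda> ?n")
      case True
      have "pre \<kappa> ?q \<noteq> \<mu>" using img[OF True] k by blast
      then show ?thesis
        using True clinear_on_0[OF csubspace_UNIV Vs_linear[OF fiber_mor(3)[OF qn True]]]
        by (simp add: coord_block_op[OF qn] row_sum_delta[OF qn mem] pre_suf_cmp[OF c])
    qed (simp add: coord_block_op[OF qn])
  qed
  then have "((\<lambda>l. delta (cmp \<Lambda> \<mu> l) (coord ?f (cmp \<Lambda> \<mu> l))) has_sum ?f) ?N"
    by (simp add: has_sum_reindex[OF inj] o_def)
  then have "((\<lambda>l. delta (cmp \<Lambda> \<mu> l) (Vs l (V \<nu> \<xi>))) has_sum ?f) ?N"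
    by (subst (asm) has_sum_cong) (auto simp: coord_f)
  then show ?thesis by (simp add: infsumI)
qed

text \<open>This resolves the definite description. \<open>block_op\<close> is contractive and has
  the prescribed values; conversely every path of degree \<open>e_vec v\<close> factors at
  \<open>e_vec v - e_vec u\<close>, so the prescription reaches every generator of
  \<open>E_space\<close>.\<close>

lemma P_op_eq:
  assumes uv: "u \<subseteq> v"
  shows "P_op \<Lambda> V u v =
    (\<lambda>f. if f \<in> E_space \<Lambda> V v then block_op (e_vec v) (e_vec v - e_vec u) f else 0)" (is "_ = ?T")
proof -
  let ?n = "e_vec v :: nat ^ 'r" and ?q = "e_vec v - e_vec u :: nat ^ 'r" and ?E = "E_space \<Lambda> V v"
  have qn: "?q \<le> ?n" by (rule vec_diff_le)
  have qu: "?q + e_vec u = ?n"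
    using vec_diff_add[OF e_vec_mono[OF uv]] by (simp add: add.commute)
  have un: "?n - ?q = e_vec u" using qu by (metis add_diff_cancel_left')
  let ?R = "\<lambda>\<mu> \<nu> \<xi>. \<Sum>\<^sub>\<infinity>l\<in>{l \<in> mor_deg \<Lambda> (e_vec u). rng \<Lambda> l = src \<Lambda> \<mu>}.
    delta (cmp \<Lambda> \<mu> l) (Vs l (V \<nu> \<xi>))"
  let ?Q = "\<lambda>T. bounded_op ?E T \<and> (\<forall>f. f \<notin> ?E \<longrightarrow> T f = 0) \<and>
     (\<forall>\<mu>\<in>mor_deg \<Lambda> ?q. \<forall>\<nu>\<in>mor_deg \<Lambda> (e_vec u). rng \<Lambda> \<nu> = src \<Lambda> \<mu> \<longrightarrow>
       (\<forall>\<xi>\<in>range (V (src \<Lambda> \<nu>)).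
          T (delta (cmp \<Lambda> \<mu> \<nu>) \<xi>) =
            ?R \<mu> \<nu> \<xi>))"
  have comp: "composable \<mu> \<nu>" "cmp \<Lambda> \<mu> \<nu> \<in> mor_deg \<Lambda> ?n" "src \<Lambda> (cmp \<Lambda> \<mu> \<nu>) = src \<Lambda> \<nu>"
    if "\<mu> \<in> mor_deg \<Lambda> ?q" "\<nu> \<in> mor_deg \<Lambda> (e_vec u)" "rng \<Lambda> \<nu> = src \<Lambda> \<mu>" for \<mu> \<nu>
  proof -
    show c: "composable \<mu> \<nu>" using that by (simp add: composable_def mor_deg_def)
    show "cmp \<Lambda> \<mu> \<nu> \<in> mor_deg \<Lambda> ?n" "src \<Lambda> (cmp \<Lambda> \<mu> \<nu>) = src \<Lambda> \<nu>"
      using composableD[OF c] that qu by (auto simp: mor_deg_def)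
  qed
  have QT: "?Q ?T"
  proof (intro conjI ballI allI impI)
    show "bounded_op ?E ?T"
    proof (rule bounded_opI[of _ _ 1])
      have "block_op ?n ?q f \<in> ?E" for f
        unfolding E_space_def using Vs_range[OF fiber_mor(3)[OF qn]] fiber_mor(5)[OF qn]
        by (simp add: coord_block_op[OF qn])
      then show "?T f \<in> ?E" if "f \<in> ?E" for f
        using that by simp
      show "clinear_on ?E ?T"
        using clinear_block_op[OF qn, of ?E] closed_csubspace_E_space[of v]
        by (auto simp: clinear_on_def closed_csubspace_def csubspace_def)
      show "norm (?T f) \<le> 1 * norm f" if "f \<in> ?E" for f
        using norm_block_op[OF qn, of f] that by simp
    qed
    fix \<mu> \<nu> \<xi>
    assume a: "\<mu> \<in> mor_deg \<Lambda> ?q" "\<nu> \<in> mor_deg \<Lambda> (e_vec u)" "rng \<Lambda> \<nu> = src \<Lambda> \<mu>"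
      "\<xi> \<in> range (V (src \<Lambda> \<nu>))"
    have "delta (cmp \<Lambda> \<mu> \<nu>) \<xi> \<in> ?E"
      using delta_E_space comp[OF a(1-3)] a(4) by simp
    then show "?T (delta (cmp \<Lambda> \<mu> \<nu>) \<xi>) =
        ?R \<mu> \<nu> \<xi>"
      using block_op_delta[OF comp(1)[OF a(1-3)], of \<xi>] a qu by (simp add: mor_deg_def)
  qed simp
  show ?thesis
    unfolding P_op_def
  proof (rule the_equality[where P = ?Q, OF QT], rule ext)
    fix T f assume T: "?Q T"
    show "T f = ?T f"
    proof (cases "f \<in> ?E")
      case True
      show ?thesis
      proof (rule bounded_op_eq_on_cspan[OF E_space_eq_cspan _ _ _ True])
        fix d assume "d \<in> {delta \<kappa> \<xi> | \<kappa> \<xi>. \<kappa> \<in> mor_deg \<Lambda> ?n \<and> \<xi> \<in> range (V (src \<Lambda> \<kappa>))}"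
        then obtain \<kappa> \<xi> where d: "d = delta \<kappa> \<xi>" "\<kappa> \<in> mor_deg \<Lambda> ?n" "\<xi> \<in> range (V (src \<Lambda> \<kappa>))"
          by blast
        note p = pre_suf[OF fiber_mor(1,2)[OF qn d(2)]]
        have a: "pre \<kappa> ?q \<in> mor_deg \<Lambda> ?q" "suf \<kappa> ?q \<in> mor_deg \<Lambda> (e_vec u)"
          "rng \<Lambda> (suf \<kappa> ?q) = src \<Lambda> (pre \<kappa> ?q)" "\<xi> \<in> range (V (src \<Lambda> (suf \<kappa> ?q)))"
          using p d un by (auto simp: mor_deg_def)
        have "T' d = ?R (pre \<kappa> ?q) (suf \<kappa> ?q) \<xi>" if T': "?Q T'" for T'
        proof -
          have "T' (delta (cmp \<Lambda> (pre \<kappa> ?q) (suf \<kappa> ?q)) \<xi>) =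
            ?R (pre \<kappa> ?q) (suf \<kappa> ?q) \<xi>"
            by (rule T'[THEN conjunct2, THEN conjunct2, rule_format, OF a])
          then show ?thesis by (simp only: d(1) p(7))
        qed
        from this[OF T] this[OF QT] show "T d = ?T d" by simp
      qed (use T QT in blast)+
    qed (use T in auto)
  qed
qed

text \<open>Moving the adjoint to the other side shows a Gram form in which only paths with equal
  prefix interact; \<open>sum_gram_grouped\<close> then turns the quadratic form of
  \<open>P_op\<close> into a sum of squared norms.\<close>

lemma cinner_P_op_delta:
  assumes uv: "u \<subseteq> v" and \<kappa>: "\<kappa> \<in> mor_deg \<Lambda> (e_vec v)" "\<xi> \<in> range (V (src \<Lambda> \<kappa>))"
    and \<kappa>': "\<kappa>' \<in> mor_deg \<Lambda> (e_vec v)"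
  shows "cinner (P_op \<Lambda> V u v (delta \<kappa> \<xi>)) (delta \<kappa>' \<xi>') =
    (if pre \<kappa> (e_vec v - e_vec u) = pre \<kappa>' (e_vec v - e_vec u)
     then cinner (V (suf \<kappa> (e_vec v - e_vec u)) \<xi>) (V (suf \<kappa>' (e_vec v - e_vec u)) \<xi>') else 0)"
proof -
  have qn: "e_vec v - e_vec u \<le> (e_vec v :: nat ^ 'r)" by (rule vec_diff_le)
  note m = fiber_mor(3)[OF qn \<kappa>']
  show ?thesis
    using \<kappa> \<kappa>' clinear_on_0[OF csubspace_UNIV Vs_linear[OF m]]
    by (simp add: P_op_eq[OF uv] delta_E_space cinner_delta_right coord_block_op[OF qn]
        row_sum_delta[OF qn] cinner_Vs_left m cinner.zero_left)
qed

lemma clinear_on_P_op: "u \<subseteq> v \<Longrightarrow> clinear_on (E_space \<Lambda> V v) (P_op \<Lambda> V u v)"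
  using clinear_block_op[OF vec_diff_le, of "E_space \<Lambda> V v" "e_vec v" "e_vec u"]
    closed_csubspace_E_space[of v]
  by (auto simp: P_op_eq clinear_on_def closed_csubspace_def csubspace_def)

end

section \<open>Positivity of the dilation kernel\<close>

lemma finite_vec_atMost: "finite {p :: nat ^ 'r::finite. p \<le> n}"
proof (rule finite_surj)
  show "finite (PiE UNIV (\<lambda>i. {..n $ i}))" by (rule finite_PiE) auto
  show "{p. p \<le> n} \<subseteq> vec_lambda ` PiE UNIV (\<lambda>i. {..n $ i})"
  proof
    fix p :: "nat ^ 'r" assume "p \<in> {p. p \<le> n}"
    then have "vec_nth p \<in> PiE UNIV (\<lambda>i. {..n $ i})" by (auto simp: less_eq_vec_def)
    from imageI[OF this, of vec_lambda] show "p \<in> vec_lambda ` PiE UNIV (\<lambda>i. {..n $ i})"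
      by simp
  qed
qed

text \<open>The sets \<open>u\<close> with \<open>e_vec u \<le> p\<close> are the subsets of the
  support of \<open>p\<close>, and their alternating sum is the expansion of a product of factors
  \<open>1 - 1\<close> over that support.\<close>

lemma alternating_sum_e_vec:
  fixes p :: "nat ^ 'r::finite"
  shows "(\<Sum>u\<in>UNIV. if e_vec u \<le> p then (- 1) ^ card u else 0 :: real) = (if p = 0 then 1 else 0)"
proof -
  define S where "S = {j. p $ j \<noteq> 0}"
  have S: "e_vec u \<le> p \<longleftrightarrow> u \<in> Pow S" for u
    by (auto simp: S_def less_eq_vec_def e_vec_nth Suc_le_eq)
  have "(\<Sum>u\<in>UNIV. if e_vec u \<le> p then (- 1) ^ card u else 0 :: real) = (\<Sum>u\<in>Pow S. (- 1) ^ card u)"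
    by (simp add: S sum.If_cases Pow_def)
  also have "\<dots> = (\<Prod>j\<in>S. 1 - 1 :: real)"
    by (subst prod_diff_conv_sum) auto
  also have "\<dots> = (if p = 0 then 1 else 0)"
    by (cases "p = 0") (auto simp: S_def vec_eq_iff power_0_left card_eq_0_iff)
  finally show ?thesis .
qed

lemma sum_gram_grouped:
  fixes y :: "'i \<Rightarrow> 'a::complex_inner"
  assumes "finite B"
  shows "(\<Sum>i\<in>B. \<Sum>j\<in>B. if g i = g j then cinner (y i) (y j) else 0)
    = complex_of_real (\<Sum>m\<in>g ` B. (norm (\<Sum>i\<in>{i\<in>B. g i = m}. y i))\<^sup>2)"
proof -
  have "(\<Sum>i\<in>B. \<Sum>j\<in>B. if g i = g j then cinner (y i) (y j) else 0)
      = (\<Sum>i\<in>B. \<Sum>j\<in>{j\<in>B. g j = g i}. cinner (y i) (y j))"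
    using assms by (simp add: sum.inter_filter eq_commute[of "g _" "g _"] cong: if_cong)
  also have "\<dots> = (\<Sum>m\<in>g ` B. \<Sum>i\<in>{i\<in>B. g i = m}. \<Sum>j\<in>{j\<in>B. g j = g i}. cinner (y i) (y j))"
    by (rule sum.image_gen[OF assms])
  also have "\<dots> = (\<Sum>m\<in>g ` B. complex_of_real ((norm (\<Sum>i\<in>{i\<in>B. g i = m}. y i))\<^sup>2))"
    unfolding cinner_self[symmetric] cinner.sum_left unfolding cinner.sum_right
    by (intro sum.cong refl) auto
  finally show ?thesis by simp
qed

context graph_contraction
begin

text \<open>All paths of \<open>M\<close> start with \<rho>, so stripping it leaves paths of degree
  \<open>e_vec v\<close>, and the condition is evaluated at the sum \<open>f\<close> of the tensors
  of these suffixes with the vectors \<open>g \<mu>\<close>.\<close>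

lemma condition_on_tuple:
  assumes cond: "op_nonneg (E_space \<Lambda> V v) (\<lambda>f. \<Sum>u\<in>Pow v. (-1) ^ card u *\<^sub>R P_op \<Lambda> V u v f)"
    and vn: "e_vec v \<le> n"
    and M: "finite M" "\<And>\<mu>. \<mu> \<in> M \<Longrightarrow> \<mu> \<in> mor_deg \<Lambda> n" "\<And>\<mu>. \<mu> \<in> M \<Longrightarrow> pre \<mu> (n - e_vec v) = \<rho>"
    and g: "\<And>\<mu>. \<mu> \<in> M \<Longrightarrow> g \<mu> \<in> range (V (src \<Lambda> \<mu>))"
  shows "0 \<le> (\<Sum>u\<in>Pow v. (-1) ^ card u * (\<Sum>\<sigma>\<in>(\<lambda>\<mu>. pre \<mu> (n - e_vec u)) ` M.
    (norm (\<Sum>\<mu>\<in>{\<mu>\<in>M. pre \<mu> (n - e_vec u) = \<sigma>}. V (suf \<mu> (n - e_vec u)) (g \<mu>)))\<^sup>2))"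
proof -
  let ?Q = "\<lambda>u. \<Sum>\<sigma>\<in>(\<lambda>\<mu>. pre \<mu> (n - e_vec u)) ` M.
    (norm (\<Sum>\<mu>\<in>{\<mu>\<in>M. pre \<mu> (n - e_vec u) = \<sigma>}. V (suf \<mu> (n - e_vec u)) (g \<mu>)))\<^sup>2"
  define r where "r = n - e_vec v"
  have rn: "r \<le> n" by (simp add: r_def vec_diff_le)
  have nr: "n - r = e_vec v" "r + e_vec v = n"
    using vn by (auto simp: r_def vec_eq_iff less_eq_vec_def)
  have Mm: "\<mu> \<in> mor \<Lambda>" "deg \<Lambda> \<mu> = n" "r \<le> deg \<Lambda> \<mu>" if "\<mu> \<in> M" for \<mu>
    using M(2)[OF that] rn by (auto simp: mor_deg_def)
  note ps = pre_suf[OF Mm(1) Mm(3)]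
  have sE: "suf \<mu> r \<in> mor_deg \<Lambda> (e_vec v)" if "\<mu> \<in> M" for \<mu>
    using ps(3,5)[OF that that] Mm(2)[OF that] nr by (simp add: mor_deg_def)
  have sR: "g \<mu> \<in> range (V (src \<Lambda> (suf \<mu> r)))" if "\<mu> \<in> M" for \<mu>
    using ps(9)[OF that that] g[OF that] by simp
  define f where "f = (\<Sum>\<mu>\<in>M. delta (suf \<mu> r) (g \<mu>))"
  have dE: "delta (suf \<mu> r) (g \<mu>) \<in> E_space \<Lambda> V v" if "\<mu> \<in> M" for \<mu>
    by (rule delta_E_space[OF sE sR]) (use that in auto)
  have subE: "csubspace (E_space \<Lambda> V v)"
    using closed_csubspace_E_space by (simp add: closed_csubspace_def)
  have fE: "f \<in> E_space \<Lambda> V v"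
    unfolding f_def by (rule csubspace_sum[OF subE dE])
  have quad: "cinner (P_op \<Lambda> V u v f) f
      = complex_of_real (?Q u)"
    if u: "u \<subseteq> v" for u
  proof -
    define q where "q = e_vec v - e_vec u"
    have qv: "q \<le> e_vec v" by (simp add: q_def vec_diff_le)
    have rq: "r + q = n - e_vec u"
      using vn e_vec_mono[OF u] by (auto simp: r_def q_def vec_eq_iff less_eq_vec_def)
    have comp: "pre \<mu> (r + q) = cmp \<Lambda> \<rho> (pre (suf \<mu> r) q)" "suf \<mu> (r + q) = suf (suf \<mu> r) q"
      "composable \<rho> (pre (suf \<mu> r) q)" if m: "\<mu> \<in> M" for \<mu>
    proof -
      have \<rho>: "pre \<mu> r = \<rho>" using M(3)[OF m] by (simp add: r_def)
      have c: "composable \<rho> (suf \<mu> r)" "deg \<Lambda> \<rho> = r" "cmp \<Lambda> \<rho> (suf \<mu> r) = \<mu>"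
        using ps(1,4,7)[OF m m] \<rho> by auto
      have "q \<le> deg \<Lambda> (suf \<mu> r)" using sE[OF m] qv by (simp add: mor_deg_def)
      from pre_suf_cmp_ge[OF c(1) this] show
        "pre \<mu> (r + q) = cmp \<Lambda> \<rho> (pre (suf \<mu> r) q)" "suf \<mu> (r + q) = suf (suf \<mu> r) q"
        "composable \<rho> (pre (suf \<mu> r) q)"
        by (simp_all only: c(2,3))
    qed
    \<comment> \<open>Composition with \<rho> on the left is injective, so grouping the suffixes by
      their prefixes is the same as grouping the paths by theirs.\<close>
    have eq: "pre (suf \<mu> r) q = pre (suf \<mu>' r) q \<longleftrightarrow> pre \<mu> (r + q) = pre \<mu>' (r + q)"
      if "\<mu> \<in> M" "\<mu>' \<in> M" for \<mu> \<mu>'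
      using comp(1)[OF that(1)] comp(1)[OF that(2)]
        cmp_cancel_left[OF comp(3)[OF that(1)] comp(3)[OF that(2)]] by auto
    have "P_op \<Lambda> V u v f = (\<Sum>\<mu>\<in>M. P_op \<Lambda> V u v (delta (suf \<mu> r) (g \<mu>)))"
      unfolding f_def by (rule clinear_on_sum[OF subE clinear_on_P_op[OF u] dE])
    then have "cinner (P_op \<Lambda> V u v f) f = (\<Sum>\<mu>\<in>M. \<Sum>\<mu>'\<in>M.
        cinner (P_op \<Lambda> V u v (delta (suf \<mu> r) (g \<mu>))) (delta (suf \<mu>' r) (g \<mu>')))"
      by (simp only: cinner.sum_left) (simp only: f_def cinner.sum_right)
    also have "\<dots> = (\<Sum>\<mu>\<in>M. \<Sum>\<mu>'\<in>M. if pre \<mu> (r + q) = pre \<mu>' (r + q)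
        then cinner (V (suf \<mu> (r + q)) (g \<mu>)) (V (suf \<mu>' (r + q)) (g \<mu>')) else 0)"
    proof (intro sum.cong refl)
      fix \<mu> \<mu>' assume m: "\<mu> \<in> M" "\<mu>' \<in> M"
      show "cinner (P_op \<Lambda> V u v (delta (suf \<mu> r) (g \<mu>))) (delta (suf \<mu>' r) (g \<mu>'))
        = (if pre \<mu> (r + q) = pre \<mu>' (r + q)
          then cinner (V (suf \<mu> (r + q)) (g \<mu>)) (V (suf \<mu>' (r + q)) (g \<mu>')) else 0)"
        unfolding cinner_P_op_delta[OF u sE[OF m(1)] sR[OF m(1)] sE[OF m(2)]] q_def[symmetric]
          eq[OF m] comp(2)[OF m(1)] comp(2)[OF m(2)] ..
    qed
    finally show ?thesis unfolding sum_gram_grouped[OF M(1)] rq .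
  qed
  have "cinner (\<Sum>u\<in>Pow v. (-1) ^ card u *\<^sub>R P_op \<Lambda> V u v f) f
      = complex_of_real (\<Sum>u\<in>Pow v. (-1) ^ card u * ?Q u)"
    unfolding cinner.sum_left of_real_sum
    by (intro sum.cong refl)
      (simp only: cinner.scaleR_left quad Pow_iff scaleR_conv_of_real of_real_mult)
  moreover have "cinner (\<Sum>u\<in>Pow v. (-1) ^ card u *\<^sub>R P_op \<Lambda> V u v f) f \<in> \<real>\<^sub>\<ge>\<^sub>0"
    using cond fE unfolding op_nonneg_def by blast
  ultimately show ?thesis by (simp only: nonneg_Reals_of_real_iff)
qed

definition kS :: "'l \<Rightarrow> 'h \<Rightarrow> 'l \<Rightarrow> 'h \<Rightarrow> complex" where
  "kS l x m y = (let p = vmin (deg \<Lambda> l) (deg \<Lambda> m) in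
    if pre l p = pre m p then cinner (V (suf l p) x) (V (suf m p) y) else 0)"

context
  fixes A :: "'i set" and \<kappa> :: "'i \<Rightarrow> 'l" and h :: "'i \<Rightarrow> 'h"
  assumes A: "finite A" and \<kappa>: "\<And>i. i \<in> A \<Longrightarrow> \<kappa> i \<in> mor \<Lambda>"
begin

text \<open>Here the family \<open>h\<close> is indexed by a finite set of paths \<open>\<kappa> i\<close>, so \<open>tail_sum 0 \<mu>\<close> is the vector
  \<open>g \<mu>\<close> of the introduction and \<open>tail_sum (e_vec u) \<mu>\<close> is \<open>(\<Sum>\<alpha>. V \<alpha> (g (\<mu>\<alpha>)))\<close>.\<close>

definition tail_sum :: "nat ^ 'r \<Rightarrow> 'l \<Rightarrow> 'h" where
  "tail_sum s \<mu> = (\<Sum>i\<in>{i\<in>A. deg \<Lambda> \<mu> + s \<le> deg \<Lambda> (\<kappa> i) \<and> pre (\<kappa> i) (deg \<Lambda> \<mu>) = \<mu>}.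
    V (suf (\<kappa> i) (deg \<Lambda> \<mu>)) (h i))"

text \<open>Outside this finite set every \<open>tail_sum\<close> is an empty sum, so sums over all
  paths reduce to sums over it.\<close>

definition prefixes :: "'l set" where
  "prefixes = (\<Union>i\<in>A. pre (\<kappa> i) ` {p. p \<le> deg \<Lambda> (\<kappa> i)})"

lemma finite_prefixes: "finite prefixes"
  unfolding prefixes_def using A finite_vec_atMost by blast

lemma prefixes_mor: "\<mu> \<in> prefixes \<Longrightarrow> \<mu> \<in> mor \<Lambda>"
  unfolding prefixes_def using \<kappa> pre_suf(2) by auto

lemma pre_in_prefixes: "i \<in> A \<Longrightarrow> p \<le> deg \<Lambda> (\<kappa> i) \<Longrightarrow> pre (\<kappa> i) p \<in> prefixes"
  unfolding prefixes_def by blast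

lemma prefixes_closed:
  assumes "\<mu> \<in> prefixes" "p \<le> deg \<Lambda> \<mu>"
  shows "pre \<mu> p \<in> prefixes"
proof -
  obtain i q where iq: "i \<in> A" "q \<le> deg \<Lambda> (\<kappa> i)" "\<mu> = pre (\<kappa> i) q"
    using assms(1) unfolding prefixes_def by blast
  then have "p \<le> q" using assms(2) pre_suf(4)[OF \<kappa>] by simp
  then show ?thesis
    using pre_pre(1)[OF \<kappa>[OF iq(1)] iq(2)] iq pre_in_prefixes[of i p] by auto
qed

text \<open>This makes \<open>tail_sum 0 \<mu>\<close> an admissible coordinate at \<mu> in
  \<open>condition_on_tuple\<close>.\<close>

lemma tail_sum_0_range: "\<mu> \<in> mor \<Lambda> \<Longrightarrow> tail_sum 0 \<mu> \<in> range (V (src \<Lambda> \<mu>))"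
proof -
  assume m: "\<mu> \<in> mor \<Lambda>"
  have a: "src \<Lambda> \<mu> \<in> mor \<Lambda>" "src \<Lambda> \<mu> \<in> obj \<Lambda>" using src_obj[OF m] obj_mor by auto
  have "V (src \<Lambda> \<mu>) (V (suf (\<kappa> i) (deg \<Lambda> \<mu>)) x) = V (suf (\<kappa> i) (deg \<Lambda> \<mu>)) x"
    if "i \<in> A" "deg \<Lambda> \<mu> \<le> deg \<Lambda> (\<kappa> i)" "pre (\<kappa> i) (deg \<Lambda> \<mu>) = \<mu>" for i x
    using pre_suf(3,6)[OF \<kappa>[OF that(1)] that(2)] that(3) V_rng by metis
  then show ?thesis
    by (simp add: range_V_iff[OF a(2)] tail_sum_def V_sum[OF a(1)])
qed

text \<open>Expanding the squared norms, a pair \<open>i\<close>, \<open>j\<close> contributes once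
  for each common prefix \<mu> and each \<open>u\<close> with
  \<open>deg \<Lambda> \<mu> + e_vec u \<le> m i j\<close>. The alternating sum over
  \<open>u\<close> cancels all but the common prefix of the maximal degree \<open>m i j\<close>,
  where the inner product is the kernel.\<close>

lemma kernel_sum_eq:
  "Re (\<Sum>i\<in>A. \<Sum>j\<in>A. kS (\<kappa> i) (h i) (\<kappa> j) (h j))
    = (\<Sum>\<mu>\<in>prefixes. \<Sum>u\<in>UNIV. (-1) ^ card u * (norm (tail_sum (e_vec u) \<mu>))\<^sup>2)"
proof -
  define ip where "ip i j p = inner (V (suf (\<kappa> i) p) (h i)) (V (suf (\<kappa> j) p) (h j))" for i j p
  define C where "C \<mu> i j \<longleftrightarrow> pre (\<kappa> i) (deg \<Lambda> \<mu>) = \<mu> \<and> pre (\<kappa> j) (deg \<Lambda> \<mu>) = \<mu>" for \<mu> i j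
  define m where "m i j = vmin (deg \<Lambda> (\<kappa> i)) (deg \<Lambda> (\<kappa> j))" for i j
  have norm: "(norm (tail_sum s \<mu>))\<^sup>2
      = (\<Sum>i\<in>A. \<Sum>j\<in>A. if C \<mu> i j \<and> deg \<Lambda> \<mu> + s \<le> m i j then ip i j (deg \<Lambda> \<mu>) else 0)" for s \<mu>
  proof -
    let ?D = "\<lambda>i. deg \<Lambda> \<mu> + s \<le> deg \<Lambda> (\<kappa> i) \<and> pre (\<kappa> i) (deg \<Lambda> \<mu>) = \<mu>"
    let ?y = "\<lambda>i. V (suf (\<kappa> i) (deg \<Lambda> \<mu>)) (h i)"
    have eq: "tail_sum s \<mu> = (\<Sum>i\<in>A. if ?D i then ?y i else 0)"
      unfolding tail_sum_def by (rule sum.inter_filter[OF A])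
    have le: "deg \<Lambda> \<mu> + s \<le> m i j \<longleftrightarrow> deg \<Lambda> \<mu> + s \<le> deg \<Lambda> (\<kappa> i) \<and> deg \<Lambda> \<mu> + s \<le> deg \<Lambda> (\<kappa> j)" for i j
      unfolding m_def using vmin_le vmin_greatest order_trans by blast
    show ?thesis
      unfolding power2_norm_eq_inner eq inner_sum_left inner_sum_right
      by (intro sum.cong refl) (auto simp: le C_def ip_def inner_commute)
  qed
  let ?J = "\<lambda>\<mu> u i j. if C \<mu> i j \<and> deg \<Lambda> \<mu> + e_vec u \<le> m i j then ip i j (deg \<Lambda> \<mu>) else 0"
  \<comment> \<open>Inclusion-exclusion with \<open>p = m i j - deg \<Lambda> \<mu>\<close>. As
    subtraction is truncated, the case where \<mu> is too long is treated separately.\<close>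
  have alt: "(\<Sum>u\<in>UNIV. (-1) ^ card u * ?J \<mu> u i j)
      = (if C \<mu> i j \<and> deg \<Lambda> \<mu> = m i j then ip i j (deg \<Lambda> \<mu>) else 0)" for \<mu> i j
  proof (cases "C \<mu> i j \<and> deg \<Lambda> \<mu> \<le> m i j")
    case True
    have le: "deg \<Lambda> \<mu> + e_vec u \<le> m i j \<longleftrightarrow> e_vec u \<le> m i j - deg \<Lambda> \<mu>" for u
      using True by (auto simp: less_eq_vec_def le_diff_conv2 add.commute)
    have zero: "deg \<Lambda> \<mu> = m i j \<longleftrightarrow> m i j - deg \<Lambda> \<mu> = 0"
      using True by (auto simp: vec_eq_iff less_eq_vec_def le_antisym)
    have "(\<Sum>u\<in>UNIV. (-1) ^ card u * ?J \<mu> u i j)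
      = (\<Sum>u\<in>UNIV. if e_vec u \<le> m i j - deg \<Lambda> \<mu> then (-1) ^ card u else 0) * ip i j (deg \<Lambda> \<mu>)"
      unfolding sum_distrib_right le using True by (intro sum.cong refl) auto
    then show ?thesis
      unfolding alternating_sum_e_vec zero using True by auto
  next
    case False
    have zero: "?J \<mu> u i j = 0" for u
      by (rule if_not_P) (use False vec_le_add(1) order_trans in blast)
    have "\<not> (C \<mu> i j \<and> deg \<Lambda> \<mu> = m i j)" using False by auto
    then show ?thesis unfolding zero by (simp only: if_False mult_zero_right sum.neutral_const)
  qed
  \<comment> \<open>The only candidate for \<mu> is the prefix of \<open>\<kappa> i\<close> of
    degree \<open>m i j\<close>.\<close>
  have one: "(\<Sum>\<mu>\<in>prefixes. if C \<mu> i j \<and> deg \<Lambda> \<mu> = m i j then ip i j (deg \<Lambda> \<mu>) else 0)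
      = Re (kS (\<kappa> i) (h i) (\<kappa> j) (h j))" if ij: "i \<in> A" "j \<in> A" for i j
  proof -
    have le: "m i j \<le> deg \<Lambda> (\<kappa> i)" by (simp add: m_def vmin_le)
    have d: "deg \<Lambda> (pre (\<kappa> i) (m i j)) = m i j" by (rule pre_suf(4)[OF \<kappa>[OF ij(1)] le])
    have "(\<Sum>\<mu>\<in>prefixes. if C \<mu> i j \<and> deg \<Lambda> \<mu> = m i j then ip i j (deg \<Lambda> \<mu>) else 0)
        = (\<Sum>\<mu>\<in>prefixes. if \<mu> = pre (\<kappa> i) (m i j)
            then (if pre (\<kappa> i) (m i j) = pre (\<kappa> j) (m i j) then ip i j (m i j) else 0) else 0)"
      by (intro sum.cong refl) (use d in \<open>auto simp: C_def\<close>)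
    also have "\<dots> = (if pre (\<kappa> i) (m i j) = pre (\<kappa> j) (m i j) then ip i j (m i j) else 0)"
      using finite_prefixes pre_in_prefixes[OF ij(1) le] by simp
    finally show ?thesis
      by (simp add: kS_def m_def ip_def Re_cinner Let_def)
  qed
  have "(\<Sum>\<mu>\<in>prefixes. \<Sum>u\<in>UNIV. (-1) ^ card u * (norm (tail_sum (e_vec u) \<mu>))\<^sup>2)
      = (\<Sum>\<mu>\<in>prefixes. \<Sum>u\<in>UNIV. \<Sum>i\<in>A. \<Sum>j\<in>A. (-1) ^ card u *
          ?J \<mu> u i j)"
    unfolding norm by (simp only: sum_distrib_left)
  also have "\<dots> = (\<Sum>\<mu>\<in>prefixes. \<Sum>i\<in>A. \<Sum>j\<in>A. \<Sum>u\<in>UNIV. (-1) ^ card u *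
          ?J \<mu> u i j)"
    by (intro sum.cong refl, subst sum.swap, intro sum.cong refl) (rule sum.swap)
  also have "\<dots> = (\<Sum>i\<in>A. \<Sum>j\<in>A. \<Sum>\<mu>\<in>prefixes.
        if C \<mu> i j \<and> deg \<Lambda> \<mu> = m i j then ip i j (deg \<Lambda> \<mu>) else 0)"
    unfolding alt by (subst sum.swap, intro sum.cong refl) (rule sum.swap)
  also have "\<dots> = Re (\<Sum>i\<in>A. \<Sum>j\<in>A. kS (\<kappa> i) (h i) (\<kappa> j) (h j))"
    by (simp add: one)
  finally show ?thesis by simp
qed

text \<open>Sorting the terms by \<open>n = deg \<Lambda> \<mu> + e_vec u\<close> and, for fixed \<open>n\<close> with support \<open>v\<close>, by the
  prefix \<open>\<rho>\<close> of \<open>\<mu>\<close> of degree \<open>n - e_vec v\<close> leaves one instance of the positivity condition for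
  each pair \<open>(n, \<rho>)\<close>.\<close>

lemma tail_sum_regroup:
  assumes vn: "e_vec v \<le> n" and u: "u \<subseteq> v"
    and \<sigma>: "\<sigma> \<in> mor \<Lambda>" "deg \<Lambda> \<sigma> = n - e_vec u" "pre \<sigma> (n - e_vec v) = \<rho>"
  shows "tail_sum (e_vec u) \<sigma> =
    (\<Sum>\<mu>\<in>{\<mu>\<in>{\<mu>\<in>prefixes. deg \<Lambda> \<mu> = n \<and> pre \<mu> (n - e_vec v) = \<rho>}. pre \<mu> (n - e_vec u) = \<sigma>}.
      V (suf \<mu> (n - e_vec u)) (tail_sum 0 \<mu>))"
proof -
  let ?q = "n - e_vec u" and ?r = "n - e_vec v"
  let ?I = "{i\<in>A. n \<le> deg \<Lambda> (\<kappa> i) \<and> pre (\<kappa> i) ?q = \<sigma>}"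
  let ?M = "{\<mu>\<in>{\<mu>\<in>prefixes. deg \<Lambda> \<mu> = n \<and> pre \<mu> ?r = \<rho>}. pre \<mu> ?q = \<sigma>}"
  have qu: "?q + e_vec u = n"
    using order_trans[OF e_vec_mono[OF u] vn] by (simp add: add.commute vec_diff_add)
  have rq: "?r \<le> ?q" "?q \<le> n"
    using e_vec_mono[OF u] by (auto simp: less_eq_vec_def diff_le_mono2)
  have I: "pre (pre (\<kappa> i) n) ?q = \<sigma>" "pre (pre (\<kappa> i) n) ?r = \<rho>" "pre (\<kappa> i) n \<in> prefixes"
    "deg \<Lambda> (pre (\<kappa> i) n) = n" if i: "i \<in> ?I" for i
  proof -
    have i': "\<kappa> i \<in> mor \<Lambda>" "n \<le> deg \<Lambda> (\<kappa> i)" "pre (\<kappa> i) ?q = \<sigma>" using i \<kappa> by auto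
    show "pre (pre (\<kappa> i) n) ?q = \<sigma>" using pre_pre(1)[OF i'(1,2) rq(2)] i'(3) by simp
    have "pre (pre (\<kappa> i) n) ?r = pre (\<kappa> i) ?r"
      by (rule pre_pre(1)[OF i'(1,2) order_trans[OF rq]])
    also have "\<dots> = \<rho>"
      using pre_pre(1)[OF i'(1) order_trans[OF rq(2) i'(2)] rq(1)] i'(3) \<sigma>(3) by simp
    finally show "pre (pre (\<kappa> i) n) ?r = \<rho>" .
    show "pre (\<kappa> i) n \<in> prefixes" using i by (auto intro!: pre_in_prefixes)
    show "deg \<Lambda> (pre (\<kappa> i) n) = n" by (rule pre_suf(4)[OF i'(1,2)])
  qed
  have "(\<Sum>\<mu>\<in>?M. V (suf \<mu> ?q) (tail_sum 0 \<mu>))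
      = (\<Sum>\<mu>\<in>?M. \<Sum>i\<in>{i\<in>?I. pre (\<kappa> i) n = \<mu>}. V (suf (\<kappa> i) ?q) (h i))"
  proof (rule sum.cong[OF refl])
    fix \<mu> assume m: "\<mu> \<in> ?M"
    then have \<mu>: "\<mu> \<in> mor \<Lambda>" "deg \<Lambda> \<mu> = n" "pre \<mu> ?q = \<sigma>" using prefixes_mor by auto
    have s: "suf \<mu> ?q \<in> mor \<Lambda>" using pre_suf(3)[OF \<mu>(1)] \<mu>(2) rq(2) by simp
    have "V (suf \<mu> ?q) (tail_sum 0 \<mu>)
        = (\<Sum>i\<in>{i\<in>A. n \<le> deg \<Lambda> (\<kappa> i) \<and> pre (\<kappa> i) n = \<mu>}. V (suf \<mu> ?q) (V (suf (\<kappa> i) n) (h i)))"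
      unfolding tail_sum_def V_sum[OF s] by (simp add: \<mu>(2))
    also have "\<dots> = (\<Sum>i\<in>{i\<in>?I. pre (\<kappa> i) n = \<mu>}. V (suf (\<kappa> i) ?q) (h i))"
    proof (rule sum.cong)
      have "pre (\<kappa> i) ?q = \<sigma>" if "i \<in> A" "n \<le> deg \<Lambda> (\<kappa> i)" "pre (\<kappa> i) n = \<mu>" for i
        using pre_pre(1)[OF \<kappa>[OF that(1)] that(2) rq(2)] that(3) \<mu>(3) by simp
      then show "{i\<in>A. n \<le> deg \<Lambda> (\<kappa> i) \<and> pre (\<kappa> i) n = \<mu>} = {i\<in>?I. pre (\<kappa> i) n = \<mu>}"
        by auto
      fix i assume "i \<in> {i\<in>?I. pre (\<kappa> i) n = \<mu>}"
      then have i: "\<kappa> i \<in> mor \<Lambda>" "n \<le> deg \<Lambda> (\<kappa> i)" "pre (\<kappa> i) n = \<mu>" using \<kappa> by auto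
      show "V (suf \<mu> ?q) (V (suf (\<kappa> i) n) (h i)) = V (suf (\<kappa> i) ?q) (h i)"
        using pre_pre(2,3)[OF i(1,2) rq(2)] i(3) V_cmp by simp
    qed
    finally show "V (suf \<mu> ?q) (tail_sum 0 \<mu>)
        = (\<Sum>i\<in>{i\<in>?I. pre (\<kappa> i) n = \<mu>}. V (suf (\<kappa> i) ?q) (h i))" .
  qed
  \<comment> \<open>Each \<open>i\<close> is filed under its prefix of degree \<open>n\<close>,
    which belongs to \<open>?M\<close> by the facts \<open>I\<close>.\<close>
  also have "\<dots> = (\<Sum>i\<in>?I. V (suf (\<kappa> i) ?q) (h i))"
    by (rule sum.group) (use A finite_prefixes I in auto)
  also have "\<dots> = tail_sum (e_vec u) \<sigma>"
    unfolding tail_sum_def \<sigma>(2) qu ..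
  finally show ?thesis by simp
qed

lemma degree_term_nonneg:
  assumes cond: "op_nonneg (E_space \<Lambda> V v) (\<lambda>f. \<Sum>u\<in>Pow v. (-1) ^ card u *\<^sub>R P_op \<Lambda> V u v f)"
    and vn: "e_vec v \<le> n"
  shows "0 \<le> (\<Sum>u\<in>Pow v. (-1) ^ card u *
    (\<Sum>\<mu>\<in>{\<mu>\<in>prefixes. deg \<Lambda> \<mu> = n - e_vec u}. (norm (tail_sum (e_vec u) \<mu>))\<^sup>2))"
proof -
  let ?r = "n - e_vec v"
  let ?S = "\<lambda>u. {\<mu>\<in>prefixes. deg \<Lambda> \<mu> = n - e_vec u}"
  let ?X = "\<lambda>u \<mu>. (norm (tail_sum (e_vec u) \<mu>))\<^sup>2"
  let ?Z = "\<lambda>u \<rho>. \<Sum>\<mu>\<in>{\<mu>\<in>?S u. pre \<mu> ?r = \<rho>}. ?X u \<mu>"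
  \<comment> \<open>Only finiteness of \<open>R\<close> and the containment of the occurring \<rho>
    matter; paths shorter than \<open>?r\<close> may add arbitrary further elements.\<close>
  define R where "R = (\<lambda>\<mu>. pre \<mu> ?r) ` prefixes"
  have R: "finite R" by (simp add: R_def finite_prefixes)
  have "(\<Sum>u\<in>Pow v. (-1) ^ card u * (\<Sum>\<mu>\<in>?S u. ?X u \<mu>))
      = (\<Sum>u\<in>Pow v. \<Sum>\<rho>\<in>R. (-1) ^ card u * ?Z u \<rho>)"
  proof (rule sum.cong[OF refl])
    fix u
    have "(\<Sum>\<mu>\<in>?S u. ?X u \<mu>) = (\<Sum>\<rho>\<in>R. \<Sum>\<mu>\<in>{\<mu>\<in>?S u. pre \<mu> ?r = \<rho>}. ?X u \<mu>)"
      by (rule sum.group[symmetric]) (use R finite_prefixes in \<open>auto simp: R_def\<close>)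
    then show "(-1) ^ card u * (\<Sum>\<mu>\<in>?S u. ?X u \<mu>)
        = (\<Sum>\<rho>\<in>R. (-1) ^ card u * ?Z u \<rho>)"
      by (simp only: sum_distrib_left)
  qed
  also have "\<dots> = (\<Sum>\<rho>\<in>R. \<Sum>u\<in>Pow v. (-1) ^ card u * ?Z u \<rho>)"
    by (rule sum.swap)
  also have "\<dots> \<ge> 0"
  proof (rule sum_nonneg)
    fix \<rho> assume "\<rho> \<in> R"
    define M where "M = {\<mu>\<in>prefixes. deg \<Lambda> \<mu> = n \<and> pre \<mu> ?r = \<rho>}"
    have "(\<Sum>u\<in>Pow v. (-1) ^ card u * ?Z u \<rho>)
        = (\<Sum>u\<in>Pow v. (-1) ^ card u * (\<Sum>\<sigma>\<in>(\<lambda>\<mu>. pre \<mu> (n - e_vec u)) ` M.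
    (norm (\<Sum>\<mu>\<in>{\<mu>\<in>M. pre \<mu> (n - e_vec u) = \<sigma>}. V (suf \<mu> (n - e_vec u)) (tail_sum 0 \<mu>)))\<^sup>2))"
    proof (rule sum.cong[OF refl])
      fix u assume "u \<in> Pow v"
      then have u: "u \<subseteq> v" by simp
      let ?q = "n - e_vec u"
      let ?Y = "\<lambda>\<sigma>. (norm (\<Sum>\<mu>\<in>{\<mu>\<in>M. pre \<mu> ?q = \<sigma>}. V (suf \<mu> ?q) (tail_sum 0 \<mu>)))\<^sup>2"
      have rq: "?r \<le> ?q" "?q \<le> n"
        using e_vec_mono[OF u] by (auto simp: less_eq_vec_def diff_le_mono2)
      have "?Z u \<rho> = (\<Sum>\<sigma>\<in>{\<mu>\<in>?S u. pre \<mu> ?r = \<rho>}. ?Y \<sigma>)"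
        by (rule sum.cong[OF refl])
          (use tail_sum_regroup[OF vn u] prefixes_mor in \<open>simp add: M_def\<close>)
      \<comment> \<open>A \<sigma> that no path of \<open>M\<close> extends contributes the norm of
        an empty sum.\<close>
      also have "\<dots> = (\<Sum>\<sigma>\<in>(\<lambda>\<mu>. pre \<mu> ?q) ` M. ?Y \<sigma>)"
      proof (rule sum.mono_neutral_right)
        show "(\<lambda>\<mu>. pre \<mu> ?q) ` M \<subseteq> {\<mu>\<in>?S u. pre \<mu> ?r = \<rho>}"
        proof
          fix \<sigma> assume "\<sigma> \<in> (\<lambda>\<mu>. pre \<mu> ?q) ` M"
          then obtain \<mu> where \<mu>: "\<mu> \<in> prefixes" "deg \<Lambda> \<mu> = n" "pre \<mu> ?r = \<rho>" "\<sigma> = pre \<mu> ?q"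
            by (auto simp: M_def)
          note m = prefixes_mor[OF \<mu>(1)]
          have q: "?q \<le> deg \<Lambda> \<mu>" using \<mu>(2) rq(2) by simp
          show "\<sigma> \<in> {\<mu>\<in>?S u. pre \<mu> ?r = \<rho>}"
            using prefixes_closed[OF \<mu>(1) q] pre_suf(4)[OF m q] pre_pre(1)[OF m q rq(1)] \<mu> by simp
        qed
        show "\<forall>\<sigma>\<in>{\<mu>\<in>?S u. pre \<mu> ?r = \<rho>} - (\<lambda>\<mu>. pre \<mu> ?q) ` M. ?Y \<sigma> = 0"
        proof
          fix \<sigma> assume "\<sigma> \<in> {\<mu>\<in>?S u. pre \<mu> ?r = \<rho>} - (\<lambda>\<mu>. pre \<mu> ?q) ` M"
          then have "{\<mu>\<in>M. pre \<mu> ?q = \<sigma>} = {}" by auto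
          then show "?Y \<sigma> = 0" by (simp only: sum.empty) simp
        qed
      qed (use finite_prefixes in auto)
      finally show "(-1) ^ card u * ?Z u \<rho>
          = (-1) ^ card u * (\<Sum>\<sigma>\<in>(\<lambda>\<mu>. pre \<mu> ?q) ` M. ?Y \<sigma>)" by simp
    qed
    also have "\<dots> \<ge> 0"
      by (rule condition_on_tuple[OF cond vn])
        (use finite_prefixes prefixes_mor tail_sum_0_range in \<open>auto simp: M_def mor_deg_def\<close>)
    finally show "0 \<le> (\<Sum>u\<in>Pow v. (-1) ^ card u * ?Z u \<rho>)" .
  qed
  finally show ?thesis .
qed

text \<open>Paths of degree zero are vertices, and the tail sums at different vertices are
  orthogonal, so their squared norms add up to that of the total.\<close>

lemma tail_sum_deg_0: "(\<Sum>\<mu>\<in>{\<mu>\<in>prefixes. deg \<Lambda> \<mu> = 0}. (norm (tail_sum 0 \<mu>))\<^sup>2)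
    = (norm (\<Sum>i\<in>A. V (\<kappa> i) (h i)))\<^sup>2"
proof -
  let ?O = "{\<mu>\<in>prefixes. deg \<Lambda> \<mu> = 0}"
  have w: "tail_sum 0 \<mu> = (\<Sum>i\<in>{i\<in>A. rng \<Lambda> (\<kappa> i) = \<mu>}. V (\<kappa> i) (h i))" if "deg \<Lambda> \<mu> = 0" for \<mu>
    unfolding tail_sum_def that
    by (rule sum.cong) (auto simp: vec_zero_le pre_suf_0 \<kappa>)
  have orth: "cinner (tail_sum 0 \<mu>) (tail_sum 0 \<mu>') = 0" if "\<mu> \<in> ?O" "\<mu>' \<in> ?O" "\<mu> \<noteq> \<mu>'" for \<mu> \<mu>'
    using that by (auto simp: w cinner.sum_left cinner.sum_right \<kappa> intro!: sum.neutral cinner_V_diff_rng)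
  have "(\<Sum>\<mu>\<in>?O. tail_sum 0 \<mu>) = (\<Sum>\<mu>\<in>?O. \<Sum>i\<in>{i\<in>A. rng \<Lambda> (\<kappa> i) = \<mu>}. V (\<kappa> i) (h i))"
    by (rule sum.cong) (auto simp: w)
  also have "\<dots> = (\<Sum>i\<in>A. V (\<kappa> i) (h i))"
  proof (rule sum.group)
    show "(\<lambda>i. rng \<Lambda> (\<kappa> i)) ` A \<subseteq> ?O"
      using pre_in_prefixes[OF _ vec_zero_le] \<kappa> by (auto simp: pre_suf_0 deg_id rng_obj)
  qed (use A finite_prefixes in auto)
  finally show ?thesis
    using norm_sum_orthogonal[of ?O "tail_sum 0", OF _ orth] finite_prefixes by simp
qed

text \<open>The bound is stronger than positivity because total degree \<open>n = 0\<close> allows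
  only \<open>u = {}\<close> and vertices, and its term is the left-hand side. For any other
  \<open>n\<close> the condition is applied with \<open>v\<close> the support of \<open>n\<close>.
  The surplus is used in \<open>kI_positive\<close>.\<close>

lemma kernel_positive:
  assumes cond: "\<And>v. op_nonneg (E_space \<Lambda> V v) (\<lambda>f. \<Sum>u\<in>Pow v. (-1) ^ card u *\<^sub>R P_op \<Lambda> V u v f)"
  shows "(norm (\<Sum>i\<in>A. V (\<kappa> i) (h i)))\<^sup>2 \<le> Re (\<Sum>i\<in>A. \<Sum>j\<in>A. kS (\<kappa> i) (h i) (\<kappa> j) (h j))"
proof -
  define X where "X u \<mu> = (norm (tail_sum (e_vec u) \<mu>))\<^sup>2" for u \<mu>
  \<comment> \<open>Inserting 0 makes the term \<open>T 0\<close> available also for empty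
    \<open>A\<close>.\<close>
  define N where "N = insert 0 ((\<lambda>(\<mu>, u). deg \<Lambda> \<mu> + e_vec u) ` (prefixes \<times> (UNIV :: 'r set set)))"
  have N: "finite N" by (simp add: N_def finite_prefixes)
  let ?Z = "\<lambda>u n. \<Sum>\<mu>\<in>{\<mu>\<in>prefixes. deg \<Lambda> \<mu> + e_vec u = n}. X u \<mu>"
  define T where "T n = (\<Sum>u\<in>UNIV. (-1) ^ card u * ?Z u n)" for n
  have T: "T n = (\<Sum>u\<in>Pow {j. n $ j \<noteq> 0}. (-1) ^ card u *
      (\<Sum>\<mu>\<in>{\<mu>\<in>prefixes. deg \<Lambda> \<mu> = n - e_vec u}. X u \<mu>))" for n
    unfolding T_def
  proof (rule sum.mono_neutral_cong_right)
    show "\<forall>u\<in>UNIV - Pow {j. n $ j \<noteq> 0}. (-1) ^ card u * ?Z u n = 0"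
    proof
      fix u assume "u \<in> UNIV - Pow {j. n $ j \<noteq> 0}"
      then obtain j where "j \<in> u" "n $ j = 0" by auto
      then have "{\<mu>\<in>prefixes. deg \<Lambda> \<mu> + e_vec u = n} = {}"
        by (auto simp: vec_eq_iff e_vec_nth intro!: exI[of _ j])
      then show "(-1) ^ card u * ?Z u n = 0"
        by (simp only: sum.empty)
    qed
    fix u assume "u \<in> Pow {j. n $ j \<noteq> 0}"
    then have "e_vec u \<le> n" by (auto simp: less_eq_vec_def e_vec_nth Suc_le_eq)
    then have "p + e_vec u = n \<longleftrightarrow> p = n - e_vec u" for p
      by (auto simp: vec_diff_add add.commute)
    then show "(-1) ^ card u * ?Z u n
        = (-1) ^ card u * (\<Sum>\<mu>\<in>{\<mu>\<in>prefixes. deg \<Lambda> \<mu> = n - e_vec u}. X u \<mu>)" by simp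
  qed auto
  have nonneg: "0 \<le> T n" for n
    unfolding T X_def
    by (rule degree_term_nonneg[OF cond]) (auto simp: less_eq_vec_def e_vec_nth Suc_le_eq)
  have T0: "T 0 = (norm (\<Sum>i\<in>A. V (\<kappa> i) (h i)))\<^sup>2"
    unfolding T using tail_sum_deg_0 by (simp add: X_def e_vec_empty)
  have "(\<Sum>\<mu>\<in>prefixes. \<Sum>u\<in>UNIV. (-1) ^ card u * X u \<mu>) = (\<Sum>u\<in>UNIV. \<Sum>\<mu>\<in>prefixes. (-1) ^ card u * X u \<mu>)"
    by (rule sum.swap)
  also have "\<dots> = (\<Sum>u\<in>UNIV. \<Sum>n\<in>N. \<Sum>\<mu>\<in>{\<mu>\<in>prefixes. deg \<Lambda> \<mu> + e_vec u = n}. (-1) ^ card u * X u \<mu>)"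
  proof (rule sum.cong[OF refl])
    fix u :: "'r set"
    show "(\<Sum>\<mu>\<in>prefixes. (-1) ^ card u * X u \<mu>)
      = (\<Sum>n\<in>N. \<Sum>\<mu>\<in>{\<mu>\<in>prefixes. deg \<Lambda> \<mu> + e_vec u = n}. (-1) ^ card u * X u \<mu>)"
      by (rule sum.group[symmetric]) (use finite_prefixes N in \<open>auto simp: N_def\<close>)
  qed
  also have "\<dots> = (\<Sum>n\<in>N. T n)"
    unfolding T_def sum_distrib_left by (rule sum.swap)
  finally have Q: "Re (\<Sum>i\<in>A. \<Sum>j\<in>A. kS (\<kappa> i) (h i) (\<kappa> j) (h j)) = (\<Sum>n\<in>N. T n)"
    unfolding kernel_sum_eq X_def .
  have "T 0 \<le> (\<Sum>n\<in>N. T n)"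
    using member_le_sum[of 0 N T] N nonneg by (auto simp: N_def)
  then show ?thesis unfolding Q T0 .
qed

end

end

section \<open>Toeplitz families\<close>

text \<open>Orthogonality of ranges in equal degree stands in for the operator inequalities of
  contractions and Toeplitz families: it can be read off a Gram matrix, it implies these
  inequalities, and \<open>toeplitz_ops_of_dilation\<close> derives it for every dilation.\<close>

locale toeplitz_ops = rank_graph \<Lambda>
  for \<Lambda> :: "('l, 'r::finite) rank_graph_data" +
  fixes K :: "'k::chilbert_space set" and W :: "'l \<Rightarrow> 'k \<Rightarrow> 'k"
  assumes K: "closed_csubspace K"
    and W_bounded: "l \<in> mor \<Lambda> \<Longrightarrow> bounded_op K (W l)"
    and W_cmp: "composable l m \<Longrightarrow> x \<in> K \<Longrightarrow> W l (W m x) = W (cmp \<Lambda> l m) x"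
    and W_adj_self: "l \<in> mor \<Lambda> \<Longrightarrow> x \<in> K \<Longrightarrow> adj K (W l) (W l x) = W (src \<Lambda> l) x"
    and W_adj_orth: "l \<in> mor \<Lambda> \<Longrightarrow> m \<in> mor \<Lambda> \<Longrightarrow> deg \<Lambda> l = deg \<Lambda> m \<Longrightarrow> l \<noteq> m \<Longrightarrow> x \<in> K \<Longrightarrow>
      adj K (W m) (W l x) = 0"
begin

lemma sub: "csubspace K"
  using K by (simp add: closed_csubspace_def)

lemma W_in: "l \<in> mor \<Lambda> \<Longrightarrow> x \<in> K \<Longrightarrow> W l x \<in> K"
  using bounded_opD(1)[OF W_bounded] .

lemma Ws_in: "l \<in> mor \<Lambda> \<Longrightarrow> x \<in> K \<Longrightarrow> adj K (W l) x \<in> K"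
  using adj_in[OF K W_bounded] .

lemma cinner_Ws_right: "l \<in> mor \<Lambda> \<Longrightarrow> x \<in> K \<Longrightarrow> y \<in> K \<Longrightarrow> cinner x (adj K (W l) y) = cinner (W l x) y"
  using cinner_adj_right[OF K W_bounded] .

lemma cinner_Ws_left: "l \<in> mor \<Lambda> \<Longrightarrow> x \<in> K \<Longrightarrow> y \<in> K \<Longrightarrow> cinner (adj K (W l) x) y = cinner x (W l y)"
  using cinner_adj_left[OF K W_bounded] .

lemma W_isometric:
  "l \<in> mor \<Lambda> \<Longrightarrow> x \<in> K \<Longrightarrow> y \<in> K \<Longrightarrow> cinner (W l x) (W l y) = cinner (W (src \<Lambda> l) x) y"
  using cinner_Ws_left[of l "W l x" y] by (simp add: W_adj_self W_in)

lemma W_orthogonal: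
  "l \<in> mor \<Lambda> \<Longrightarrow> m \<in> mor \<Lambda> \<Longrightarrow> deg \<Lambda> l = deg \<Lambda> m \<Longrightarrow> l \<noteq> m \<Longrightarrow> x \<in> K \<Longrightarrow> y \<in> K \<Longrightarrow>
    cinner (W l x) (W m y) = 0"
  using cinner_Ws_left[of m "W l x" y] by (simp add: W_adj_orth W_in cinner.zero_left)

lemma obj_in_mor: "a \<in> obj \<Lambda> \<Longrightarrow> a \<in> mor \<Lambda>"
  using obj_mor by blast

text \<open>At a vertex \<open>W_adj_self\<close> reads: the adjoint of \<open>W a\<close> composed
  with \<open>W a\<close> is \<open>W a\<close>. Such a product is self-adjoint.\<close>

lemma W_obj_adj:
  assumes a: "a \<in> obj \<Lambda>" and x: "x \<in> K"
  shows "adj K (W a) x = W a x"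
proof (rule adj_eqI[OF sub])
  note m = obj_in_mor[OF a]
  show "W a x \<in> K" by (rule W_in[OF m x])
  show "cinner (W a y) x = cinner y (W a x)" if y: "y \<in> K" for y
  proof -
    have "cinner (W a y) x = cinner (W a y) (W a x)"
      using W_isometric[OF m y x] by (simp add: src_id a)
    also have "\<dots> = cinner y (adj K (W a) (W a x))"
      by (rule cinner_Ws_right[symmetric]) (use m x y W_in in auto)
    also have "\<dots> = cinner y (W a x)"
      by (simp add: W_adj_self m x src_id a)
    finally show ?thesis .
  qed
qed

lemma cinner_W_obj: "a \<in> obj \<Lambda> \<Longrightarrow> x \<in> K \<Longrightarrow> y \<in> K \<Longrightarrow> cinner (W a x) y = cinner x (W a y)"
  using cinner_Ws_right[of a x y] by (simp add: W_obj_adj obj_in_mor)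

lemma W_rng: "l \<in> mor \<Lambda> \<Longrightarrow> x \<in> K \<Longrightarrow> W (rng \<Lambda> l) (W l x) = W l x"
  using W_cmp[OF composable_id(1)] by (simp add: cmp_id_left)

lemma W_src: "l \<in> mor \<Lambda> \<Longrightarrow> x \<in> K \<Longrightarrow> W l (W (src \<Lambda> l) x) = W l x"
  using W_cmp[OF composable_id(2)] by (simp add: cmp_id_right)

lemma W_obj_idem: "a \<in> obj \<Lambda> \<Longrightarrow> x \<in> K \<Longrightarrow> W a (W a x) = W a x"
  using W_rng[of a x] by (simp add: rng_id obj_in_mor)

lemma W_obj_orth:
  assumes "a \<in> obj \<Lambda>" "b \<in> obj \<Lambda>" "a \<noteq> b" "x \<in> K"
  shows "W a (W b x) = 0"
  using W_adj_orth[of b a x] assms by (simp add: W_obj_adj obj_in_mor deg_id W_in)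

lemma W_0: "l \<in> mor \<Lambda> \<Longrightarrow> W l 0 = 0"
  using clinear_on_0[OF sub bounded_opD(2)[OF W_bounded]] .

lemma W_not_composable:
  assumes l: "l \<in> mor \<Lambda>" and m: "m \<in> mor \<Lambda>" and neq: "src \<Lambda> l \<noteq> rng \<Lambda> m" and x: "x \<in> K"
  shows "W l (W m x) = 0"
proof -
  have "W l (W m x) = W l (W (src \<Lambda> l) (W (rng \<Lambda> m) (W m x)))"
    using l m x by (simp add: W_rng W_src W_in)
  also have "\<dots> = 0"
    using l m x neq by (simp add: W_obj_orth W_0 W_in src_obj rng_obj)
  finally show ?thesis .
qed

lemma norm_W_le:
  assumes l: "l \<in> mor \<Lambda>" and x: "x \<in> K"
  shows "norm (W l x) \<le> norm x"
proof -
  let ?s = "src \<Lambda> l"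
  have s: "?s \<in> obj \<Lambda>" "?s \<in> mor \<Lambda>" using l by (auto simp: src_obj obj_in_mor)
  have eq: "cinner (W ?s x) (W ?s x) = cinner (W ?s x) x"
    using W_isometric[OF s(2) x x] by (simp add: src_id s)
  then have "norm (W l x) = norm (W ?s x)"
    using W_isometric[OF l x x] by (intro norm_eq_of_cinner) simp
  then show ?thesis using norm_le_of_cinner[OF eq] by simp
qed

lemma norm_sum_W_le:
  assumes F: "finite F" "F \<subseteq> mor_deg \<Lambda> n" and x: "\<And>l. l \<in> F \<Longrightarrow> x l \<in> K"
  shows "(norm (\<Sum>l\<in>F. W l (x l)))\<^sup>2 \<le> (\<Sum>l\<in>F. (norm (x l))\<^sup>2)"
proof -
  have m: "l \<in> mor \<Lambda>" "deg \<Lambda> l = n" if "l \<in> F" for l using F that mor_degD by auto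
  have "(norm (\<Sum>l\<in>F. W l (x l)))\<^sup>2 = (\<Sum>l\<in>F. (norm (W l (x l)))\<^sup>2)"
    by (rule norm_sum_orthogonal[OF F(1)]) (simp add: W_orthogonal m x)
  also have "\<dots> \<le> (\<Sum>l\<in>F. (norm (x l))\<^sup>2)"
    by (rule sum_mono) (simp add: norm_W_le m x power_mono)
  finally show ?thesis .
qed

lemma cinner_W_Ws:
  "l \<in> mor \<Lambda> \<Longrightarrow> x \<in> K \<Longrightarrow> cinner (W l (adj K (W l) x)) x = complex_of_real ((norm (adj K (W l) x))\<^sup>2)"
  by (simp add: cinner_Ws_right[symmetric] Ws_in cinner_self del: of_real_power)

text \<open>Expand \<open>(norm (x - p))\<^sup>2 \<ge> 0\<close>: the inner product of
  \<open>x\<close> with \<open>p\<close> is the left-hand sum, and \<open>(norm p)\<^sup>2\<close>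
  is at most that sum because the ranges are orthogonal.\<close>

lemma W_bessel:
  assumes F: "finite F" "F \<subseteq> mor_deg \<Lambda> n" and x: "x \<in> K"
  shows "(\<Sum>l\<in>F. (norm (adj K (W l) x))\<^sup>2) \<le> (norm x)\<^sup>2"
proof -
  define p where "p = (\<Sum>l\<in>F. W l (adj K (W l) x))"
  have m: "l \<in> mor \<Lambda>" if "l \<in> F" for l using F that mor_degD by auto
  have "cinner p x = complex_of_real (\<Sum>l\<in>F. (norm (adj K (W l) x))\<^sup>2)"
    unfolding p_def cinner.sum_left of_real_sum by (intro sum.cong refl cinner_W_Ws m x)
  then have "Re (cinner x p) = (\<Sum>l\<in>F. (norm (adj K (W l) x))\<^sup>2)"
    by (subst cinner_commute) simp
  moreover have "(norm p)\<^sup>2 \<le> (\<Sum>l\<in>F. (norm (adj K (W l) x))\<^sup>2)"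
    unfolding p_def by (rule norm_sum_W_le[OF F]) (simp add: Ws_in m x)
  moreover have "0 \<le> (norm (x - p))\<^sup>2" by simp
  ultimately show ?thesis unfolding norm_diff_sq by linarith
qed

lemma orth_projection_W: "a \<in> obj \<Lambda> \<Longrightarrow> orth_projection K (W a)"
  unfolding orth_projection_def
  using W_bounded[OF obj_in_mor] W_obj_idem W_obj_adj by blast

lemma contraction_W: "contraction \<Lambda> K W"
proof -
  have summ: "(\<lambda>l. W l (adj K (W l) x)) summable_on mor_deg \<Lambda> n \<and>
      cinner (x - (\<Sum>\<^sub>\<infinity>l\<in>mor_deg \<Lambda> n. W l (adj K (W l) x))) x \<in> \<real>\<^sub>\<ge>\<^sub>0" if x: "x \<in> K" for n x
  proof
    let ?g = "\<lambda>l. (norm (adj K (W l) x))\<^sup>2"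
    have g: "?g summable_on mor_deg \<Lambda> n"
      by (intro nonneg_bdd_above_summable_on bdd_aboveI2[where M = "(norm x)\<^sup>2"])
        (use W_bessel x in auto)
    show s: "(\<lambda>l. W l (adj K (W l) x)) summable_on mor_deg \<Lambda> n"
      by (rule summable_on_norm_sum_bound(1)[OF g], rule norm_sum_W_le)
        (use Ws_in x mor_degD in auto)
    have "((\<lambda>l. cinner (W l (adj K (W l) x)) x) has_sum
        cinner (\<Sum>\<^sub>\<infinity>l\<in>mor_deg \<Lambda> n. W l (adj K (W l) x)) x) (mor_deg \<Lambda> n)"
      by (rule has_sum_bounded_linear[OF cinner.bounded_linear_left has_sum_infsum[OF s]])
    moreover have "((\<lambda>l. cinner (W l (adj K (W l) x)) x) has_sum
        complex_of_real (infsum ?g (mor_deg \<Lambda> n))) (mor_deg \<Lambda> n)"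
    proof (subst has_sum_cong)
      show "cinner (W l (adj K (W l) x)) x = complex_of_real (?g l)" if "l \<in> mor_deg \<Lambda> n" for l
        by (rule cinner_W_Ws) (use that mor_degD x in auto)
      show "((\<lambda>l. complex_of_real (?g l)) has_sum complex_of_real (infsum ?g (mor_deg \<Lambda> n))) (mor_deg \<Lambda> n)"
        by (rule has_sum_bounded_linear[OF bounded_linear_of_real has_sum_infsum[OF g]])
    qed
    ultimately have eq: "cinner (\<Sum>\<^sub>\<infinity>l\<in>mor_deg \<Lambda> n. W l (adj K (W l) x)) x
        = complex_of_real (infsum ?g (mor_deg \<Lambda> n))"
      by (rule has_sum_unique)
    have "infsum ?g (mor_deg \<Lambda> n) \<le> (norm x)\<^sup>2"
      by (rule infsum_le_finite_sums[OF g W_bessel[OF _ _ x]])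
    then show "cinner (x - (\<Sum>\<^sub>\<infinity>l\<in>mor_deg \<Lambda> n. W l (adj K (W l) x))) x \<in> \<real>\<^sub>\<ge>\<^sub>0"
      unfolding cinner.diff_left eq cinner_self by (simp flip: of_real_diff del: of_real_power)
  qed
  show ?thesis
    unfolding contraction_def op_le_def op_nonneg_def
    using W_bounded W_not_composable W_cmp orth_projection_W summ by (auto simp: composable_def)
qed

lemma partial_isometry_W:
  assumes l: "l \<in> mor \<Lambda>"
  shows "partial_isometry K (W l)"
  unfolding partial_isometry_def
proof (intro conjI ballI impI)
  show "bounded_op K (W l)" by (rule W_bounded[OF l])
  fix x assume x: "x \<in> K" and orth: "\<forall>y\<in>K. W l y = 0 \<longrightarrow> cinner x y = 0"
  let ?s = "src \<Lambda> l"
  have s: "?s \<in> obj \<Lambda>" "?s \<in> mor \<Lambda>" using l by (auto simp: src_obj obj_in_mor)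
  note lin = bounded_opD(2)[OF W_bounded[OF l]]
  \<comment> \<open>The part of \<open>x\<close> outside the source projection lies in the kernel of
    \<open>W l\<close>, so \<open>x\<close> is orthogonal to it.\<close>
  have "W l (x - W ?s x) = 0"
    using clinear_on_diff[OF sub lin x W_in[OF s(2) x]] W_src[OF l x] by simp
  then have "cinner x (x - W ?s x) = 0"
    using orth csubspace_diff[OF sub x W_in[OF s(2) x]] by blast
  then have "cinner x x = cinner (W l x) (W l x)"
    using W_isometric[OF l x x] cinner_W_obj[OF s(1) x x] by (simp add: cinner.diff_right)
  then show "norm (W l x) = norm x" by (intro norm_eq_of_cinner) simp
qed

lemma toeplitz_family_W: "toeplitz_family \<Lambda> K W"
proof -
  have range: "cinner (W a x - (\<Sum>l\<in>F. W l (adj K (W l) x))) x \<in> \<real>\<^sub>\<ge>\<^sub>0"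
    if a: "a \<in> obj \<Lambda>" and F: "finite F" "F \<subseteq> {l \<in> mor_deg \<Lambda> n. rng \<Lambda> l = a}" and x: "x \<in> K" for n a F x
  proof -
    note am = obj_in_mor[OF a]
    have m: "l \<in> mor \<Lambda>" "rng \<Lambda> l = a" if "l \<in> F" for l using F that mor_degD by auto
    have ax: "W a x \<in> K" by (rule W_in[OF am x])
    \<comment> \<open>The range of \<open>W l\<close> lies below \<open>W a\<close>, so
      \<open>x\<close> may be replaced by \<open>W a x\<close>; the Bessel inequality at that vector
      is the claim.\<close>
    have "adj K (W l) (W a x) = adj K (W l) x" if l: "l \<in> F" for l
    proof (rule adj_eqI[OF sub])
      show "adj K (W l) x \<in> K" by (rule Ws_in[OF m(1)[OF l] x])
      show "cinner (W l y) (W a x) = cinner y (adj K (W l) x)" if y: "y \<in> K" for y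
        using m[OF l] y x a W_rng[of l y]
        by (simp add: cinner_W_obj[symmetric] W_in cinner_Ws_right)
    qed
    then have "(\<Sum>l\<in>F. (norm (adj K (W l) x))\<^sup>2) \<le> (norm (W a x))\<^sup>2"
      using W_bessel[OF F(1) _ ax, of n] F(2) by (auto simp: subset_iff)
    moreover have "cinner (\<Sum>l\<in>F. W l (adj K (W l) x)) x = complex_of_real (\<Sum>l\<in>F. (norm (adj K (W l) x))\<^sup>2)"
      unfolding cinner.sum_left of_real_sum by (intro sum.cong refl cinner_W_Ws m x)
    moreover have "cinner (W a x) x = complex_of_real ((norm (W a x))\<^sup>2)"
      using W_isometric[OF am x x] unfolding cinner_self by (simp add: src_id a)
    ultimately show ?thesis
      unfolding cinner.diff_left by (simp flip: of_real_diff del: of_real_power of_real_sum)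
  qed
  show ?thesis
    unfolding toeplitz_family_def op_le_def op_nonneg_def
    using partial_isometry_W orth_projection_W W_obj_orth W_cmp W_adj_self range
    by (auto simp: composable_def)
qed

end

section \<open>Existence of the dilation\<close>

context graph_contraction
begin

lemma kS_commute: "kS m y l x = cnj (kS l x m y)"
  using cinner_commute[of "V (suf m _) y" "V (suf l _) x"]
  by (auto simp: kS_def Let_def vmin_commute[of "deg \<Lambda> m"])

text \<open>A common left factor adds its degree to the minimum, leaves the suffixes unchanged and,
  by left cancellation, does not affect equality of prefixes. This is what makes the dilating
  operators isometric on their source.\<close>

lemma kS_cmp:
  assumes c: "composable l m" "composable l n"
  shows "kS (cmp \<Lambda> l m) x (cmp \<Lambda> l n) y = kS m x n y"
proof -
  let ?p = "vmin (deg \<Lambda> m) (deg \<Lambda> n)"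
  have p: "vmin (deg \<Lambda> (cmp \<Lambda> l m)) (deg \<Lambda> (cmp \<Lambda> l n)) = deg \<Lambda> l + ?p"
    by (simp only: composableD(5)[OF c(1)] composableD(5)[OF c(2)] vmin_add)
  note m = pre_suf_cmp_ge[OF c(1) vmin_le(1), of "deg \<Lambda> n"]
  note n = pre_suf_cmp_ge[OF c(2) vmin_le(2), of "deg \<Lambda> m"]
  have "pre (cmp \<Lambda> l m) (deg \<Lambda> l + ?p) = pre (cmp \<Lambda> l n) (deg \<Lambda> l + ?p) \<longleftrightarrow> pre m ?p = pre n ?p"
    using cmp_cancel_left[OF m(3) n(3)] by (auto simp: m(1) n(1))
  then show ?thesis by (simp only: kS_def Let_def p m(2) n(2))
qed

lemma kS_diff_rng:
  assumes "l \<in> mor \<Lambda>" "m \<in> mor \<Lambda>" "rng \<Lambda> l \<noteq> rng \<Lambda> m"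
  shows "kS l x m y = 0"
  using pre_suf(8)[OF assms(1) vmin_le(1), of "deg \<Lambda> m"]
    pre_suf(8)[OF assms(2) vmin_le(2), of "deg \<Lambda> l"] assms(3)
  by (auto simp: kS_def Let_def)

text \<open>The compared prefixes are the ranges; where they differ, the vectors on the right are
  orthogonal as well.\<close>

lemma kS_disjoint:
  assumes lm: "l \<in> mor \<Lambda>" "m \<in> mor \<Lambda>" and "vmin (deg \<Lambda> l) (deg \<Lambda> m) = 0"
  shows "kS l x m y = cinner (V l x) (V m y)"
  using assms cinner_V_diff_rng[OF lm] by (auto simp: kS_def Let_def pre_suf_0)

text \<open>The two paths already differ in their prefixes of degree \<open>deg \<Lambda> l\<close>,
  hence also in the longer ones that \<open>kS\<close> compares.\<close>

lemma kS_same_degree: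
  assumes c: "composable l \<alpha>" "composable m \<beta>" and d: "deg \<Lambda> l = deg \<Lambda> m" and "l \<noteq> m"
  shows "kS (cmp \<Lambda> l \<alpha>) x (cmp \<Lambda> m \<beta>) y = 0"
proof -
  let ?p = "vmin (deg \<Lambda> (cmp \<Lambda> l \<alpha>)) (deg \<Lambda> (cmp \<Lambda> m \<beta>))"
  have le: "deg \<Lambda> l \<le> ?p"
    by (simp add: vmin_greatest composableD(5)[OF c(1)] composableD(5)[OF c(2)] d vec_le_add)
  have "pre (cmp \<Lambda> l \<alpha>) ?p \<noteq> pre (cmp \<Lambda> m \<beta>) ?p"
    using pre_eq_mono[OF composableD(4)[OF c(1)] composableD(4)[OF c(2)] vmin_le(1) vmin_le(2) le]
      pre_suf_cmp(1)[OF c(1)] pre_suf_cmp(1)[OF c(2)] d \<open>l \<noteq> m\<close> by metis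
  then show ?thesis by (simp add: kS_def Let_def)
qed

text \<open>The index \<open>(None, h)\<close> stands for the vector \<open>h\<close> of the original space, and \<open>(Some l, h)\<close> for
  its image under the operator of \<open>l\<close> in the dilation.\<close>

fun kI :: "'l option \<times> 'h \<Rightarrow> 'l option \<times> 'h \<Rightarrow> complex" where
  "kI (None, x) (None, y) = cinner x y"
| "kI (Some l, x) (None, y) = cinner (V l x) y"
| "kI (None, x) (Some m, y) = cinner x (V m y)"
| "kI (Some l, x) (Some m, y) = kS l x m y"

fun valid :: "'l option \<times> 'h \<Rightarrow> bool" where
  "valid (None, x) \<longleftrightarrow> True"
| "valid (Some l, x) \<longleftrightarrow> l \<in> mor \<Lambda>"

text \<open>For paths that do not compose, \<open>(None, 0)\<close> serves as an index of the zero
  vector: \<open>kI\<close> vanishes on it.\<close>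

fun act :: "'l \<Rightarrow> 'l option \<times> 'h \<Rightarrow> 'l option \<times> 'h" where
  "act l (None, x) = (Some l, x)"
| "act l (Some m, x) = (if src \<Lambda> l = rng \<Lambda> m then (Some (cmp \<Lambda> l m), x) else (None, 0))"

lemma kI_commute: "kI j i = cnj (kI i j)"
  by (cases "(i, j)" rule: kI.cases) (auto intro: cinner_commute kS_commute)

lemma kS_scale:
  assumes lm: "l \<in> mor \<Lambda>" "m \<in> mor \<Lambda>"
  shows "kS l (c *\<^sub>C x) m (d *\<^sub>C y) = c * cnj d * kS l x m y"
  using pre_suf(3)[OF lm(1) vmin_le(1), of "deg \<Lambda> m"] pre_suf(3)[OF lm(2) vmin_le(2), of "deg \<Lambda> l"]
  by (simp add: kS_def Let_def V_scaleC cinner_scaleC_left cinner_scaleC_right)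

lemma kI_scale:
  "valid (o1, x) \<Longrightarrow> valid (o2, y) \<Longrightarrow> kI (o1, c *\<^sub>C x) (o2, d *\<^sub>C y) = c * cnj d * kI (o1, x) (o2, y)"
  by (cases o1; cases o2)
    (auto simp: V_scaleC kS_scale cinner_scaleC_left cinner_scaleC_right)

lemma kI_zero:
  assumes "valid i" "valid (o', x)"
  shows "kI (o', 0) i = 0" "kI i (o', 0) = 0"
  using kI_scale[of o' x "fst i" "snd i" 0 1] kI_scale[of "fst i" "snd i" o' x 1 0] assms
  by (simp_all add: scaleC.zero_left)

lemma valid_act: "l \<in> mor \<Lambda> \<Longrightarrow> valid i \<Longrightarrow> valid (act l i)"
  by (cases "(l, i)" rule: act.cases) (auto simp: cmp_mor)

lemma act_cases:
  assumes "l \<in> mor \<Lambda>" "valid i"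
  obtains "act l i = (None, 0)" | \<alpha> x where "act l i = (Some (cmp \<Lambda> l \<alpha>), x)" "composable l \<alpha>"
proof -
  obtain o' y where i: "i = (o', y)" by (cases i)
  show ?thesis
  proof (cases o')
    case None
    then show ?thesis
      using that(2)[of "src \<Lambda> l" y] composable_id(2)[OF assms(1)] by (simp add: i cmp_id_right assms(1))
  next
    case (Some m)
    then show ?thesis
      using that(1) that(2)[of m y] assms by (cases "src \<Lambda> l = rng \<Lambda> m") (auto simp: i composable_def)
  qed
qed

text \<open>The Gram form of \<open>W_adj_self\<close>; it also yields the norm bound that allows
  \<open>act l\<close> to be extended to an operator.\<close>

lemma kI_act_isometric:
  assumes l: "l \<in> mor \<Lambda>" and i: "valid i" and j: "valid j"
  shows "kI (act l i) (act l j) = kI (act (src \<Lambda> l) i) j"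
proof -
  let ?s = "src \<Lambda> l"
  have s: "?s \<in> obj \<Lambda>" "?s \<in> mor \<Lambda>" "rng \<Lambda> ?s = ?s" "src \<Lambda> ?s = ?s" "deg \<Lambda> ?s = 0"
    "composable l ?s" "cmp \<Lambda> l ?s = l"
    using l src_obj obj_mor composable_id(2) by (auto simp: rng_id src_id deg_id cmp_id_right)
  have dis: "vmin 0 p = 0" "vmin p 0 = 0" for p :: "nat ^ 'r"
    by (simp_all add: vmin_def vec_eq_iff)
  have c: "composable l m" if "m \<in> mor \<Lambda>" "?s = rng \<Lambda> m" for m
    using l that by (simp add: composable_def)
  have self: "kS l x l y = cinner (V ?s x) y" for x y
    using kS_cmp[OF s(6) s(6)]
    by (simp add: s kS_disjoint dis cinner_V_obj V_obj_idem)
  have left: "kS l x (cmp \<Lambda> l m) y = kS ?s x m y" if "m \<in> mor \<Lambda>" "?s = rng \<Lambda> m" for m x y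
    using kS_cmp[OF s(6) c[OF that]] by (simp add: s)
  have right: "kS (cmp \<Lambda> l m) x l y = cinner (V m x) y" if "m \<in> mor \<Lambda>" "?s = rng \<Lambda> m" for m x y
    using kS_cmp[OF c[OF that] s(6)] cinner_V_rng[OF that(1)] that(1)
    by (simp add: s kS_disjoint dis flip: that(2))
  obtain oi x oj y where ij: "i = (oi, x)" "j = (oj, y)" by (cases i, cases j)
  show ?thesis
    using i j
    by (cases oi; cases oj)
      (auto simp: ij self left right cmp_id_left c kS_cmp kS_diff_rng s V_0 cinner.zero_left
        cinner.zero_right cmp_mor l)
qed

text \<open>The Gram form of \<open>W_adj_orth\<close>.\<close>

lemma kI_act_orthogonal:
  assumes l: "l \<in> mor \<Lambda>" and m: "m \<in> mor \<Lambda>" and d: "deg \<Lambda> l = deg \<Lambda> m" and "l \<noteq> m"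
    and i: "valid i" and j: "valid j"
  shows "kI (act l i) (act m j) = 0"
proof (cases rule: act_cases[OF l i])
  case 1
  then show ?thesis using kI_zero(1)[OF valid_act[OF m j], of None] by simp
next
  case (2 \<alpha> x)
  note c = this
  show ?thesis
  proof (cases rule: act_cases[OF m j])
    case 1
    then show ?thesis using kI_zero(2)[OF valid_act[OF l i], of None] by simp
  next
    case (2 \<beta> y)
    then show ?thesis using c kS_same_degree[OF c(2) 2(2) d \<open>l \<noteq> m\<close>] by simp
  qed
qed

text \<open>The Gram form of the statement that the adjoint of the dilating operator restricts to
  \<open>Vs l\<close> on the original space.\<close>

lemma kI_act_J:
  assumes l: "l \<in> mor \<Lambda>" and i: "valid i"
  shows "kI (act l i) (None, h) = kI i (None, Vs l h)"
proof -
  obtain oi x where "i = (oi, x)" by (cases i)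
  then show ?thesis
    using i l by (cases oi) (auto simp: cinner_Vs_right V_cmp composable_def V_not_composable cinner.zero_left)
qed

text \<open>The Gram form of \<open>W_cmp\<close>. The indices themselves may differ: for paths that
  do not compose, the left side gives \<open>(Some l, 0)\<close> and the right side
  \<open>(None, 0)\<close>, two names of the zero vector.\<close>

lemma kI_act_act:
  assumes c: "composable l m" and i: "valid i" and j: "valid j"
  shows "kI (act l (act m i)) j = kI (act (cmp \<Lambda> l m) i) j"
proof -
  note cD = composableD[OF c]
  obtain oi x where ix: "i = (oi, x)" by (cases i)
  show ?thesis
  proof (cases oi)
    case None
    then show ?thesis using c by (simp add: ix composable_def)
  next
    case (Some n)
    then have n: "n \<in> mor \<Lambda>" using i ix by simp
    show ?thesis
    proof (cases "src \<Lambda> m = rng \<Lambda> n")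
      case True
      then have "composable m n" using cD n by (simp add: composable_def)
      then show ?thesis
        using composable_assoc[OF c] cD composableD[of m n] by (simp add: ix Some True)
    next
      case False
      then show ?thesis
        using cD kI_zero(1)[OF j, of "Some l" 0] kI_zero(1)[OF j, of None 0] by (simp add: ix Some)
    qed
  qed
qed

section \<open>Positivity and realisation of the extended kernel\<close>

context
  assumes cond: "\<And>v. op_nonneg (E_space \<Lambda> V v) (\<lambda>f. \<Sum>u\<in>Pow v. (-1) ^ card u *\<^sub>R P_op \<Lambda> V u v f)"
begin

text \<open>With \<open>x\<close> the sum of the original vectors and \<open>y\<close> that of the
  \<open>V (\<kappa> i) (h i)\<close>, the form is at least \<open>(norm (x + y))\<^sup>2\<close>:
  \<open>kernel_positive\<close> supplies the term \<open>(norm y)\<^sup>2\<close> that completes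
  the square.\<close>

lemma kI_positive:
  fixes A :: "'i set" and z :: "'i \<Rightarrow> 'l option \<times> 'h"
  assumes A: "finite A" and z: "\<And>i. i \<in> A \<Longrightarrow> valid (z i)"
  shows "0 \<le> Re (\<Sum>i\<in>A. \<Sum>j\<in>A. kI (z i) (z j))"
proof -
  define A0 A1 where "A0 = {i\<in>A. fst (z i) = None}" and "A1 = {i\<in>A. fst (z i) \<noteq> None}"
  have fin: "finite A0" "finite A1" "A = A0 \<union> A1" "A0 \<inter> A1 = {}"
    using A by (auto simp: A0_def A1_def)
  define \<kappa> where "\<kappa> i = the (fst (z i))" for i
  define h where "h i = snd (z i)" for i
  have z0: "z i = (None, h i)" if "i \<in> A0" for i
    using that by (simp add: A0_def h_def prod_eq_iff)
  have z1: "z i = (Some (\<kappa> i), h i)" "\<kappa> i \<in> mor \<Lambda>" if "i \<in> A1" for i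
  proof -
    show eq: "z i = (Some (\<kappa> i), h i)"
      using that by (auto simp: A1_def h_def \<kappa>_def prod_eq_iff)
    show "\<kappa> i \<in> mor \<Lambda>" using z[of i] that unfolding eq by (simp add: A1_def)
  qed
  define x y where "x = (\<Sum>i\<in>A0. h i)" and "y = (\<Sum>i\<in>A1. V (\<kappa> i) (h i))"
  have "(\<Sum>i\<in>A. \<Sum>j\<in>A. kI (z i) (z j)) = cinner x x + cinner x y + cinner y x
      + (\<Sum>i\<in>A1. \<Sum>j\<in>A1. kS (\<kappa> i) (h i) (\<kappa> j) (h j))"
  proof -
    have 00: "(\<Sum>i\<in>A0. \<Sum>j\<in>A0. kI (z i) (z j)) = cinner x x"
      unfolding x_def cinner.sum_left unfolding cinner.sum_right by (simp add: z0)
    have 01: "(\<Sum>i\<in>A0. \<Sum>j\<in>A1. kI (z i) (z j)) = cinner x y"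
      unfolding x_def y_def cinner.sum_left unfolding cinner.sum_right by (simp add: z0 z1)
    have 10: "(\<Sum>i\<in>A1. \<Sum>j\<in>A0. kI (z i) (z j)) = cinner y x"
      unfolding x_def y_def cinner.sum_left unfolding cinner.sum_right by (simp add: z0 z1)
    have 11: "(\<Sum>i\<in>A1. \<Sum>j\<in>A1. kI (z i) (z j)) = (\<Sum>i\<in>A1. \<Sum>j\<in>A1. kS (\<kappa> i) (h i) (\<kappa> j) (h j))"
      by (simp add: z1)
    show ?thesis
      unfolding fin(3) sum.union_disjoint[OF fin(1,2,4)] sum.distrib 00 01 10 11 by simp
  qed
  then have "Re (\<Sum>i\<in>A. \<Sum>j\<in>A. kI (z i) (z j)) = (norm x)\<^sup>2 + 2 * Re (cinner x y)
      + Re (\<Sum>i\<in>A1. \<Sum>j\<in>A1. kS (\<kappa> i) (h i) (\<kappa> j) (h j))"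
    using arg_cong[OF cinner_commute[of y x], of Re] by (simp add: cinner_self del: of_real_power)
  moreover have "(norm y)\<^sup>2 \<le> Re (\<Sum>i\<in>A1. \<Sum>j\<in>A1. kS (\<kappa> i) (h i) (\<kappa> j) (h j))"
    unfolding y_def by (rule kernel_positive[OF fin(2) z1(2) cond])
  moreover have "0 \<le> (norm x)\<^sup>2 + 2 * Re (cinner x y) + (norm y)\<^sup>2"
    unfolding norm_add_sq[symmetric] by simp
  ultimately show ?thesis by linarith
qed

text \<open>\<open>gram_realisation\<close> needs a kernel on the whole index type, so
  \<open>t\<close> sends invalid indices to that of the zero vector. The coefficients
  \<open>c i\<close> are absorbed into the vector component of the index, which reduces positivity
  to \<open>kI_positive\<close>.\<close>

lemma realisation_exists:
  obtains X :: "'l option \<times> 'h \<Rightarrow> ('l option \<times> 'h, complex) ell2"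
  where "\<And>i j. valid i \<Longrightarrow> valid j \<Longrightarrow> cinner (X i) (X j) = kI i j"
proof -
  define t where "t i = (if valid i then i else (None, 0))" for i
  have t: "valid (t i)" for i by (simp add: t_def)
  have vs: "valid (fst i, c *\<^sub>C snd i)" if "valid i" for i and c :: complex
    using that by (cases i) (metis fst_conv snd_conv valid.elims(2) valid.simps)
  have pos: "0 \<le> Re (\<Sum>i\<in>A. \<Sum>j\<in>A. c i * cnj (c j) * kI (t i) (t j))" if "finite A" for A and c :: "'l option \<times> 'h \<Rightarrow> complex"
  proof -
    have "(\<Sum>i\<in>A. \<Sum>j\<in>A. c i * cnj (c j) * kI (t i) (t j))
        = (\<Sum>i\<in>A. \<Sum>j\<in>A. kI (fst (t i), c i *\<^sub>C snd (t i)) (fst (t j), c j *\<^sub>C snd (t j)))"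
      by (intro sum.cong refl) (simp add: kI_scale t)
    then show ?thesis
      using kI_positive[OF that, of "\<lambda>i. (fst (t i), c i *\<^sub>C snd (t i))"] vs[OF t] by simp
  qed
  obtain X :: "'l option \<times> 'h \<Rightarrow> ('l option \<times> 'h, complex) ell2"
    where X: "\<And>i j. cinner (X i) (X j) = kI (t i) (t j)"
    using gram_realisation[of "\<lambda>i j. kI (t i) (t j)", OF kI_commute pos] by blast
  show ?thesis by (rule that[of X]) (simp add: X t_def)
qed

end

section \<open>Operators on the closed span of the realised vectors\<close>

context
  fixes X :: "'l option \<times> 'h \<Rightarrow> ('l option \<times> 'h, complex) ell2"
  assumes X: "\<And>i j. valid i \<Longrightarrow> valid j \<Longrightarrow> cinner (X i) (X j) = kI i j"
begin

definition KX :: "('l option \<times> 'h, complex) ell2 set" where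
  "KX = closed_cspan (X ` Collect valid)"

lemma KX: "closed_csubspace KX"
  by (simp add: KX_def)

lemma X_in: "valid i \<Longrightarrow> X i \<in> KX"
  unfolding KX_def by (rule closed_cspan_base) simp

lemma KX_eqI:
  assumes "y \<in> KX" "y' \<in> KX" "\<And>i. valid i \<Longrightarrow> cinner (X i) y = cinner (X i) y'"
  shows "y = y'"
  by (rule cspan_eqI[OF assms(1,2)[unfolded KX_def]]) (use assms(3) in blast)

text \<open>By \<open>kI_act_isometric\<close> the image under \<open>l\<close> has the norm of the
  image under its source vertex. For a vertex the same identity says that the image is orthogonal to
  its difference from the original vector, so its norm is no larger.\<close>

lemma act_bound:
  assumes l: "l \<in> mor \<Lambda>" and A: "A \<subseteq> Collect valid"
  shows "norm (\<Sum>i\<in>A. c i *\<^sub>C X (act l i)) \<le> 1 * norm (\<Sum>i\<in>A. c i *\<^sub>C X i)"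
proof -
  define y where "y m = (\<Sum>i\<in>A. c i *\<^sub>C X (act m i))" for m
  define x where "x = (\<Sum>i\<in>A. c i *\<^sub>C X i)"
  have eq: "cinner (y m) (y m) = cinner (y (src \<Lambda> m)) x" if m: "m \<in> mor \<Lambda>" for m
  proof -
    have s: "src \<Lambda> m \<in> mor \<Lambda>" using src_obj[OF m] obj_mor by blast
    show ?thesis
      unfolding y_def x_def cinner.sum_left unfolding cinner.sum_right
    proof (intro sum.cong refl)
      fix i j assume "i \<in> A" "j \<in> A"
      then have ij: "valid i" "valid j" using A by auto
      then show "cinner (c i *\<^sub>C X (act m i)) (c j *\<^sub>C X (act m j))
          = cinner (c i *\<^sub>C X (act (src \<Lambda> m) i)) (c j *\<^sub>C X j)"
        using kI_act_isometric[OF m ij] valid_act m s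
        by (simp add: cinner_scaleC_left cinner_scaleC_right X)
    qed
  qed
  let ?s = "src \<Lambda> l"
  have s: "?s \<in> mor \<Lambda>" "src \<Lambda> ?s = ?s" using src_obj[OF l] obj_mor by (auto simp: src_id)
  have "norm (y l) = norm (y ?s)"
    using eq[OF l] eq[OF s(1)] unfolding s(2) by (intro norm_eq_of_cinner) simp
  also have "\<dots> \<le> norm x"
    by (rule norm_le_of_cinner) (use eq[OF s(1)] in \<open>simp only: s(2)\<close>)
  finally show ?thesis by (simp add: y_def x_def)
qed

definition WX :: "'l \<Rightarrow> ('l option \<times> 'h, complex) ell2 \<Rightarrow> ('l option \<times> 'h, complex) ell2" where
  "WX l = (SOME T. bounded_op KX T \<and> (\<forall>i. valid i \<longrightarrow> T (X i) = X (act l i)))"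

lemma WX:
  assumes l: "l \<in> mor \<Lambda>"
  shows "bounded_op KX (WX l)" "valid i \<Longrightarrow> WX l (X i) = X (act l i)"
proof -
  let ?P = "\<lambda>T. bounded_op KX T \<and> (\<forall>i. valid i \<longrightarrow> T (X i) = X (act l i))"
  obtain T where T: "clinear_on KX T"
    "\<And>z. z \<in> KX \<Longrightarrow> T z \<in> closed_cspan ((\<lambda>i. X (act l i)) ` Collect valid)"
    "\<And>i. i \<in> Collect valid \<Longrightarrow> T (X i) = X (act l i)"
    "\<And>z. z \<in> KX \<Longrightarrow> norm (T z) \<le> 1 * norm z"
    using extend_family[of "Collect valid" "\<lambda>i. X (act l i)" 1 X, OF act_bound[OF l]]
    unfolding KX_def by blast
  have "closed_cspan ((\<lambda>i. X (act l i)) ` Collect valid) \<subseteq> KX"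
    unfolding KX_def using valid_act[OF l] by (intro closed_cspan_mono) auto
  then have "bounded_op KX T"
    using T by (intro bounded_opI[of _ _ 1]) auto
  then have "?P T" using T(3) by simp
  then have "?P (WX l)" unfolding WX_def by (rule someI[where P = ?P])
  then show "bounded_op KX (WX l)" "valid i \<Longrightarrow> WX l (X i) = X (act l i)" by blast+
qed

lemma bounded_op_eq_on_KX:
  assumes "bounded_op KX A" "bounded_op KX B"
    and "\<And>i j. valid i \<Longrightarrow> valid j \<Longrightarrow> cinner (X j) (A (X i)) = cinner (X j) (B (X i))" and "x \<in> KX"
  shows "A x = B x"
proof (rule bounded_op_eq_on_cspan[OF KX_def assms(1,2) _ assms(4)])
  fix z assume "z \<in> X ` Collect valid"
  then obtain i where i: "valid i" "z = X i" by auto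
  show "A z = B z"
    unfolding i(2)
    by (rule KX_eqI[OF bounded_opD(1)[OF assms(1) X_in[OF i(1)]] bounded_opD(1)[OF assms(2) X_in[OF i(1)]]])
      (rule assms(3)[OF i(1)])
qed

text \<open>Each relation is tested by inner products of generators, where it is one of the
  \<open>kI_act\<close> identities.\<close>

lemma toeplitz_ops_WX: "toeplitz_ops \<Lambda> KX WX"
proof unfold_locales
  show "closed_csubspace KX" by (rule KX)
  show "bounded_op KX (WX l)" if "l \<in> mor \<Lambda>" for l by (rule WX(1)[OF that])
  show "WX l (WX m x) = WX (cmp \<Lambda> l m) x" if c: "composable l m" and x: "x \<in> KX" for l m x
  proof (rule bounded_op_eq_on_KX[OF _ _ _ x])
    note cD = composableD[OF c]
    show "bounded_op KX (\<lambda>x. WX l (WX m x))" by (rule bounded_op_compose[OF WX(1) WX(1)]) (use cD in auto)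
    show "bounded_op KX (WX (cmp \<Lambda> l m))" by (rule WX(1)[OF cD(4)])
    show "cinner (X j) (WX l (WX m (X i))) = cinner (X j) (WX (cmp \<Lambda> l m) (X i))"
      if ij: "valid i" "valid j" for i j
      using kI_act_act[OF c ij] cD ij kI_commute[of j]
      by (simp add: WX valid_act X)
  qed
  show "adj KX (WX l) (WX l x) = WX (src \<Lambda> l) x" if l: "l \<in> mor \<Lambda>" and x: "x \<in> KX" for l x
  proof (rule bounded_op_eq_on_KX[OF _ _ _ x])
    have s: "src \<Lambda> l \<in> mor \<Lambda>" using src_obj[OF l] obj_mor by blast
    show "bounded_op KX (\<lambda>x. adj KX (WX l) (WX l x))"
      by (rule bounded_op_compose[OF bounded_op_adj[OF KX WX(1)[OF l]] WX(1)[OF l]])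
    show "bounded_op KX (WX (src \<Lambda> l))" by (rule WX(1)[OF s])
    show "cinner (X j) (adj KX (WX l) (WX l (X i))) = cinner (X j) (WX (src \<Lambda> l) (X i))"
      if ij: "valid i" "valid j" for i j
      using kI_act_isometric[OF l ij] l s ij kI_commute[of j] kI_commute[of "act l j"]
      by (simp add: cinner_adj_right[OF KX WX(1)] WX X_in valid_act X)
  qed
  show "adj KX (WX m) (WX l x) = 0"
    if l: "l \<in> mor \<Lambda>" and m: "m \<in> mor \<Lambda>" and d: "deg \<Lambda> l = deg \<Lambda> m" "l \<noteq> m" and x: "x \<in> KX" for l m x
  proof (rule bounded_op_eq_on_KX[OF _ _ _ x])
    show "bounded_op KX (\<lambda>x. adj KX (WX m) (WX l x))"
      by (rule bounded_op_compose[OF bounded_op_adj[OF KX WX(1)[OF m]] WX(1)[OF l]])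
    show "bounded_op KX (\<lambda>x. 0)"
      by (rule bounded_op_zero) (use KX in \<open>simp add: closed_csubspace_def\<close>)
    show "cinner (X j) (adj KX (WX m) (WX l (X i))) = cinner (X j) 0"
      if ij: "valid i" "valid j" for i j
      using kI_act_orthogonal[OF m l d(1)[symmetric] d(2)[symmetric] ij(2,1)] l m ij
      by (simp add: cinner_adj_right[OF KX WX(1)] WX X_in valid_act X cinner.zero_right)
  qed
qed

end

end

lemma isometry_range_closed:
  fixes J :: "'a::chilbert_space \<Rightarrow> 'b::chilbert_space"
  assumes J: "isometry_on UNIV K J"
  shows "closed_csubspace (range J)"
proof -
  have lin: "clinear_on UNIV J" and inner: "cinner (J x) (J y) = cinner x y" for x y
    using J by (auto simp: isometry_on_def)
  have norm: "norm (J x) = norm x" for x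
    by (rule norm_eq_of_cinner) (rule inner)
  have dist: "dist (J x) (J y) = dist x y" for x y
    using norm[of "x - y"] clinear_on_diff[OF csubspace_UNIV lin, of x y] by (simp add: dist_norm)
  have "csubspace (range J)"
    unfolding csubspace_def
    using clinear_on_0[OF csubspace_UNIV lin] clinear_onD[OF lin]
    by (auto simp: image_iff) metis+
  moreover have "closed (range J)"
    unfolding closed_sequential_limits
  proof (intro allI impI)
    fix f l assume f: "(\<forall>n. f n \<in> range J) \<and> f \<longlonglongrightarrow> l"
    then have "\<forall>n. \<exists>x. f n = J x" by blast
    then obtain g where g: "\<And>n. f n = J (g n)" by metis
    have "Cauchy f" using f LIMSEQ_imp_Cauchy by blast
    then have "Cauchy g" unfolding Cauchy_def g dist .
    then obtain x where "g \<longlonglongrightarrow> x" by (auto simp: Cauchy_convergent_iff convergent_def)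
    then have "f \<longlonglongrightarrow> J x" unfolding tendsto_iff g dist .
    then show "l \<in> range J" using f LIMSEQ_unique by blast
  qed
  ultimately show ?thesis by (simp add: closed_csubspace_def)
qed

section \<open>The realised family as a dilation\<close>

context graph_contraction
begin

context
  fixes X :: "'l option \<times> 'h \<Rightarrow> ('l option \<times> 'h, complex) ell2"
  assumes X: "\<And>i j. valid i \<Longrightarrow> valid j \<Longrightarrow> cinner (X i) (X j) = kI i j"
begin

interpretation dil: toeplitz_ops \<Lambda> "KX X" "WX X"
  by (rule toeplitz_ops_WX[OF X])

abbreviation JX :: "'h \<Rightarrow> ('l option \<times> 'h, complex) ell2" where
  "JX h \<equiv> X (None, h)"

text \<open>Nothing in the choice of \<open>X\<close> makes it linear in the vector; linearity
  follows from preservation of inner products.\<close>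

lemma isometry_JX: "isometry_on UNIV (KX X) JX"
proof -
  have inner: "cinner (JX x) (JX y) = cinner x y" for x y by (simp add: X)
  then have "clinear_on UNIV JX" by (intro clinear_on_of_cinner) auto
  then show ?thesis using inner X_in[OF X] by (simp add: isometry_on_def)
qed

lemma WX_JX: "l \<in> mor \<Lambda> \<Longrightarrow> WX X l (JX h) = X (Some l, h)"
  using WX(2)[OF X, of l "(None, h)"] by simp

lemma adj_WX_JX:
  assumes l: "l \<in> mor \<Lambda>"
  shows "adj (KX X) (WX X l) (JX h) = JX (Vs l h)"
proof (rule KX_eqI[OF X])
  have J: "JX h \<in> KX X" for h by (rule X_in[OF X]) auto
  show "adj (KX X) (WX X l) (JX h) \<in> KX X" by (rule dil.Ws_in[OF l J])
  show "JX (Vs l h) \<in> KX X" by (rule J)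
  show "cinner (X i) (adj (KX X) (WX X l) (JX h)) = cinner (X i) (JX (Vs l h))" if i: "valid i" for i
    using kI_act_J[OF l i, of h] i l
    by (simp add: dil.cinner_Ws_right X_in[OF X] J WX(2)[OF X] X valid_act)
qed auto

lemma toeplitz_dilation_X: "toeplitz_dilation \<Lambda> V (KX X) JX (WX X)"
proof -
  have J: "JX h \<in> KX X" for h by (rule X_in[OF X]) auto
  have "proj_onto (range JX) (adj (KX X) (WX X l) (WX X m (JX h))) = JX (Vs l (V m h))"
    if l: "l \<in> mor \<Lambda>" and m: "m \<in> mor \<Lambda>" and d: "\<forall>j. deg \<Lambda> l $ j \<noteq> 0 \<longrightarrow> deg \<Lambda> m $ j = 0" for l m h
  proof (rule proj_onto_eq)
    show "csubspace (range JX)"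
      using isometry_range_closed[OF isometry_JX] by (simp add: closed_csubspace_def)
    show "JX (Vs l (V m h)) \<in> range JX" by blast
    fix z assume "z \<in> range JX"
    then obtain k where z: "z = JX k" by auto
    have v: "vmin (deg \<Lambda> m) (deg \<Lambda> l) = 0"
      unfolding vmin_commute[of "deg \<Lambda> m"] by (rule vmin_eq_0) (use d in blast)
    \<comment> \<open>After the adjoint is moved across, \<open>m\<close> comes first in the kernel;
      with no common degree it is the inner product of \<open>V m h\<close> and
      \<open>V l k\<close>.\<close>
    have "cinner (adj (KX X) (WX X l) (WX X m (JX h))) z = kS m h l k"
      using l m by (simp add: z dil.cinner_Ws_left dil.W_in J) (simp add: WX_JX X)
    also have "\<dots> = cinner (JX (Vs l (V m h))) z"
      using l m by (simp add: z X kS_disjoint v cinner_Vs_left)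
    finally show "cinner (adj (KX X) (WX X l) (WX X m (JX h)) - JX (Vs l (V m h))) z = 0"
      by (simp add: cinner.diff_left)
  qed
  moreover have "adj (KX X) (WX X l) ` range JX \<subseteq> range JX" if "l \<in> mor \<Lambda>" for l
    using adj_WX_JX[OF that] by auto
  ultimately show ?thesis
    unfolding toeplitz_dilation_def
    using dil.K isometry_JX dil.contraction_W dil.toeplitz_family_W by blast
qed

text \<open>The vectors \<open>X (Some a, h)\<close> of the objects \<open>a\<close>, together with \<open>JX h\<close>, have the Gram matrix of
  the \<open>V a h\<close> together with \<open>h\<close>, so nondegeneracy of \<open>V\<close> transfers to the dilation.\<close>

lemma minimal_dilation_X:
  assumes nd: "nondegenerate \<Lambda> V"
  shows "minimal_dilation \<Lambda> (KX X) JX (WX X)"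
  unfolding minimal_dilation_def
proof
  let ?S = "closed_cspan (\<Union>l\<in>mor \<Lambda>. WX X l ` range JX)"
  have J: "JX h \<in> KX X" for h by (rule X_in[OF X]) auto
  show "?S \<subseteq> KX X"
    by (rule closed_cspan_minimal[OF _ dil.K]) (use dil.W_in J in auto)
  have some: "X (Some l, h) \<in> ?S" if "l \<in> mor \<Lambda>" for l h
    by (rule closed_cspan_base, unfold WX_JX[OF that, symmetric]) (use that in blast)
  have none: "JX h \<in> ?S" for h
  proof (rule Lim_in_closed_set)
    let ?F = "finite_subsets_at_top (obj \<Lambda>)"
    let ?p = "\<lambda>F. \<Sum>a\<in>F. X (Some a, h)" and ?q = "\<lambda>F. \<Sum>a\<in>F. V a h"
    have norm: "norm (?p F - JX h) = norm (?q F - h)" if F: "finite F" "F \<subseteq> obj \<Lambda>" for F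
    proof -
      have a: "a \<in> mor \<Lambda>" "deg \<Lambda> a = 0" if "a \<in> F" for a
        using that F obj_mor deg_id by auto
      have v: "vmin 0 0 = (0 :: nat ^ 'r)" by (simp add: vmin_def vec_eq_iff)
      have "cinner (?p F) (?p F) = cinner (?q F) (?q F)"
        unfolding cinner.sum_left unfolding cinner.sum_right
        by (intro sum.cong refl) (simp add: X a kS_disjoint v)
      then have 1: "norm (?p F) = norm (?q F)"
        by (rule norm_eq_of_cinner)
      have 2: "cinner (?p F) (JX h) = cinner (?q F) h"
        unfolding cinner.sum_left by (intro sum.cong refl) (simp add: X a)
      have 3: "norm (JX h) = norm h" by (rule norm_eq_of_cinner) (simp add: X)
      have "(norm (?p F - JX h))\<^sup>2 = (norm (?q F - h))\<^sup>2"
        unfolding norm_diff_sq 1 2 3 ..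
      then show ?thesis by simp
    qed
    have "((\<lambda>F. ?q F - h) \<longlongrightarrow> 0) ?F"
      using nd by (simp add: nondegenerate_def has_sum_def LIM_zero)
    then have "((\<lambda>F. norm (?q F - h)) \<longlongrightarrow> 0) ?F"
      by (rule tendsto_norm_zero)
    moreover have "\<forall>\<^sub>F F in ?F. norm (?q F - h) = norm (?p F - JX h)"
      by (rule eventually_finite_subsets_at_top_weakI) (simp add: norm)
    ultimately have "((\<lambda>F. norm (?p F - JX h)) \<longlongrightarrow> 0) ?F"
      by (rule Lim_transform_eventually)
    then show "(?p \<longlongrightarrow> JX h) ?F"
      by (simp add: tendsto_norm_zero_iff LIM_zero_iff)
    show "\<forall>\<^sub>F F in ?F. ?p F \<in> ?S"
    proof (rule eventually_finite_subsets_at_top_weakI)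
      fix F assume "finite F" "F \<subseteq> obj \<Lambda>"
      then show "?p F \<in> ?S"
        using closed_csubspace_cspan some obj_mor unfolding closed_csubspace_def
        by (blast intro: csubspace_sum)
    qed
    show "closed ?S" using closed_csubspace_cspan by (auto simp: closed_csubspace_def)
  qed simp
  have "X i \<in> ?S" if "valid i" for i
  proof (cases i)
    case (Pair oi h)
    then show ?thesis using that some none by (cases oi) auto
  qed
  then have "X ` Collect valid \<subseteq> ?S" by blast
  then have "closed_cspan (X ` Collect valid) \<subseteq> ?S"
    by (rule closed_cspan_minimal[OF _ closed_csubspace_cspan])
  then show "KX X \<subseteq> ?S"
    using KX_def[OF X] by blast
qed

end

section \<open>Uniqueness of the minimal dilation\<close>

text \<open>Only orthogonality of ranges in equal degree has to be derived. For different range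
  vertices it comes from the vertex projections, in degree zero from orthogonality of vertices, and
  otherwise from the Toeplitz inequality for the two paths.\<close>

lemma toeplitz_ops_of_dilation:
  assumes D: "toeplitz_dilation \<Lambda> V K J W"
  shows "toeplitz_ops \<Lambda> K W"
proof -
  have K: "closed_csubspace K" and C: "contraction \<Lambda> K W" and T: "toeplitz_family \<Lambda> K W"
    using D by (auto simp: toeplitz_dilation_def)
  have sub: "csubspace K" using K by (simp add: closed_csubspace_def)
  have bounded: "bounded_op K (W l)" if "l \<in> mor \<Lambda>" for l
    using C that by (auto simp: contraction_def)
  note W_in = bounded_opD(1)[OF bounded]
  have cmp: "W l (W m x) = W (cmp \<Lambda> l m) x" if "composable l m" "x \<in> K" for l m x
    using T that by (auto simp: toeplitz_family_def composable_def)
  have self: "adj K (W l) (W l x) = W (src \<Lambda> l) x" if "l \<in> mor \<Lambda>" "x \<in> K" for l x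
    using T that by (auto simp: toeplitz_family_def)
  have obj_adj: "adj K (W a) x = W a x" if "a \<in> obj \<Lambda>" "x \<in> K" for a x
    using T that by (auto simp: toeplitz_family_def orth_projection_def)
  have obj_orth: "W a (W b x) = 0" if "a \<in> obj \<Lambda>" "b \<in> obj \<Lambda>" "a \<noteq> b" "x \<in> K" for a b x
    using T that by (auto simp: toeplitz_family_def)
  have le: "op_le K (\<lambda>x. \<Sum>l\<in>F. W l (adj K (W l) x)) (W a)"
    if "a \<in> obj \<Lambda>" "n \<noteq> 0" "finite F" "F \<subseteq> {l \<in> mor_deg \<Lambda> n. rng \<Lambda> l = a}" for a n F
    using T that unfolding toeplitz_family_def by blast
  have om: "a \<in> mor \<Lambda>" if "a \<in> obj \<Lambda>" for a using that obj_mor by blast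
  have orth: "adj K (W m) (W l x) = 0"
    if l: "l \<in> mor \<Lambda>" and m: "m \<in> mor \<Lambda>" and d: "deg \<Lambda> l = deg \<Lambda> m" "l \<noteq> m" and x: "x \<in> K" for l m x
  proof -
    define z where "z = W l x"
    have z: "z \<in> K" by (simp add: z_def W_in l x)
    have rz: "W (rng \<Lambda> l) z = z"
      using cmp[OF composable_id(1)[OF l] x] l by (simp add: z_def cmp_id_left)
    note Az = adj_in[OF K bounded[OF m] z]
    show ?thesis
    proof (cases "rng \<Lambda> l = rng \<Lambda> m")
      case False
      have "cinner y (adj K (W m) z) = 0" if y: "y \<in> K" for y
      proof -
        have "cinner y (adj K (W m) z) = cinner (W m y) (W (rng \<Lambda> l) z)"
          by (simp add: cinner_adj_right[OF K bounded] m y z rz)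
        also have "\<dots> = cinner (adj K (W (rng \<Lambda> l)) (W m y)) z"
          by (rule cinner_adj_left[OF K bounded, symmetric]) (use l m y z W_in om rng_obj in auto)
        also have "adj K (W (rng \<Lambda> l)) (W m y) = W (rng \<Lambda> l) (W (rng \<Lambda> m) (W m y))"
          using cmp[OF composable_id(1)[OF m] y] m by (simp add: obj_adj rng_obj l W_in y cmp_id_left)
        also have "\<dots> = 0" using False by (simp add: obj_orth rng_obj l m W_in y)
        finally show ?thesis by (simp add: cinner.zero_left)
      qed
      then show ?thesis using Az cinner_self_eq_0 unfolding z_def by blast
    next
      case True
      show ?thesis
      proof (cases "deg \<Lambda> l = 0")
        case True
        then have "l \<in> obj \<Lambda>" "m \<in> obj \<Lambda>" using deg_0_obj l m d by auto
        then show ?thesis using d(2) x by (simp add: obj_adj W_in l obj_orth)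
      next
        case deg: False
        \<comment> \<open>At \<open>z\<close> in the range of \<open>W l\<close>, both
          \<open>W (rng \<Lambda> l)\<close> and the term of \<open>l\<close> reproduce
          \<open>z\<close>. What remains is minus the squared norm of \<open>adj K (W m) z\<close>,
          which must be nonnegative.\<close>
        have "op_le K (\<lambda>x. \<Sum>k\<in>{l, m}. W k (adj K (W k) x)) (W (rng \<Lambda> l))"
          by (rule le[OF rng_obj[OF l] deg]) (use l m d True in \<open>auto simp: mor_deg_def\<close>)
        then have "cinner (W (rng \<Lambda> l) z - (\<Sum>k\<in>{l, m}. W k (adj K (W k) z))) z \<in> \<real>\<^sub>\<ge>\<^sub>0"
          using z by (auto simp: op_le_def op_nonneg_def)
        moreover have "W l (adj K (W l) z) = z"
          using self[OF l x] cmp[OF composable_id(2)[OF l] x] l by (simp add: z_def cmp_id_right)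
        ultimately have "cinner (- W m (adj K (W m) z)) z \<in> \<real>\<^sub>\<ge>\<^sub>0"
          using d(2) by (simp add: rz)
        then have "- cinner (adj K (W m) z) (adj K (W m) z) \<in> \<real>\<^sub>\<ge>\<^sub>0"
          by (simp add: cinner.minus_left cinner_adj_right[OF K bounded] m Az z)
        then have "adj K (W m) z = 0"
          by (simp add: cinner_self complex_nonneg_Reals_iff flip: of_real_power)
        then show ?thesis by (simp add: z_def)
      qed
    qed
  qed
  show ?thesis
    by unfold_locales (use K bounded cmp self orth in auto)
qed

lemma gram_of_dilation:
  assumes D: "toeplitz_dilation \<Lambda> V K J W" and l: "l \<in> mor \<Lambda>" and m: "m \<in> mor \<Lambda>"
  shows "cinner (W l (J h)) (W m (J k)) = kS l h m k"
proof -
  interpret dil: toeplitz_ops \<Lambda> K W by (rule toeplitz_ops_of_dilation[OF D])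
  have J: "isometry_on UNIV K J" using D by (simp add: toeplitz_dilation_def)
  then have JK: "J h \<in> K" and inner: "cinner (J h) (J k) = cinner h k" for h k
    by (auto simp: isometry_on_def)
  let ?p = "vmin (deg \<Lambda> l) (deg \<Lambda> m)"
  let ?l = "suf l ?p" and ?m = "suf m ?p"
  note lp = pre_suf[OF l vmin_le(1), of "deg \<Lambda> m"]
  note mp = pre_suf[OF m vmin_le(2), of "deg \<Lambda> l"]
  have Wl: "W l (J h) = W (pre l ?p) (W ?l (J h))"
    using dil.W_cmp[OF lp(1) JK[of h]] lp(7) by simp
  have Wm: "W m (J k) = W (pre m ?p) (W ?m (J k))"
    using dil.W_cmp[OF mp(1) JK[of k]] mp(7) by simp
  have lK: "W ?l (J h) \<in> K" and mK: "W ?m (J k) \<in> K"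
    using dil.W_in[OF lp(3) JK] dil.W_in[OF mp(3) JK] by auto
  show ?thesis
  proof (cases "pre l ?p = pre m ?p")
    case False
    have "cinner (W l (J h)) (W m (J k)) = 0"
      unfolding Wl Wm
      by (rule dil.W_orthogonal[OF lp(2) mp(2) _ False lK mK]) (simp only: lp(4) mp(4))
    then show ?thesis using False by (simp add: kS_def Let_def)
  next
    case True
    have "cinner (W l (J h)) (W m (J k)) = cinner (W (src \<Lambda> (pre l ?p)) (W ?l (J h))) (W ?m (J k))"
      unfolding Wl Wm True[symmetric] by (rule dil.W_isometric[OF lp(2) lK mK])
    also have "\<dots> = cinner (W ?l (J h)) (W ?m (J k))"
      unfolding lp(6) by (simp add: dil.W_rng lp(3) JK)
    also have "\<dots> = cinner (adj K (W ?m) (W ?l (J h))) (J k)"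
      by (rule dil.cinner_Ws_left[OF mp(3) lK JK, symmetric])
    \<comment> \<open>Pairing with a vector of \<open>range J\<close> does not see the projection
      onto that range; this brings in the compression formula of the dilation.\<close>
    also have "\<dots> = cinner (proj_onto (range J) (adj K (W ?m) (W ?l (J h)))) (J k)"
      by (rule cinner_proj_onto[OF isometry_range_closed[OF J], symmetric]) blast
    also have "proj_onto (range J) (adj K (W ?m) (W ?l (J h))) = J (Vs ?m (V ?l h))"
    proof -
      \<comment> \<open>Once the minimum is subtracted from both degrees, one of them is zero in
        every coordinate.\<close>
      have "\<forall>j. deg \<Lambda> ?m $ j \<noteq> 0 \<longrightarrow> deg \<Lambda> ?l $ j = 0"
        unfolding lp(5) mp(5) by (auto simp: vmin_def)
      then show ?thesis using D lp(3) mp(3) unfolding toeplitz_dilation_def by blast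
    qed
    also have "cinner (J (Vs ?m (V ?l h))) (J k) = cinner (V ?l h) (V ?m k)"
      by (simp add: inner cinner_Vs_left mp(3))
    finally show ?thesis using True by (simp add: kS_def Let_def)
  qed
qed

text \<open>\<open>gram_of_dilation\<close> gives both generating families the same Gram matrix,
  hence a unitary between the spaces. On generators the intertwining relation is composition of
  paths, or both sides vanish.\<close>

lemma minimal_dilation_unique:
  fixes K :: "'k::chilbert_space set" and K' :: "'m::chilbert_space set"
  assumes D: "toeplitz_dilation \<Lambda> V K J W" and M: "minimal_dilation \<Lambda> K J W"
    and D': "toeplitz_dilation \<Lambda> V K' J' W'" and M': "minimal_dilation \<Lambda> K' J' W'"
  shows "unitarily_equivalent \<Lambda> K W K' W'"
proof -
  interpret d: toeplitz_ops \<Lambda> K W by (rule toeplitz_ops_of_dilation[OF D])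
  interpret d': toeplitz_ops \<Lambda> K' W' by (rule toeplitz_ops_of_dilation[OF D'])
  let ?I = "mor \<Lambda> \<times> (UNIV :: 'h set)"
  let ?x = "\<lambda>(l, h). W l (J h)" and ?y = "\<lambda>(l, h). W' l (J' h)"
  have "?x ` ?I = (\<Union>l\<in>mor \<Lambda>. W l ` range J)" "?y ` ?I = (\<Union>l\<in>mor \<Lambda>. W' l ` range J')"
    by force+
  then have K: "closed_cspan (?x ` ?I) = K" "closed_cspan (?y ` ?I) = K'"
    using M M' by (simp_all add: minimal_dilation_def)
  have gram: "cinner (?x i) (?x j) = cinner (?y i) (?y j)" if "i \<in> ?I" "j \<in> ?I" for i j
    using that gram_of_dilation[OF D] gram_of_dilation[OF D'] by auto
  obtain U where U: "unitary_on K K' U" and Ux: "\<And>i. i \<in> ?I \<Longrightarrow> U (?x i) = ?y i"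
    by (rule unitary_of_gram[of ?I ?x ?y, OF gram, unfolded K]) auto
  have lin: "clinear_on K U" and UK: "\<And>z. z \<in> K \<Longrightarrow> U z \<in> K'"
    and inner: "\<And>z. z \<in> K \<Longrightarrow> cinner (U z) (U z) = cinner z z"
    using U by (auto simp: unitary_on_def isometry_on_def)
  have Ugen: "U (W l (J h)) = W' l (J' h)" if "l \<in> mor \<Lambda>" for l h
    using Ux[of "(l, h)"] that by simp
  have norm: "norm (U z) = norm z" if "z \<in> K" for z
    by (rule norm_eq_of_cinner) (rule inner[OF that])
  have JK: "J h \<in> K" "J' h \<in> K'" for h
    using D D' by (auto simp: toeplitz_dilation_def isometry_on_def)
  have "U (W m z) = W' m (U z)" if m: "m \<in> mor \<Lambda>" and z: "z \<in> K" for m z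
  proof -
    let ?T = "\<lambda>z. U (W m z) - W' m (U z)"
    \<comment> \<open>\<open>?T\<close> maps between two different spaces, so the kernel lemma is
      applied directly; the bound 2 arises because both terms are contractive.\<close>
    have "closed_csubspace {z \<in> K. ?T z = 0}"
    proof (rule closed_csubspace_kernel[OF d.K, of _ 2])
      show "clinear_on K ?T"
        using lin UK d.W_in[OF m] bounded_opD(2)[OF d.W_bounded[OF m]]
          bounded_opD(2)[OF d'.W_bounded[OF m]]
        by (auto simp: clinear_on_def scaleC.diff_right)
      show "norm (?T z) \<le> 2 * norm z" if "z \<in> K" for z
      proof -
        have "norm (U (W m z)) \<le> norm z" using norm d.W_in[OF m that] d.norm_W_le[OF m that] by simp
        moreover have "norm (W' m (U z)) \<le> norm z"
          using d'.norm_W_le[OF m UK[OF that]] norm[OF that] by simp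
        ultimately show ?thesis using norm_triangle_ineq4[of "U (W m z)" "W' m (U z)"] by simp
      qed
    qed
    moreover have "?x ` ?I \<subseteq> {z \<in> K. ?T z = 0}"
    proof clarsimp
      fix l h assume l: "l \<in> mor \<Lambda>"
      show "W l (J h) \<in> K \<and> U (W m (W l (J h))) = W' m (U (W l (J h)))"
      proof (cases "src \<Lambda> m = rng \<Lambda> l")
        case True
        then have c: "composable m l" using l m by (simp add: composable_def)
        then show ?thesis
          using composableD(4)[OF c] JK l by (simp add: d.W_cmp d'.W_cmp Ugen d.W_in)
      next
        case False
        then show ?thesis
          using l m JK clinear_on_0[OF d.sub lin]
          by (simp add: d.W_not_composable d'.W_not_composable Ugen d.W_in)
      qed
    qed
    ultimately have "closed_cspan (?x ` ?I) \<subseteq> {z \<in> K. ?T z = 0}"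
      by (rule closed_cspan_minimal[rotated])
    then show ?thesis using z unfolding K by auto
  qed
  then show ?thesis
    unfolding unitarily_equivalent_def using U by blast
qed

end

theorem theorem5p3:
  fixes \<Lambda> :: "('l, 'r::finite) rank_graph_data"
    and V :: "'l \<Rightarrow> 'h::chilbert_space \<Rightarrow> 'h"
  assumes "rank_graph \<Lambda>"
    and "contraction \<Lambda> UNIV V"
    and "\<And>v :: 'r set. op_nonneg (E_space \<Lambda> V v) (\<lambda>f. \<Sum>u\<in>Pow v. (-1) ^ card u *\<^sub>R P_op \<Lambda> V u v f)"
  shows "(\<exists>(K :: ('l option \<times> 'h, complex) ell2 set) J W. toeplitz_dilation \<Lambda> V K J W) \<and>
    (nondegenerate \<Lambda> V \<longrightarrow>
      (\<exists>(K :: ('l option \<times> 'h, complex) ell2 set) J W.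
         toeplitz_dilation \<Lambda> V K J W \<and> minimal_dilation \<Lambda> K J W)) \<and>
    (\<forall>(K :: 'k::chilbert_space set) J W (K' :: 'm::chilbert_space set) J' W'.
       toeplitz_dilation \<Lambda> V K J W \<and> minimal_dilation \<Lambda> K J W \<and>
       toeplitz_dilation \<Lambda> V K' J' W' \<and> minimal_dilation \<Lambda> K' J' W' \<longrightarrow>
       unitarily_equivalent \<Lambda> K W K' W')"
proof -
  interpret rank_graph \<Lambda> by (rule assms(1))
  interpret graph_contraction \<Lambda> V by unfold_locales (rule assms(2))
  \<comment> \<open>One realisation serves both existence claims; nondegeneracy enters only in the
    proof that it is minimal.\<close>
  obtain X :: "'l option \<times> 'h \<Rightarrow> ('l option \<times> 'h, complex) ell2"
    where X: "\<And>i j. valid i \<Longrightarrow> valid j \<Longrightarrow> cinner (X i) (X j) = kI i j"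
    using realisation_exists[OF assms(3)] by blast
  show ?thesis
    using toeplitz_dilation_X[OF X] minimal_dilation_X[OF X] minimal_dilation_unique by blast
qed

end
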